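(* Let $A(x)=A_0+\mathrm{Diag}(x)$, with $A_0\in K(H)^{sa}$ and $x\in c_0$ such that $\lambda_{\max}(A(x))=-\lambda_{\min}(A(x))$. Let $S_{\max}$ and $S_{\min}$ be the eigenspaces of $\lambda_{\max}(A(x))$ and $\lambda_{\min}(A(x))$, respectively. Then the following statements are equivalent: (1) $0\in\partial\big(\|A(x)\|\big)$. (2) $0\in\partial\lambda_{\max}(A(x))+\partial\lambda_{\min}(A(x))$. (3) $m_{S_{\max}}\cap m_{S_{\min}}\neq\emptyset$. (4) $W\left(\{P_{S_{\max}}e_ie_i^*P_{S_{\max}}\}_{i=1}^\infty\right)\cap W\left(\{P_{S_{\min}}e_ie_i^*P_{S_{\min}}\}_{i=1}^\infty\right)\neq\{(0,\dots,0,\dots)\}$. (5) There exist $m\in\mathbb{N}$, concrete C$^*$-isomorphisms $U_{S_{\max}}:M_{\dim(S_{\max})}(\mathbb{C})\to P_{S_{\max}}B(H)P_{S_{\max}}$ and $U_{S_{\min}}:M_{\dim(S_{\min})}(\mathbb{C})\to P_{S_{\min}}B(H)P_{S_{\min}}$, and matrices $\{B_j\}_{j=1}^m\subset M^h_{\dim(S_{\max})}(\mathbb{C})$ and $\{C_j\}_{j=1}^m\subset M^h_{\dim(S_{\min})}(\mathbb{C})$ with $B_j=U_{S_{\max}}^{-1}(P_{S_{\max}}e_je_j^*P_{S_{\max}})$ and $C_j=U_{S_{\min}}^{-1}(P_{S_{\min}}e_je_j^*P_{S_{\min}})$, such that $$W(\{B_j\}_{j=1}^m)\cap W(\{C_j\}_{j=1}^m)\neq\{(0,\dots,0)\}.$$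 (6) $A(x)$ is minimal, that is, $\|A(x)\|\le\|A(x)+D\|$ for every diagonal $D$.
   Context: $H$ is a separable complex Hilbert space with a fixed orthonormal basis $\{e_i\}_{i\in\mathbb{N}}$; "diagonal" refers to operators in $B(H)$ diagonal in this basis. $\|\cdot\|$ is the operator norm, $B(H)$ the bounded operators, $K(H)^{sa}$ the self-adjoint compact operators, $B_1(H)^{sa}$ the self-adjoint trace class operators, $c_0$ the real sequences converging to $0$, $\mathrm{Diag}(x)=\sum_kx_ke_ke_k^*$, $M_r(\mathbb{C})$ the $r\times r$ complex matrices and $M_r^h(\mathbb{C})$ the Hermitian ones. $\lambda_{\max}(C)$ and $\lambda_{\min}(C)$ are the maximum and minimum of the spectrum of $C\in K(H)^{sa}$. For a convex $f:\mathcal{X}\to\mathbb{R}$ on a Banach space, $\partial f(x)=\{v\in\mathcal{X}^*: f(y)-f(x)\ge\mathrm{Re}\,v(y-x)\ \forall y\in\mathcal{X}\}$. Here $\partial(\|A(x)\|)$ and $\partial\lambda_{\max}(A(x))$ are the subdifferentials at $x$ of the functions $y\mapsto\|A(y)\|$ and $y\mapsto\lambda_{\max}(A(y))$ on $c_0$, and $\partial\lambda_{\min}(A(x))$ stands for the subdifferential at $x$ of the convex function $y\mapsto-\lambda_{\min}(A(y))$ on $c_0$. For a subspace $S$, $P_S$ is the orthogonal projection onto $S$, and the moment of $S$ is $m_S=\mathrm{co}\{|v|^2: v\in S,\ \|v\|=1\}$, where $\mathrm{co}$ is the convex hull and $|v|^2=(|v_1|^2,|v_2|^2,\dots)$ with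 $v_k$ the coordinates of $v$ in the fixed basis. The joint numerical range of a norm-bounded sequence $\{A_j\}_{j=1}^\infty$ of self-adjoint compact operators is $W(\{A_j\}_{j=1}^\infty)=\{\{\mathrm{tr}(\rho A_j)\}_{j=1}^\infty:\rho\in B_1(H)^{sa},\ \rho\ge0,\ \mathrm{tr}(\rho)=1\}$; for a finite family of Hermitian $r\times r$ matrices it is $W(\{B_j\}_{j=1}^m)=\{\{\mathrm{tr}(\rho B_j)\}_{j=1}^m:\rho\in M_r^h(\mathbb{C}),\ \rho\ge0,\ \mathrm{tr}(\rho)=1\}$.
   Formalization: Item (5) is asserted only for A(x) ≠ 0 (otherwise dim S is infinite), and its condition is mended: there is m such that for every n ≥ m the two ranges of the first n matrices share a nonzero vector; with a single m and "≠ {0}", (5) does not imply (3). *)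

theory Defs
  imports "HOL-Analysis.Analysis" "Jordan_Normal_Form.Schur_Decomposition"
begin

section \<open>Complex Hilbert spaces\<close>

text \<open>The inner product is linear in the first argument.\<close>

class complex_hilbert = banach +
  fixes scaleC :: "complex \<Rightarrow> 'a \<Rightarrow> 'a" (infixr \<open>*\<^sub>C\<close> 75)
    and cinner :: "'a \<Rightarrow> 'a \<Rightarrow> complex"
  assumes scaleC_add_right: "a *\<^sub>C (x + y) = a *\<^sub>C x + a *\<^sub>C y"
    and scaleC_add_left: "(a + b) *\<^sub>C x = a *\<^sub>C x + b *\<^sub>C x"
    and scaleC_scaleC: "a *\<^sub>C b *\<^sub>C x = (a * b) *\<^sub>C x"
    and scaleC_one: "1 *\<^sub>C x = x"
    and scaleR_scaleC: "r *\<^sub>R x = complex_of_real r *\<^sub>C x"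
    and cinner_commute: "cinner x y = cnj (cinner y x)"
    and cinner_add_left: "cinner (x + y) z = cinner x z + cinner y z"
    and cinner_scaleC_left: "cinner (a *\<^sub>C x) y = a * cinner x y"
    and cinner_self: "cinner x x = complex_of_real ((norm x)\<^sup>2)"

interpretation complex_vector: vector_space "scaleC :: complex \<Rightarrow> 'a::complex_hilbert \<Rightarrow> 'a"
  by unfold_locales (simp_all add: scaleC_add_right scaleC_add_left scaleC_scaleC scaleC_one)

definition orthonormal_basis :: "(nat \<Rightarrow> 'h::complex_hilbert) \<Rightarrow> bool" where
  "orthonormal_basis e \<longleftrightarrow>
     (\<forall>j k. cinner (e j) (e k) = (if j = k then 1 else 0)) \<and>
     closure (complex_vector.span (range e)) = UNIV"

section \<open>Bounded operators\<close>

text \<open>The library type of bounded linear maps consists of the real-linear ones;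
  \<open>B(H)\<close> is its complex-linear part. Its norm is the operator norm.\<close>

definition bounded_ops :: "('h::complex_hilbert \<Rightarrow>\<^sub>L 'h) set" where
  "bounded_ops = {T. \<forall>c v. blinfun_apply T (c *\<^sub>C v) = c *\<^sub>C blinfun_apply T v}"

definition selfadjoint :: "('h::complex_hilbert \<Rightarrow>\<^sub>L 'h) \<Rightarrow> bool" where
  "selfadjoint T \<longleftrightarrow> T \<in> bounded_ops \<and>
     (\<forall>u v. cinner (blinfun_apply T u) v = cinner u (blinfun_apply T v))"

definition positive_op :: "('h::complex_hilbert \<Rightarrow>\<^sub>L 'h) \<Rightarrow> bool" where
  "positive_op T \<longleftrightarrow> selfadjoint T \<and> (\<forall>v. 0 \<le> Re (cinner (blinfun_apply T v) v))"

definition compact_sa_ops :: "('h::complex_hilbert \<Rightarrow>\<^sub>L 'h) set" where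
  "compact_sa_ops = {T. selfadjoint T \<and> compact (closure (blinfun_apply T ` cball 0 1))}"

definition diagonal_op :: "(nat \<Rightarrow> 'h::complex_hilbert) \<Rightarrow> ('h \<Rightarrow>\<^sub>L 'h) \<Rightarrow> bool" where
  "diagonal_op e D \<longleftrightarrow> D \<in> bounded_ops \<and>
     (\<forall>j k. j \<noteq> k \<longrightarrow> cinner (blinfun_apply D (e j)) (e k) = 0)"

text \<open>The rank-one operator \<open>v v\<^sup>*\<close>.\<close>

definition outer :: "'h::complex_hilbert \<Rightarrow> ('h \<Rightarrow>\<^sub>L 'h)" where
  "outer v = Blinfun (\<lambda>u. cinner u v *\<^sub>C v)"

definition orth_proj :: "'h::complex_hilbert set \<Rightarrow> ('h \<Rightarrow>\<^sub>L 'h)" where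
  "orth_proj S = (THE P. P \<in> bounded_ops \<and>
     (\<forall>v. blinfun_apply P v \<in> S \<and> (\<forall>s\<in>S. cinner (v - blinfun_apply P v) s = 0)))"

text \<open>The map \<open>T \<mapsto> P\<^sub>S T P\<^sub>S\<close>.\<close>

definition compression :: "'h::complex_hilbert set \<Rightarrow> ('h \<Rightarrow>\<^sub>L 'h) \<Rightarrow> ('h \<Rightarrow>\<^sub>L 'h)" where
  "compression S T = orth_proj S o\<^sub>L T o\<^sub>L orth_proj S"

definition spectrum_op :: "('h::complex_hilbert \<Rightarrow>\<^sub>L 'h) \<Rightarrow> complex set" where
  "spectrum_op T = {z. \<not> (\<exists>R\<in>bounded_ops. \<forall>v.
     blinfun_apply R (blinfun_apply T v - z *\<^sub>C v) = v \<and>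
     blinfun_apply T (blinfun_apply R v) - z *\<^sub>C blinfun_apply R v = v)}"

definition lambda_max :: "('h::complex_hilbert \<Rightarrow>\<^sub>L 'h) \<Rightarrow> real" where
  "lambda_max T = (GREATEST r. complex_of_real r \<in> spectrum_op T)"

definition lambda_min :: "('h::complex_hilbert \<Rightarrow>\<^sub>L 'h) \<Rightarrow> real" where
  "lambda_min T = (LEAST r. complex_of_real r \<in> spectrum_op T)"

definition eigenspace_op :: "('h::complex_hilbert \<Rightarrow>\<^sub>L 'h) \<Rightarrow> real \<Rightarrow> 'h set" where
  "eigenspace_op T r = {v. blinfun_apply T v = r *\<^sub>R v}"

section \<open>Trace class operators, moments and joint numerical ranges\<close>

text \<open>In \<open>trace_class\<close> the operator \<open>R\<close> is \<open>|T|\<close>: it is positive, and the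
  condition on inner products says \<open>R\<^sup>2 = T\<^sup>* T\<close>.\<close>

definition trace_class :: "(nat \<Rightarrow> 'h::complex_hilbert) \<Rightarrow> ('h \<Rightarrow>\<^sub>L 'h) \<Rightarrow> bool" where
  "trace_class e T \<longleftrightarrow> T \<in> bounded_ops \<and>
     (\<exists>R. positive_op R \<and>
        (\<forall>u v. cinner (blinfun_apply R u) (blinfun_apply R v) =
               cinner (blinfun_apply T u) (blinfun_apply T v)) \<and>
        (\<lambda>k. cinner (blinfun_apply R (e k)) (e k)) summable_on UNIV)"

definition trace_op :: "(nat \<Rightarrow> 'h::complex_hilbert) \<Rightarrow> ('h \<Rightarrow>\<^sub>L 'h) \<Rightarrow> complex" where
  "trace_op e T = (\<Sum>\<^sub>\<infinity>k. cinner (blinfun_apply T (e k)) (e k))"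

definition joint_numerical_range ::
  "(nat \<Rightarrow> 'h::complex_hilbert) \<Rightarrow> (nat \<Rightarrow> ('h \<Rightarrow>\<^sub>L 'h)) \<Rightarrow> (nat \<Rightarrow> complex) set" where
  "joint_numerical_range e T = {(\<lambda>j. trace_op e (\<rho> o\<^sub>L T j)) | \<rho>.
     trace_class e \<rho> \<and> selfadjoint \<rho> \<and> positive_op \<rho> \<and> trace_op e \<rho> = 1}"

text \<open>The convex hull of the sequences \<open>|v|\<^sup>2\<close>, written out as the set of finite convex
  combinations because \<open>nat \<Rightarrow> real\<close> is not an instance of \<open>real_vector\<close>.\<close>

definition moment :: "(nat \<Rightarrow> 'h::complex_hilbert) \<Rightarrow> 'h set \<Rightarrow> (nat \<Rightarrow> real) set" where
  "moment e S = {(\<lambda>k. \<Sum>v\<in>F. t v * (cmod (cinner v (e k)))\<^sup>2) | F t.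
     finite F \<and> F \<subseteq> {v \<in> S. norm v = 1} \<and> (\<forall>v\<in>F. 0 \<le> t v) \<and> sum t F = 1}"

section \<open>Matrices\<close>

definition hermitian_mats :: "nat \<Rightarrow> complex mat set" where
  "hermitian_mats r = {X \<in> carrier_mat r r. mat_adjoint X = X}"

definition trace_mat :: "complex mat \<Rightarrow> complex" where
  "trace_mat X = (\<Sum>i<dim_row X. X $$ (i, i))"

definition density_mats :: "nat \<Rightarrow> complex mat set" where
  "density_mats r = {\<rho> \<in> hermitian_mats r.
     (\<forall>v\<in>carrier_vec r. 0 \<le> Re ((\<rho> *\<^sub>v v) \<bullet>c v)) \<and> trace_mat \<rho> = 1}"

text \<open>The joint numerical range of the finite family \<open>B 0, \<dots>, B (m - 1)\<close>.\<close>

definition joint_numerical_range_mat ::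
  "nat \<Rightarrow> nat \<Rightarrow> (nat \<Rightarrow> complex mat) \<Rightarrow> complex vec set" where
  "joint_numerical_range_mat r m B = {vec m (\<lambda>j. trace_mat (\<rho> * B j)) | \<rho>. \<rho> \<in> density_mats r}"

text \<open>The condition with \<open>mat_adjoint\<close> says \<open>U (X\<^sup>*) = (U X)\<^sup>*\<close>.\<close>

definition cstar_iso_corner ::
  "nat \<Rightarrow> 'h::complex_hilbert set \<Rightarrow> (complex mat \<Rightarrow> ('h \<Rightarrow>\<^sub>L 'h)) \<Rightarrow> bool" where
  "cstar_iso_corner r S U \<longleftrightarrow>
     bij_betw U (carrier_mat r r) (compression S ` bounded_ops) \<and>
     (\<forall>X\<in>carrier_mat r r. \<forall>Y\<in>carrier_mat r r. U (X + Y) = U X + U Y) \<and>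
     (\<forall>c. \<forall>X\<in>carrier_mat r r. \<forall>v.
        blinfun_apply (U (c \<cdot>\<^sub>m X)) v = c *\<^sub>C blinfun_apply (U X) v) \<and>
     (\<forall>X\<in>carrier_mat r r. \<forall>Y\<in>carrier_mat r r. U (X * Y) = U X o\<^sub>L U Y) \<and>
     (\<forall>X\<in>carrier_mat r r. \<forall>u v.
        cinner (blinfun_apply (U X) u) v = cinner u (blinfun_apply (U (mat_adjoint X)) v))"

section \<open>The Banach space of real null sequences\<close>

typedef c0 = "{x :: nat \<Rightarrow> real. x \<longlonglongrightarrow> 0}"
  morphisms c0_nth Abs_c0
  by (rule exI[of _ "\<lambda>_. 0"]) simp

setup_lifting type_definition_c0

lemma c0_eqI: "(\<And>k. c0_nth x k = c0_nth y k) \<Longrightarrow> x = y"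
  by transfer auto

lemma c0_nth_tendsto: "c0_nth x \<longlonglongrightarrow> 0"
  using c0_nth[of x] by simp

lemma c0_bdd_above: "bdd_above (range (\<lambda>k. \<bar>c0_nth x k\<bar>))"
proof -
  have "Bseq (c0_nth x)"
    using c0_nth_tendsto by (intro convergent_imp_Bseq convergentI)
  then obtain K where "\<And>k. norm (c0_nth x k) \<le> K"
    by (auto simp: Bseq_def)
  then show ?thesis
    by (intro bdd_aboveI[of _ K]) auto
qed

instantiation c0 :: real_vector
begin

lift_definition zero_c0 :: c0 is "\<lambda>_. 0" by simp
lift_definition plus_c0 :: "c0 \<Rightarrow> c0 \<Rightarrow> c0" is "\<lambda>x y k. x k + y k"
  by (auto intro: tendsto_add_zero)
lift_definition uminus_c0 :: "c0 \<Rightarrow> c0" is "\<lambda>x k. - x k"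
  using tendsto_minus by fastforce
lift_definition minus_c0 :: "c0 \<Rightarrow> c0 \<Rightarrow> c0" is "\<lambda>x y k. x k - y k"
  using tendsto_diff by fastforce
lift_definition scaleR_c0 :: "real \<Rightarrow> c0 \<Rightarrow> c0" is "\<lambda>a x k. a * x k"
  by (auto intro: tendsto_mult_right_zero)

instance
  by (standard; transfer) (auto simp: algebra_simps)

end

instantiation c0 :: real_normed_vector
begin

definition norm_c0 :: "c0 \<Rightarrow> real" where
  "norm_c0 x = (SUP k. \<bar>c0_nth x k\<bar>)"
definition sgn_c0 :: "c0 \<Rightarrow> c0" where
  "sgn_c0 x = x /\<^sub>R norm x"
definition dist_c0 :: "c0 \<Rightarrow> c0 \<Rightarrow> real" where
  "dist_c0 x y = norm (x - y)"
definition uniformity_c0 :: "(c0 \<times> c0) filter" where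
  "uniformity_c0 = (INF e\<in>{0 <..}. principal {(x, y). dist x y < e})"
definition open_c0 :: "c0 set \<Rightarrow> bool" where
  "open_c0 S = (\<forall>x\<in>S. \<forall>\<^sub>F (x', y) in uniformity. x' = x \<longrightarrow> y \<in> S)"

lemma c0_nth_le_norm: "\<bar>c0_nth x k\<bar> \<le> norm x"
  unfolding norm_c0_def by (intro cSUP_upper c0_bdd_above) simp

lemma c0_norm_le: "(\<And>k. \<bar>c0_nth x k\<bar> \<le> b) \<Longrightarrow> norm x \<le> b"
  unfolding norm_c0_def by (intro cSUP_least) auto

instance
proof
  fix x y :: c0 and a :: real
  show "norm x = 0 \<longleftrightarrow> x = 0"
  proof
    assume "norm x = 0"
    then show "x = 0"
      using c0_nth_le_norm[of x] by (intro c0_eqI) (simp add: zero_c0.rep_eq)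
  qed (simp add: norm_c0_def zero_c0.rep_eq)
  show "norm (x + y) \<le> norm x + norm y"
  proof (rule c0_norm_le)
    fix k
    show "\<bar>c0_nth (x + y) k\<bar> \<le> norm x + norm y"
      using c0_nth_le_norm[of x k] c0_nth_le_norm[of y k] by (simp add: plus_c0.rep_eq)
  qed
  have le: "norm (b *\<^sub>R z) \<le> \<bar>b\<bar> * norm z" for b :: real and z :: c0
    by (rule c0_norm_le) (simp add: scaleR_c0.rep_eq abs_mult c0_nth_le_norm mult_left_mono)
  show "norm (a *\<^sub>R x) = \<bar>a\<bar> * norm x"
  proof (cases "a = 0")
    case True
    then show ?thesis
      by (simp add: norm_c0_def zero_c0.rep_eq)
  next
    case False
    have "norm (inverse a *\<^sub>R a *\<^sub>R x) \<le> \<bar>inverse a\<bar> * norm (a *\<^sub>R x)"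
      by (rule le)
    with False have "norm x \<le> \<bar>inverse a\<bar> * norm (a *\<^sub>R x)"
      by simp
    with False have "\<bar>a\<bar> * norm x \<le> norm (a *\<^sub>R x)"
      by (simp add: abs_inverse field_simps)
    with le[of a x] show ?thesis
      by simp
  qed
qed (simp_all add: sgn_c0_def dist_c0_def uniformity_c0_def open_c0_def)

end

instance c0 :: banach
proof
  fix X :: "nat \<Rightarrow> c0"
  assume X: "Cauchy X"
  have coord: "\<bar>c0_nth (X m) k - c0_nth (X n) k\<bar> \<le> dist (X m) (X n)" for m n k
    using c0_nth_le_norm[of "X m - X n" k] by (simp add: dist_norm minus_c0.rep_eq)
  have "Cauchy (\<lambda>n. c0_nth (X n) k)" for k
    unfolding Cauchy_def
  proof (intro allI impI)
    fix r :: real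
    assume "0 < r"
    then obtain M where "\<forall>m\<ge>M. \<forall>n\<ge>M. dist (X m) (X n) < r"
      using X unfolding Cauchy_def by blast
    then show "\<exists>M. \<forall>m\<ge>M. \<forall>n\<ge>M. dist (c0_nth (X m) k) (c0_nth (X n) k) < r"
      using coord by (metis dist_real_def order_le_less_trans)
  qed
  then have "\<exists>l. (\<lambda>n. c0_nth (X n) k) \<longlonglongrightarrow> l" for k
    using Cauchy_convergent convergent_def by blast
  then obtain l where l: "\<And>k. (\<lambda>n. c0_nth (X n) k) \<longlonglongrightarrow> l k"
    by metis
  have unif: "\<exists>M. \<forall>n\<ge>M. \<forall>k. \<bar>c0_nth (X n) k - l k\<bar> \<le> r" if "0 < r" for r
  proof -
    obtain M where M: "\<forall>m\<ge>M. \<forall>n\<ge>M. dist (X m) (X n) < r"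
      using X \<open>0 < r\<close> unfolding Cauchy_def by blast
    have "\<bar>c0_nth (X n) k - l k\<bar> \<le> r" if "n \<ge> M" for n k
    proof (rule tendsto_upperbound)
      show "(\<lambda>m. \<bar>c0_nth (X n) k - c0_nth (X m) k\<bar>) \<longlonglongrightarrow> \<bar>c0_nth (X n) k - l k\<bar>"
        by (intro tendsto_intros l)
      show "\<forall>\<^sub>F m in sequentially. \<bar>c0_nth (X n) k - c0_nth (X m) k\<bar> \<le> r"
        using M coord \<open>n \<ge> M\<close> unfolding eventually_sequentially
        by (meson less_imp_le order_trans)
    qed simp
    then show ?thesis by blast
  qed
  have "l \<longlonglongrightarrow> 0"
  proof (rule LIMSEQ_I)
    fix r :: real
    assume "0 < r"
    then obtain n where n: "\<And>k. \<bar>c0_nth (X n) k - l k\<bar> \<le> r / 2"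
      using unif[of "r / 2"] by auto
    obtain K where K: "\<And>k. k \<ge> K \<Longrightarrow> \<bar>c0_nth (X n) k\<bar> < r / 2"
      using LIMSEQ_D[OF c0_nth_tendsto[of "X n"], of "r / 2"] \<open>0 < r\<close> by auto
    have "norm (l k - 0) < r" if "k \<ge> K" for k
      using n[of k] K[OF that] unfolding real_norm_def diff_0_right by arith
    then show "\<exists>K. \<forall>k\<ge>K. norm (l k - 0) < r" by blast
  qed
  then have L: "c0_nth (Abs_c0 l) = l"
    by (simp add: Abs_c0_inverse)
  have "X \<longlonglongrightarrow> Abs_c0 l"
  proof (rule LIMSEQ_I)
    fix r :: real
    assume "0 < r"
    then obtain M where M: "\<forall>n\<ge>M. \<forall>k. \<bar>c0_nth (X n) k - l k\<bar> \<le> r / 2"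
      using unif[of "r / 2"] by auto
    have "norm (X n - Abs_c0 l) < r" if "n \<ge> M" for n
    proof -
      have "norm (X n - Abs_c0 l) \<le> r / 2"
        using M that by (intro c0_norm_le) (simp add: minus_c0.rep_eq L)
      with \<open>0 < r\<close> show ?thesis by simp
    qed
    then show "\<exists>M. \<forall>n\<ge>M. norm (X n - Abs_c0 l) < r" by blast
  qed
  then show "convergent X"
    by (auto simp: convergent_def)
qed

text \<open>\<open>Diag(x)\<close>; the series converges in operator norm.\<close>

definition Diag :: "(nat \<Rightarrow> 'h::complex_hilbert) \<Rightarrow> c0 \<Rightarrow> ('h \<Rightarrow>\<^sub>L 'h)" where
  "Diag e x = (\<Sum>k. c0_nth x k *\<^sub>R outer (e k))"

text \<open>For a real Banach space the dual is \<open>'a \<Rightarrow>\<^sub>L real\<close>, and no real part is needed.\<close>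

definition subdifferential :: "('a::banach \<Rightarrow> real) \<Rightarrow> 'a \<Rightarrow> ('a \<Rightarrow>\<^sub>L real) set" where
  "subdifferential f x = {\<phi>. \<forall>y. f y - f x \<ge> blinfun_apply \<phi> (y - x)}"

end

theory Submission
  imports Defs
begin

text \<open>For a self-adjoint operator the extreme spectral values are the extreme values of the quadratic
  form, so convex combinations of unit vectors in the two extreme eigenspaces bound \<open>\<parallel>A x + D\<parallel>\<close> from
  below. If two such combinations have the same diagonal, a diagonal \<open>D\<close> contributes equally to both
  and cancels; hence a common point of the moments gives minimality and the pair of opposite
  subgradients. Conversely, if the moments are disjoint, then \<open>0\<close> is not in the compact convex hull of
  \<open>m(S\<^sub>m\<^sub>a\<^sub>x) \<union> - m(S\<^sub>m\<^sub>i\<^sub>n)\<close>, because the entries of points of the moments sum to \<open>1\<close>. A nearly shortest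
  vector \<open>z\<close> of that hull in \<open>\<ell>\<^sup>2\<close> lies in \<open>c\<^sub>0\<close> and separates it from \<open>0\<close>, and by compactness of \<open>A x\<close> a
  small step in direction \<open>- z\<close> decreases the norm. Elements of the joint numerical ranges are
  diagonals of positive forms on a finite-dimensional space, which a Cholesky decomposition turns into
  points of the moments.\<close>

section \<open>Inner products and positive forms\<close>

text \<open>A point of a moment is carried as a list \<open>ws\<close> of unnormalised vectors, that
  is, as a finite-rank positive operator with trace \<open>mass ws\<close> and diagonal
  \<open>vec_density e ws\<close>. The obstacle is compactness: such lists may be arbitrarily long,
  and a coordinatewise limit could lose mass. Cholesky cures both: in a d-dimensional eigenspace
  every list can be replaced by d vectors with the same mass and diagonal, and these converge in
  norm along a subsequence. Finite dimension needs a nonzero eigenvalue of the compact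
  \<open>A x\<close>; if \<open>A x = 0\<close>, both eigenspaces are the whole space and
  \<open>e 0\<close> serves as a common witness. The joint numerical ranges of \<open>s4\<close> and
  \<open>s5\<close> are normalised differently. In \<open>s4\<close> a density operator may live off
  the eigenspace, so 0 lies in both ranges and a nonzero common point must be rescaled to reach the
  moments. In \<open>s5\<close> the trace is one on the eigenspace itself, but only finitely many
  coordinates are compared. Agreement for every large \<open>n\<close> therefore leads back to
  \<open>s1\<close>, where a direction in \<open>c0\<close> hardly sees the remaining
  coordinates.\<close>

lemma cnj_cinner [simp]: "cnj (cinner x y) = cinner (y::'h::complex_hilbert) x"
  by (rule cinner_commute[symmetric])

lemma cinner_add_right: "cinner x (y + z) = cinner x y + cinner (x::'h::complex_hilbert) z"
  by (metis cinner_add_left cinner_commute complex_cnj_add)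

lemma cinner_scaleC_right: "cinner x (a *\<^sub>C y) = cnj a * cinner (x::'h::complex_hilbert) y"
  by (metis cinner_commute cinner_scaleC_left complex_cnj_mult)

lemma cinner_zero_left [simp]: "cinner 0 (x::'h::complex_hilbert) = 0"
  using cinner_add_left[of 0 0 x] by simp

lemma cinner_zero_right [simp]: "cinner (x::'h::complex_hilbert) 0 = 0"
  using cinner_add_right[of x 0 0] by simp

lemma cinner_minus_left: "cinner (- x) y = - cinner (x::'h::complex_hilbert) y"
  using cinner_add_left[of x "- x" y] by (simp add: eq_neg_iff_add_eq_0 add.commute)

lemma cinner_minus_right: "cinner y (- x) = - cinner y (x::'h::complex_hilbert)"
  using cinner_add_right[of y x "- x"] by (simp add: eq_neg_iff_add_eq_0 add.commute)

lemma cinner_diff_left: "cinner (x - z) y = cinner x y - cinner (z::'h::complex_hilbert) y"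
  using cinner_add_left[of x "- z" y] by (simp add: cinner_minus_left)

lemma cinner_diff_right: "cinner y (x - z) = cinner y x - cinner y (z::'h::complex_hilbert)"
  using cinner_add_right[of y x "- z"] by (simp add: cinner_minus_right)

lemma cinner_sum_left: "cinner (\<Sum>i\<in>I. f i) (y::'h::complex_hilbert) = (\<Sum>i\<in>I. cinner (f i) y)"
  by (induction I rule: infinite_finite_induct) (auto simp: cinner_add_left)

lemma cinner_sum_right: "cinner (y::'h::complex_hilbert) (\<Sum>i\<in>I. f i) = (\<Sum>i\<in>I. cinner y (f i))"
  by (induction I rule: infinite_finite_induct) (auto simp: cinner_add_right)

lemma cinner_scaleR_left: "cinner (r *\<^sub>R x) (y::'h::complex_hilbert) = of_real r * cinner x y"
  by (simp add: scaleR_scaleC cinner_scaleC_left)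

lemma cinner_scaleR_right: "cinner y (r *\<^sub>R (x::'h::complex_hilbert)) = of_real r * cinner y x"
  by (simp add: scaleR_scaleC cinner_scaleC_right)

lemma Re_cinner_self: "Re (cinner x x) = (norm (x::'h::complex_hilbert))\<^sup>2"
  by (simp add: cinner_self)

lemma norm_scaleC: "norm (a *\<^sub>C (x::'h::complex_hilbert)) = cmod a * norm x"
proof -
  have "complex_of_real ((norm (a *\<^sub>C x))\<^sup>2) = a * cnj a * complex_of_real ((norm x)\<^sup>2)"
    unfolding cinner_self[symmetric] by (simp add: cinner_scaleC_left cinner_scaleC_right)
  then have "(norm (a *\<^sub>C x))\<^sup>2 = (cmod a * norm x)\<^sup>2"
    by (simp only: complex_norm_square[symmetric] power_mult_distrib of_real_mult[symmetric]
        of_real_eq_iff)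
  then show ?thesis
    by (simp add: power2_eq_iff_nonneg)
qed

lemmas cinner_simps = cinner_add_left cinner_add_right cinner_diff_left cinner_diff_right
  cinner_minus_left cinner_minus_right cinner_scaleC_left cinner_scaleC_right
  cinner_scaleR_left cinner_scaleR_right cinner_sum_left cinner_sum_right

text \<open>Forms are used rather than positive operators because the form attached to a state of a
  matrix corner does not come with an operator on the Hilbert space. Definiteness and boundedness
  are left out, so kernels are allowed.\<close>

definition psd_form :: "('h::complex_hilbert \<Rightarrow> 'h \<Rightarrow> complex) \<Rightarrow> bool" where
  "psd_form q \<longleftrightarrow> (\<forall>u v w. q (u + v) w = q u w + q v w) \<and> (\<forall>c u v. q (c *\<^sub>C u) v = c * q u v) \<and>
     (\<forall>u v. q u v = cnj (q v u)) \<and> (\<forall>u. 0 \<le> Re (q u u))"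

lemma psd_formD:
  assumes "psd_form q"
  shows "q (u + v) w = q u w + q v w" "q w (u + v) = q w u + q w v"
    "q (c *\<^sub>C u) v = c * q u v" "q u (c *\<^sub>C v) = cnj c * q u v"
    "q u v = cnj (q v u)" "0 \<le> Re (q u u)" "q 0 u = 0" "q u 0 = 0" "q u u = of_real (Re (q u u))"
proof -
  show a: "q (u + v) w = q u w + q v w" for u v w using assms unfolding psd_form_def by blast
  show c: "q u v = cnj (q v u)" for u v using assms unfolding psd_form_def by blast
  show m: "q (c *\<^sub>C u) v = c * q u v" for c u v using assms unfolding psd_form_def by blast
  show "q w (u + v) = q w u + q w v" by (metis a c complex_cnj_add)
  show "q u (c *\<^sub>C v) = cnj c * q u v" by (metis m c complex_cnj_mult)
  show "0 \<le> Re (q u u)" using assms unfolding psd_form_def by blast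
  show z: "q 0 u = 0" for u using a[of 0 0 u] by simp
  show "q u 0 = 0" by (metis z c complex_cnj_zero)
  show "q u u = of_real (Re (q u u))" using c[of u u] by (simp add: complex_eq_iff)
qed

lemma psd_form_Cauchy_Schwarz:
  assumes q: "psd_form q"
  shows "(cmod (q u v))\<^sup>2 \<le> Re (q u u) * Re (q v v)"
proof -
  note Q = psd_formD[OF q]
  define a b c where "a = Re (q u u)" and "b = Re (q v v)" and "c = q u v"
  have vu: "q v u = cnj c" unfolding c_def by (rule Q)
  have ineq: "0 \<le> a - 2 * s * (cmod c)\<^sup>2 + s\<^sup>2 * (cmod c)\<^sup>2 * b" for s :: real
  proof -
    \<comment> \<open>The phase of \<open>c\<close> in \<open>z\<close> makes both cross terms real,
      each equal to \<open>- s * (cmod c)\<^sup>2\<close>.\<close>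
    define z where "z = - of_real s * c"
    have "q (u + z *\<^sub>C v) (u + z *\<^sub>C v) = q u u + cnj z * c + z * cnj c + z * cnj z * q v v"
      by (simp add: Q(1-4) vu algebra_simps flip: c_def)
    also have "\<dots> = of_real a - 2 * of_real s * (c * cnj c) + (of_real s)\<^sup>2 * (c * cnj c) * of_real b"
      unfolding a_def b_def z_def Q(9)[symmetric] by (simp add: algebra_simps power2_eq_square)
    also have "\<dots> = of_real (a - 2 * s * (cmod c)\<^sup>2 + s\<^sup>2 * (cmod c)\<^sup>2 * b)"
      by (simp flip: complex_norm_square)
    finally show ?thesis using Q(6)[of "u + z *\<^sub>C v"] by simp
  qed
  show ?thesis
  proof (cases "b = 0")
    case True
    have "c = 0"
    proof (rule ccontr)
      assume "c \<noteq> 0"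
      \<comment> \<open>For \<open>b = 0\<close> the inequality is affine in \<open>s\<close> with
        negative slope; this \<open>s\<close> brings its right-hand side down to -1.\<close>
      then have "0 \<le> a - (a + 1)" using ineq[of "(a + 1) / (2 * (cmod c)\<^sup>2)"] True by simp
      then show False by simp
    qed
    then show ?thesis using True by (simp flip: c_def b_def)
  next
    case False
    then have "b > 0" using Q(6)[of v] by (simp add: b_def)
    then have "0 \<le> a - (cmod c)\<^sup>2 / b"
      using ineq[of "1 / b"] by (simp add: power2_eq_square field_simps)
    then show ?thesis using \<open>b > 0\<close> by (simp add: field_simps flip: a_def b_def c_def)
  qed
qed

lemma psd_form_cinner: "psd_form (cinner :: 'h::complex_hilbert \<Rightarrow> _)"
  unfolding psd_form_def
  by (auto simp: cinner_add_left cinner_scaleC_left Re_cinner_self intro: cinner_commute)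

lemma Cauchy_Schwarz: "cmod (cinner u v) \<le> norm u * norm (v::'h::complex_hilbert)"
  using psd_form_Cauchy_Schwarz[OF psd_form_cinner, of u v]
  by (simp add: Re_cinner_self power_mult_distrib[symmetric] abs_le_square_iff[symmetric])

lemma cinner_mult_commute:
  "cinner u v * cinner v (u::'h::complex_hilbert) = of_real ((cmod (cinner u v))\<^sup>2)"
  by (subst complex_norm_square) simp

lemma cmod_cinner_commute: "cmod (cinner u v) = cmod (cinner v (u::'h::complex_hilbert))"
  by (metis cnj_cinner complex_mod_cnj)

lemma cinner_self_eq_0: "cinner u u = 0 \<longleftrightarrow> (u::'h::complex_hilbert) = 0"
  by (simp add: cinner_self)

lemma bounded_linear_cinner_left: "bounded_linear (\<lambda>u. cinner u (v::'h::complex_hilbert))"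
  by (rule bounded_linear_intro[of _ "norm v"])
    (auto simp: cinner_simps scaleR_conv_of_real Cauchy_Schwarz)

lemma bounded_bilinear_cinner: "bounded_bilinear (cinner :: 'h::complex_hilbert \<Rightarrow> _)"
  by unfold_locales
    (auto simp: cinner_simps scaleR_conv_of_real intro!: exI[of _ 1] Cauchy_Schwarz)

lemmas tendsto_cinner [tendsto_intros] = bounded_bilinear.tendsto[OF bounded_bilinear_cinner]

section \<open>Orthonormal families\<close>

definition orthonormal_set :: "'h::complex_hilbert set \<Rightarrow> bool" where
  "orthonormal_set F \<longleftrightarrow> (\<forall>f\<in>F. \<forall>g\<in>F. cinner f g = (if f = g then 1 else 0))"

definition proj_sum :: "'h::complex_hilbert set \<Rightarrow> 'h \<Rightarrow> 'h" where
  "proj_sum F v = (\<Sum>f\<in>F. cinner v f *\<^sub>C f)"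

lemma orthonormal_setD:
  "orthonormal_set F \<Longrightarrow> f \<in> F \<Longrightarrow> g \<in> F \<Longrightarrow> cinner f g = (if f = g then 1 else 0)"
  by (simp add: orthonormal_set_def)

lemma orthonormal_set_norm: "orthonormal_set F \<Longrightarrow> f \<in> F \<Longrightarrow> norm f = 1"
  using orthonormal_setD[of F f f] Re_cinner_self[of f] norm_ge_zero[of f]
  by (simp add: power2_eq_1_iff)

lemma orthonormal_set_subset: "orthonormal_set F \<Longrightarrow> G \<subseteq> F \<Longrightarrow> orthonormal_set G"
  unfolding orthonormal_set_def by blast

lemma cinner_proj_sum:
  assumes "orthonormal_set F" "finite F" "f \<in> F"
  shows "cinner (proj_sum F v) f = cinner v f"
proof -
  have "cinner (proj_sum F v) f = (\<Sum>g\<in>F. if g = f then cinner v f else 0)"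
    unfolding proj_sum_def cinner_sum_left
    by (intro sum.cong) (auto simp: cinner_scaleC_left orthonormal_setD[OF assms(1)] assms(3))
  then show ?thesis using assms by simp
qed

lemma cinner_proj_sum_proj_sum:
  assumes "orthonormal_set F" "finite F"
  shows "cinner (proj_sum F v) (proj_sum F w) = (\<Sum>f\<in>F. cinner v f * cinner f w)"
proof -
  have "cinner (proj_sum F v) (proj_sum F w) = (\<Sum>f\<in>F. cnj (cinner w f) * cinner (proj_sum F v) f)"
    unfolding proj_sum_def[of F w] by (simp add: cinner_sum_right cinner_scaleC_right)
  also have "\<dots> = (\<Sum>f\<in>F. cinner v f * cinner f w)"
    by (intro sum.cong) (auto simp: cinner_proj_sum[OF assms] mult.commute)
  finally show ?thesis .
qed

lemma cinner_proj_sum_left: "cinner (proj_sum F v) w = (\<Sum>f\<in>F. cinner v f * cinner f w)"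
  by (simp add: proj_sum_def cinner_simps)

lemma proj_sum_sym: "cinner (proj_sum F v) w = cinner v (proj_sum F w)"
  by (simp add: proj_sum_def cinner_simps mult.commute)

lemma proj_sum_Pythagoras:
  assumes "orthonormal_set F" "finite F"
  shows "(norm v)\<^sup>2 = (norm (v - proj_sum F v))\<^sup>2 + (\<Sum>f\<in>F. (cmod (cinner v f))\<^sup>2)"
proof -
  let ?s = "\<Sum>f\<in>F. cinner v f * cinner f v"
  have 1: "cinner (proj_sum F v) (proj_sum F v) = ?s" by (rule cinner_proj_sum_proj_sum[OF assms])
  have 2: "cinner (proj_sum F v) v = ?s" by (rule cinner_proj_sum_left)
  have 3: "cinner v (proj_sum F v) = ?s" by (metis 2 proj_sum_sym)
  have "cinner (v - proj_sum F v) (v - proj_sum F v) = cinner v v - ?s"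
    by (simp add: cinner_simps 1 2 3)
  moreover have "?s = of_real (\<Sum>f\<in>F. (cmod (cinner v f))\<^sup>2)"
    by (simp only: cinner_mult_commute of_real_sum)
  ultimately have "complex_of_real ((norm (v - proj_sum F v))\<^sup>2)
    = of_real ((norm v)\<^sup>2 - (\<Sum>f\<in>F. (cmod (cinner v f))\<^sup>2))"
    by (simp add: cinner_self)
  then show ?thesis by (simp only: of_real_eq_iff)
qed

lemma Bessel:
  assumes "orthonormal_set F" "finite F"
  shows "(\<Sum>f\<in>F. (cmod (cinner v f))\<^sup>2) \<le> (norm v)\<^sup>2"
  using proj_sum_Pythagoras[OF assms, of v] by simp

text \<open>Since \<open>proj_sum F\<close> fixes the span, \<open>v\<close> and
  \<open>v - s\<close> have the same residual, and Pythagoras for \<open>v - s\<close> bounds that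
  residual by \<open>norm (v - s)\<close>.\<close>

lemma proj_sum_best:
  assumes F: "orthonormal_set F" "finite F" and s: "s \<in> complex_vector.span F"
  shows "norm (v - proj_sum F v) \<le> norm (v - s)"
proof -
  have fix_s: "proj_sum F s = s" using s
  proof (induction rule: complex_vector.span_induct_alt)
    case base
    then show ?case by (simp add: proj_sum_def)
  next
    case (step c f y)
    have "proj_sum F f = (\<Sum>g\<in>F. if g = f then f else 0)"
      unfolding proj_sum_def
      by (intro sum.cong) (use step(1) in \<open>auto simp: orthonormal_setD[OF F(1)] scaleC_one\<close>)
    then have "proj_sum F f = f" using F step(1) by simp
    moreover have "proj_sum F (c *\<^sub>C f + y) = c *\<^sub>C proj_sum F f + proj_sum F y"
      by (simp add: proj_sum_def cinner_simps scaleC_add_left scaleC_scaleC sum.distrib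
          complex_vector.scale_sum_right)
    ultimately show ?case using step by simp
  qed
  have 1: "proj_sum F (v - s) = proj_sum F v - s"
    using fix_s by (simp add: proj_sum_def cinner_simps complex_vector.scale_left_diff_distrib sum_subtractf)
  have "(norm (v - proj_sum F v))\<^sup>2 = (norm ((v - s) - proj_sum F (v - s)))\<^sup>2"
    by (simp add: 1)
  also have "\<dots> \<le> (norm (v - s))\<^sup>2"
    using proj_sum_Pythagoras[OF F, of "v - s"] by (simp add: sum_nonneg)
  finally show ?thesis by (rule power2_le_imp_le) simp
qed

lemma proj_sum_in_span: "proj_sum F v \<in> complex_vector.span F"
  unfolding proj_sum_def
  by (rule complex_vector.span_sum, rule complex_vector.span_scale, rule complex_vector.span_base)

lemma proj_sum_span:
  assumes "orthonormal_set F" "finite F" "s \<in> complex_vector.span F"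
  shows "proj_sum F s = s"
  using proj_sum_best[OF assms, of s] by simp

locale onb =
  fixes e :: "nat \<Rightarrow> 'h::complex_hilbert"
  assumes basis: "orthonormal_basis e"
begin

lemma cinner_e: "cinner (e j) (e k) = (if j = k then 1 else 0)"
  using basis by (simp add: orthonormal_basis_def)

lemma inj_e: "inj e"
  by (rule injI) (metis cinner_e zero_neq_one)

lemma norm_e [simp]: "norm (e k) = 1"
  by (rule orthonormal_set_norm[of "{e k}"]) (simp_all add: orthonormal_set_def cinner_e)

lemma orthonormal_e: "orthonormal_set (e ` I)"
  by (auto simp: orthonormal_set_def cinner_e dest: injD[OF inj_e])

lemma proj_sum_e: "proj_sum (e ` I) v = (\<Sum>k\<in>I. cinner v (e k) *\<^sub>C e k)"
  unfolding proj_sum_def by (rule sum.reindex_cong[of e]) (use inj_e in \<open>auto simp: inj_on_def\<close>)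

text \<open>Density of the span supplies one finite combination close to \<open>v\<close>; by best
  approximation every partial sum that covers its indices is at least as close.\<close>

lemma expansion: "(\<lambda>k. cinner v (e k) *\<^sub>C e k) sums v"
proof -
  have "\<exists>N. \<forall>n\<ge>N. norm ((\<Sum>k<n. cinner v (e k) *\<^sub>C e k) - v) < r" if "r > 0" for r
  proof -
    have "v \<in> closure (complex_vector.span (range e))"
      using basis by (simp add: orthonormal_basis_def)
    then obtain s where s: "s \<in> complex_vector.span (range e)" "dist s v < r"
      using \<open>r > 0\<close> closure_approachable by blast
    obtain T where T: "finite T" "T \<subseteq> range e" "s \<in> complex_vector.span T"
    proof -
      obtain T c where "finite T" "T \<subseteq> range e" "s = (\<Sum>a\<in>T. c a *\<^sub>C a)"
        using s(1) unfolding complex_vector.span_explicit by blast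
      then show ?thesis
        by (intro that[of T]) (auto intro: complex_vector.span_sum complex_vector.span_scale complex_vector.span_base)
    qed
    obtain I where I: "finite I" "T = e ` I"
      using finite_subset_image[OF T(1,2)] by auto
    obtain N where N: "I \<subseteq> {..<N}"
      using I(1) by (metis finite_nat_iff_bounded)
    have "norm ((\<Sum>k<n. cinner v (e k) *\<^sub>C e k) - v) < r" if "n \<ge> N" for n
    proof -
      have "T \<subseteq> e ` {..<n}" using N I that by (auto intro!: imageI)
      then have "s \<in> complex_vector.span (e ` {..<n})"
        using T(3) complex_vector.span_mono by blast
      then have "norm (v - proj_sum (e ` {..<n}) v) \<le> norm (v - s)"
        by (intro proj_sum_best orthonormal_e) auto
      then show ?thesis using s(2)
        by (simp add: proj_sum_e dist_norm norm_minus_commute)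
    qed
    then show ?thesis by blast
  qed
  then show ?thesis unfolding sums_def by (rule LIMSEQ_I)
qed

lemma Parseval_sums: "(\<lambda>k. cinner u (e k) * cinner (e k) v) sums cinner u v"
  using bounded_linear.sums[OF bounded_linear_cinner_left[of v] expansion[of u]]
  by (simp add: cinner_scaleC_left)

lemma Bessel_e:
  assumes "finite I"
  shows "(\<Sum>k\<in>I. (cmod (cinner v (e k)))\<^sup>2) \<le> (norm v)\<^sup>2"
proof -
  have "(\<Sum>k\<in>I. (cmod (cinner v (e k)))\<^sup>2) = (\<Sum>f\<in>e ` I. (cmod (cinner v f))\<^sup>2)"
    by (rule sum.reindex_cong[of e, symmetric]) (use inj_e in \<open>auto simp: inj_on_def\<close>)
  also have "\<dots> \<le> (norm v)\<^sup>2"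
    by (rule Bessel) (use assms orthonormal_e in auto)
  finally show ?thesis .
qed

lemma norm_sums: "(\<lambda>k. (cmod (cinner v (e k)))\<^sup>2) sums (norm v)\<^sup>2"
proof -
  have "(\<lambda>k. complex_of_real ((cmod (cinner v (e k)))\<^sup>2)) sums complex_of_real ((norm v)\<^sup>2)"
    using Parseval_sums[of v v]
    by (simp only: cinner_mult_commute cinner_self)
  then show ?thesis by (simp only: sums_of_real_iff)
qed

lemma Parseval_summable: "summable (\<lambda>k. cmod (cinner u (e k) * cinner (e k) v))"
proof (rule summable_comparison_test'[of "\<lambda>k. (cmod (cinner u (e k)))\<^sup>2 + (cmod (cinner v (e k)))\<^sup>2" 0])
  show "summable (\<lambda>k. (cmod (cinner u (e k)))\<^sup>2 + (cmod (cinner v (e k)))\<^sup>2)"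
    using norm_sums by (intro summable_add) (auto dest: sums_summable)
  fix k
  have c: "cmod (cinner (e k) v) = cmod (cinner v (e k))"
    by (rule cmod_cinner_commute)
  show "norm (cmod (cinner u (e k) * cinner (e k) v)) \<le> (cmod (cinner u (e k)))\<^sup>2 + (cmod (cinner v (e k)))\<^sup>2"
    using sum_squares_bound[of "cmod (cinner u (e k))" "cmod (cinner v (e k))"]
      mult_nonneg_nonneg[OF norm_ge_zero norm_ge_zero, of "cinner u (e k)" "cinner v (e k)"]
    unfolding norm_mult real_norm_def abs_mult abs_norm_cancel c by linarith
qed

lemma Parseval_has_sum: "((\<lambda>k. cinner u (e k) * cinner (e k) v) has_sum cinner u v) UNIV"
  using norm_summable_imp_has_sum[OF Parseval_summable Parseval_sums] .

text \<open>Double counting: if every \<open>e k\<close> were in the span, the squared coefficients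
  of each \<open>e k\<close> over \<open>F\<close> would sum to 1, whereas summing them over all
  \<open>k\<close> gives the finite number of squared norms in \<open>F\<close>. This is the
  infinite dimensionality of the space.\<close>

lemma e_notin_finite:
  assumes F: "orthonormal_set F" "finite F"
  shows "\<exists>k. e k \<notin> complex_vector.span F"
proof (rule ccontr)
  assume "\<not> ?thesis"
  then have *: "proj_sum F (e k) = e k" for k using proj_sum_span[OF F] by blast
  have 1: "(\<Sum>f\<in>F. (cmod (cinner (e k) f))\<^sup>2) = 1" for k
    using proj_sum_Pythagoras[OF F, of "e k"] by (simp add: *)
  have "(\<lambda>k. \<Sum>f\<in>F. (cmod (cinner f (e k)))\<^sup>2) sums (\<Sum>f\<in>F. (norm f)\<^sup>2)"
    by (intro sums_sum norm_sums)
  moreover have "(\<Sum>f\<in>F. (cmod (cinner f (e k)))\<^sup>2) = 1" for k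
    using 1[of k] by (simp only: cmod_cinner_commute[of "e k"])
  ultimately have "(\<lambda>k::nat. 1::real) sums (\<Sum>f\<in>F. (norm f)\<^sup>2)" by simp
  then have "(\<lambda>k::nat. 1::real) \<longlonglongrightarrow> 0" by (rule summable_LIMSEQ_zero[OF sums_summable])
  then show False by (simp add: LIMSEQ_const_iff)
qed

end

section \<open>Self-adjoint operators\<close>

lemma bounded_opsD: "T \<in> bounded_ops \<Longrightarrow> T (c *\<^sub>C v) = c *\<^sub>C T (v::'h::complex_hilbert)"
  by (simp add: bounded_ops_def)

lemma selfadjointD:
  assumes "selfadjoint T"
  shows "T \<in> bounded_ops" "cinner (T u) v = cinner u (T v)"
  using assms by (auto simp: selfadjoint_def)

lemma selfadjoint_add: "selfadjoint S \<Longrightarrow> selfadjoint T \<Longrightarrow> selfadjoint (S + T)"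
  by (auto simp: selfadjoint_def bounded_ops_def blinfun.add_left cinner_simps scaleC_add_right)

lemma selfadjoint_uminus: "selfadjoint S \<Longrightarrow> selfadjoint (- S)"
  by (auto simp: selfadjoint_def bounded_ops_def blinfun.minus_left cinner_simps)

lemma selfadjoint_diff: "selfadjoint S \<Longrightarrow> selfadjoint T \<Longrightarrow> selfadjoint (S - T)"
  using selfadjoint_add[of S "- T"] selfadjoint_uminus[of T] by simp

lemma selfadjoint_scaleR: "selfadjoint S \<Longrightarrow> selfadjoint (r *\<^sub>R S)"
  by (auto simp: selfadjoint_def bounded_ops_def blinfun.scaleR_left cinner_simps scaleR_scaleC
      scaleC_scaleC mult.commute)

lemma selfadjoint_id: "selfadjoint id_blinfun"
  by (auto simp: selfadjoint_def bounded_ops_def)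

lemma abs_quadratic_form_le:
  fixes T :: "'h::complex_hilbert \<Rightarrow>\<^sub>L 'h"
  shows "\<bar>Re (cinner (T v) v)\<bar> \<le> norm T * (norm v)\<^sup>2"
proof -
  have "\<bar>Re (cinner (T v) v)\<bar> \<le> norm (T v) * norm v"
    using Cauchy_Schwarz[of "T v" v] abs_Re_le_cmod[of "cinner (T v) v"] by linarith
  also have "\<dots> \<le> (norm T * norm v) * norm v"
    by (intro mult_right_mono norm_blinfun) simp
  finally show ?thesis by (simp add: power2_eq_square mult.assoc)
qed

text \<open>Polarisation writes \<open>Re (cinner (T u) v)\<close> as a difference of two values of
  the quadratic form, and the parallelogram law adds up the two bounds.\<close>

lemma norm_selfadjoint_le:
  fixes T :: "'h::complex_hilbert \<Rightarrow>\<^sub>L 'h"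
  assumes T: "selfadjoint T" and c: "\<And>v. \<bar>Re (cinner (T v) v)\<bar> \<le> c * (norm v)\<^sup>2" "0 \<le> c"
  shows "norm T \<le> c"
proof (rule norm_blinfun_bound)
  fix u
  have polar: "4 * Re (cinner (T u) v) \<le> 2 * c * ((norm u)\<^sup>2 + (norm v)\<^sup>2)" for v
  proof -
    have vu: "Re (cinner (T v) u) = Re (cinner (T u) v)"
      using selfadjointD(2)[OF T, of v u] cnj_cinner[of "T u" v] by (metis cnj.sel(1))
    have "4 * Re (cinner (T u) v) = Re (cinner (T (u + v)) (u + v)) - Re (cinner (T (u - v)) (u - v))"
      by (simp add: blinfun.add_right blinfun.diff_right cinner_simps vu)
    also have "\<dots> \<le> c * (norm (u + v))\<^sup>2 + c * (norm (u - v))\<^sup>2"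
      using c(1)[of "u + v"] c(1)[of "u - v"] by linarith
    also have "\<dots> = c * Re (cinner (u + v) (u + v) + cinner (u - v) (u - v))"
      by (simp add: cinner_self distrib_left flip: of_real_power)
    also have "\<dots> = 2 * c * ((norm u)\<^sup>2 + (norm v)\<^sup>2)"
      by (simp add: cinner_simps Re_cinner_self algebra_simps)
    finally show ?thesis .
  qed
  show "norm (T u) \<le> c * norm u"
  proof (cases "u = 0 \<or> T u = 0")
    case True
    then show ?thesis using c(2) by auto
  next
    case False
    \<comment> \<open>The direction of \<open>T u\<close> with the length of \<open>u\<close>: the
      inner product becomes \<open>norm u * norm (T u)\<close>, and both squares on the right are
      equal.\<close>
    define v where "v = (norm u / norm (T u)) *\<^sub>R T u"
    have "Re (cinner (T u) v) = norm u * norm (T u)"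
      using False by (simp add: v_def cinner_simps cinner_self power2_eq_square)
    moreover have "norm v = norm u" using False by (simp add: v_def)
    ultimately have "4 * (norm u * norm (T u)) \<le> 2 * c * (2 * (norm u)\<^sup>2)"
      using polar[of v] by simp
    then have "norm u * norm (T u) \<le> norm u * (c * norm u)"
      by (simp add: power2_eq_square algebra_simps)
    then show ?thesis using False by simp
  qed
qed fact

lemma quadratic_form_sgn:
  fixes T :: "'h::complex_hilbert \<Rightarrow>\<^sub>L 'h"
  shows "Re (cinner (T v) v) = (norm v)\<^sup>2 * Re (cinner (T (sgn v)) (sgn v))"
proof (cases "v = 0")
  case False
  have "v = norm v *\<^sub>R sgn v" using False by (simp add: sgn_div_norm)
  then have "cinner (T v) v = of_real (norm v) * (of_real (norm v) * cinner (T (sgn v)) (sgn v))"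
    by (metis blinfun.scaleR_right cinner_scaleR_left cinner_scaleR_right)
  then show ?thesis by (simp add: power2_eq_square)
qed simp

lemma norm_selfadjoint_approx:
  fixes T :: "'h::complex_hilbert \<Rightarrow>\<^sub>L 'h"
  assumes T: "selfadjoint T" and d: "d < norm T" "0 \<le> d"
  shows "\<exists>v. norm v = 1 \<and> d < \<bar>Re (cinner (T v) v)\<bar>"
proof (rule ccontr)
  assume "\<not> ?thesis"
  then have 1: "\<bar>Re (cinner (T v) v)\<bar> \<le> d" if "norm v = 1" for v using that by force
  have "\<bar>Re (cinner (T v) v)\<bar> \<le> d * (norm v)\<^sup>2" for v
  proof (cases "v = 0")
    case False
    have "\<bar>Re (cinner (T v) v)\<bar> = (norm v)\<^sup>2 * \<bar>Re (cinner (T (sgn v)) (sgn v))\<bar>"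
      by (subst quadratic_form_sgn) (simp add: abs_mult)
    then show ?thesis using 1[of "sgn v"] False
      by (simp add: norm_sgn mult.commute mult_left_mono)
  qed simp
  then have "norm T \<le> d" by (intro norm_selfadjoint_le T d)
  then show False using d by simp
qed

lemma positive_op_psd_form: "positive_op N \<Longrightarrow> psd_form (\<lambda>u v. cinner (N u) v)"
  unfolding psd_form_def positive_op_def
  by (auto simp: blinfun.add_right cinner_simps bounded_opsD selfadjointD)

text \<open>Cauchy-Schwarz for the form of \<open>N\<close> at the pair \<open>v\<close>,
  \<open>N v\<close>. It turns a small value of the quadratic form into a small vector
  \<open>N v\<close>, which is how near-extremal vectors become approximate eigenvectors.\<close>

lemma positive_op_norm_le:
  assumes N: "positive_op N"
  shows "(norm (N v))\<^sup>2 \<le> norm N * Re (cinner (N v) v)"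
proof (cases "N v = 0")
  case False
  have "((norm (N v))\<^sup>2)\<^sup>2 \<le> Re (cinner (N v) v) * Re (cinner (N (N v)) (N v))"
    using psd_form_Cauchy_Schwarz[OF positive_op_psd_form[OF N], of v "N v"]
    by (simp add: cinner_self norm_power)
  also have "\<dots> \<le> Re (cinner (N v) v) * (norm N * (norm (N v))\<^sup>2)"
    using abs_quadratic_form_le[of N "N v"] N
    by (intro mult_left_mono) (auto simp: positive_op_def)
  finally have "(norm (N v))\<^sup>2 * (norm (N v))\<^sup>2 \<le> (norm N * Re (cinner (N v) v)) * (norm (N v))\<^sup>2"
    by (simp add: power2_eq_square algebra_simps)
  then show ?thesis using False by (subst (asm) mult_le_cancel_right_pos) auto
next
  case True
  then show ?thesis by simp
qed

section \<open>Extreme spectral values\<close>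

text \<open>The upper end of the numerical range. On a nonzero space and for self-adjoint operators
  it is the largest spectral value, which gives \<open>lambda_max\<close> a variational
  description.\<close>

definition num_sup :: "('h::complex_hilbert \<Rightarrow>\<^sub>L 'h) \<Rightarrow> real" where
  "num_sup T = (SUP v\<in>{v. norm v = 1}. Re (cinner (T v) v))"

lemma num_sup_bdd:
  fixes T :: "'h::complex_hilbert \<Rightarrow>\<^sub>L 'h"
  shows "bdd_above ((\<lambda>v. Re (cinner (T v) v)) ` {v. norm v = 1})"
proof (rule bdd_aboveI2)
  fix v :: 'h assume "v \<in> {v. norm v = 1}"
  then show "Re (cinner (T v) v) \<le> norm T"
    using abs_quadratic_form_le[of T v] by simp
qed

lemma num_sup_ge:
  fixes T :: "'h::complex_hilbert \<Rightarrow>\<^sub>L 'h"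
  shows "Re (cinner (T v) v) \<le> num_sup T * (norm v)\<^sup>2"
proof (cases "v = 0")
  case False
  then have "Re (cinner (T (sgn v)) (sgn v)) \<le> num_sup T"
    unfolding num_sup_def by (intro cSUP_upper num_sup_bdd) (simp add: norm_sgn)
  then show ?thesis
    by (subst quadratic_form_sgn, subst mult.commute) (rule mult_right_mono, auto)
qed simp

text \<open>The numerical range lies in the interval from \<open>- norm T\<close> to
  \<open>num_sup T\<close>. After a shift to its midpoint the operator has norm at most half its
  length, which is less than the distance of \<open>r\<close> from the midpoint, so the resolvent
  equation becomes a contraction. Without the shift \<open>norm T\<close> could exceed
  \<open>r\<close>.\<close>

lemma resolvent_exists:
  fixes T :: "'h::complex_hilbert \<Rightarrow>\<^sub>L 'h"
  assumes T: "selfadjoint T" and ne: "\<exists>u::'h. norm u = 1" and r: "num_sup T < r"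
  shows "of_real r \<notin> spectrum_op T"
proof -
  define M where "M = num_sup T"
  \<comment> \<open>Midpoint \<open>c\<close> and half-length \<open>k\<close> of the interval from
    \<open>- norm T\<close> to \<open>M\<close>.\<close>
  define c where "c = (M - norm T) / 2"
  define k where "k = (M + norm T) / 2"
  obtain u :: 'h where "u \<noteq> 0" using ne by (metis norm_zero zero_neq_one)
  have "0 \<le> M + norm T"
  proof -
    have "- (norm T * (norm u)\<^sup>2) \<le> M * (norm u)\<^sup>2"
      using abs_quadratic_form_le[of T u] num_sup_ge[of T u] unfolding M_def by linarith
    then have "0 \<le> (M + norm T) * (norm u)\<^sup>2" by (simp add: algebra_simps)
    then show ?thesis using \<open>u \<noteq> 0\<close> by (simp add: zero_le_mult_iff)
  qed
  then have k: "0 \<le> k" and kr: "k < r - c" using r by (simp_all add: k_def c_def M_def field_simps)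
  define T' where "T' = T - c *\<^sub>R id_blinfun"
  have T'_apply: "T' v = T v - c *\<^sub>R v" for v
    by (simp add: T'_def blinfun.diff_left blinfun.scaleR_left)
  have T': "norm T' \<le> k"
  proof (rule norm_selfadjoint_le)
    show "selfadjoint T'" unfolding T'_def
      by (intro selfadjoint_diff selfadjoint_scaleR selfadjoint_id T)
    fix v
    have "Re (cinner (T' v) v) = Re (cinner (T v) v) - c * (norm v)\<^sup>2"
      by (simp add: T'_apply cinner_simps cinner_self)
    moreover have "Re (cinner (T v) v) \<le> (k + c) * (norm v)\<^sup>2"
      using num_sup_ge[of T v] by (simp add: k_def c_def M_def add_divide_distrib diff_divide_distrib)
    moreover have "(c - k) * (norm v)\<^sup>2 \<le> Re (cinner (T v) v)"
      using abs_quadratic_form_le[of T v]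
      by (simp add: k_def c_def add_divide_distrib diff_divide_distrib abs_le_iff)
    ultimately show "\<bar>Re (cinner (T' v) v)\<bar> \<le> k * (norm v)\<^sup>2"
      by (simp add: algebra_simps abs_le_iff)
  qed fact
  have ex1: "\<exists>!v. T v - r *\<^sub>R v = w" for w
  proof -
    \<comment> \<open>The equation \<open>T v - r *\<^sub>R v = w\<close> rewritten as a fixed-point
      problem with Lipschitz constant \<open>k / (r - c)\<close>.\<close>
    have "\<exists>!v. (1 / (r - c)) *\<^sub>R (T' v - w) = v"
    proof (rule banach_fix_type[of "k / (r - c)"], goal_cases)
      case 3
      show ?case
      proof (intro allI)
      fix v v' :: 'h
      have "dist ((1 / (r - c)) *\<^sub>R (T' v - w)) ((1 / (r - c)) *\<^sub>R (T' v' - w))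
          = norm ((1 / (r - c)) *\<^sub>R (T' (v - v')))"
        by (simp add: dist_norm blinfun.diff_right algebra_simps)
      also have "\<dots> \<le> (1 / (r - c)) * (k * norm (v - v'))"
        using k kr order_trans[OF norm_blinfun[of T' "v - v'"] mult_right_mono[OF T' norm_ge_zero]]
        by (auto intro!: mult_left_mono divide_right_mono)
      finally show "dist ((1 / (r - c)) *\<^sub>R (T' v - w)) ((1 / (r - c)) *\<^sub>R (T' v' - w))
          \<le> k / (r - c) * dist v v'"
        by (simp add: dist_norm)
      qed
    qed (use k kr in auto)
    moreover have "(1 / (r - c)) *\<^sub>R (T' v - w) = v \<longleftrightarrow> T v - r *\<^sub>R v = w" for v
    proof -
      have "(1 / (r - c)) *\<^sub>R (T' v - w) = v \<longleftrightarrow> T' v - w = (r - c) *\<^sub>R v"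
      proof
        assume "(1 / (r - c)) *\<^sub>R (T' v - w) = v"
        then have "(r - c) *\<^sub>R (1 / (r - c)) *\<^sub>R (T' v - w) = (r - c) *\<^sub>R v" by (rule arg_cong)
        then show "T' v - w = (r - c) *\<^sub>R v" using k kr by (simp only: scaleR_scaleR) simp
      qed (use k kr in simp)
      also have "\<dots> \<longleftrightarrow> T v - r *\<^sub>R v = w" by (auto simp: T'_apply algebra_simps)
      finally show ?thesis .
    qed
    ultimately show ?thesis by simp
  qed
  define R where "R w = (THE v. T v - r *\<^sub>R v = w)" for w
  have R: "T (R w) - r *\<^sub>R R w = w" for w
    unfolding R_def by (rule theI'[OF ex1])
  have R': "R w = v" if "T v - r *\<^sub>R v = w" for v w
    using R ex1 that by blast
  have bnd: "norm (R w) \<le> norm w * (1 / (r - c - k))" for w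
  proof -
    have "(r - c) * norm (R w) = norm ((r - c) *\<^sub>R R w)" using k kr by simp
    also have "(r - c) *\<^sub>R R w = T' (R w) - w"
      using R[of w] by (simp add: T'_apply algebra_simps)
    also have "norm (T' (R w) - w) \<le> k * norm (R w) + norm w"
      using norm_triangle_ineq4[of "T' (R w)" w]
        order_trans[OF norm_blinfun[of T' "R w"] mult_right_mono[OF T' norm_ge_zero]] by linarith
    finally show ?thesis using kr by (simp add: field_simps)
  qed
  have add: "R (v + w) = R v + R w" for v w
  proof (rule R')
    have "T (R v + R w) - r *\<^sub>R (R v + R w) = (T (R v) - r *\<^sub>R R v) + (T (R w) - r *\<^sub>R R w)"
      by (simp add: blinfun.add_right scaleR_right_distrib)
    then show "T (R v + R w) - r *\<^sub>R (R v + R w) = v + w" by (simp add: R)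
  qed
  have sc: "R (a *\<^sub>C v) = a *\<^sub>C R v" for a v
  proof (rule R')
    have "T (a *\<^sub>C R v) - r *\<^sub>R a *\<^sub>C R v = a *\<^sub>C (T (R v) - r *\<^sub>R R v)"
      by (simp add: bounded_opsD[OF selfadjointD(1)[OF T]] scaleR_scaleC scaleC_scaleC
          complex_vector.scale_right_diff_distrib mult.commute)
    then show "T (a *\<^sub>C R v) - r *\<^sub>R a *\<^sub>C R v = a *\<^sub>C v" by (simp add: R)
  qed
  have bl: "bounded_linear R"
    by (rule bounded_linear_intro[OF add _ bnd]) (simp add: scaleR_scaleC sc)
  have "Blinfun R \<in> bounded_ops"
    by (simp add: bounded_ops_def bounded_linear_Blinfun_apply[OF bl] sc)
  then show ?thesis
    unfolding spectrum_op_def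
    by (auto intro!: bexI[of _ "Blinfun R"] R' simp: bounded_linear_Blinfun_apply[OF bl] R
        simp flip: scaleR_scaleC)
qed

text \<open>An inverse of \<open>T - M\<close> would bound \<open>norm (N v)\<close> below on the
  unit sphere, where \<open>N = M - T\<close> is positive. By \<open>positive_op_norm_le\<close> the
  form of \<open>N\<close> would then stay away from 0, contradicting that \<open>M\<close> is the
  supremum.\<close>

lemma num_sup_in_spectrum:
  fixes T :: "'h::complex_hilbert \<Rightarrow>\<^sub>L 'h"
  assumes T: "selfadjoint T" and ne: "\<exists>v::'h. norm v = 1"
  shows "of_real (num_sup T) \<in> spectrum_op T"
proof (rule ccontr)
  define M where "M = num_sup T"
  assume "\<not> ?thesis"
  then obtain R where R: "R \<in> bounded_ops" "\<And>v. R (T v - M *\<^sub>R v) = v"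
    unfolding spectrum_op_def M_def by (auto simp: scaleR_scaleC)
  define N where "N = M *\<^sub>R id_blinfun - T"
  have N_apply: "N v = M *\<^sub>R v - T v" for v
    by (simp add: N_def blinfun.diff_left blinfun.scaleR_left)
  have form: "Re (cinner (N v) v) = M * (norm v)\<^sup>2 - Re (cinner (T v) v)" for v
    by (simp add: N_apply cinner_simps cinner_self)
  have N: "positive_op N"
    unfolding positive_op_def
  proof
    show "selfadjoint N" unfolding N_def
      by (intro selfadjoint_diff selfadjoint_scaleR selfadjoint_id T)
    show "\<forall>v. 0 \<le> Re (cinner (N v) v)"
      using num_sup_ge[of T] by (simp add: form M_def)
  qed
  have lower: "1 \<le> (norm R)\<^sup>2 * norm N * (M - Re (cinner (T v) v))" if "norm v = 1" for v
  proof -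
    have "R (N v) = - v"
      using R(2)[of v] by (metis N_apply blinfun.minus_right minus_diff_eq)
    then have "1 \<le> norm R * norm (N v)"
      using norm_blinfun[of R "N v"] that by simp
    then have "1 \<le> (norm R * norm (N v))\<^sup>2" by simp
    also have "\<dots> \<le> (norm R)\<^sup>2 * (norm N * (M - Re (cinner (T v) v)))"
      using positive_op_norm_le[OF N, of v] that
      by (auto simp: form power_mult_distrib intro: mult_left_mono)
    finally show ?thesis by (simp add: mult.assoc)
  qed
  \<comment> \<open>The form of \<open>N\<close> is at least \<open>1 / K\<close> on unit vectors,
    so the supremum would drop by that amount.\<close>
  define K where "K = (norm R)\<^sup>2 * norm N"
  have "K > 0"
  proof -
    obtain v :: 'h where "norm v = 1" using ne by blast
    then show ?thesis using lower[of v] unfolding K_def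
      by (metis less_eq_real_def mult_eq_0_iff mult_nonneg_nonneg norm_ge_zero not_one_le_zero zero_le_power2)
  qed
  have "num_sup T \<le> M - 1 / K"
    unfolding num_sup_def
  proof (rule cSUP_least)
    show "{v::'h. norm v = 1} \<noteq> {}" using ne by auto
    fix v :: 'h assume "v \<in> {v. norm v = 1}"
    then show "Re (cinner (T v) v) \<le> M - 1 / K"
      using lower[of v] \<open>K > 0\<close> unfolding K_def[symmetric] by (simp add: field_simps)
  qed
  then show False using \<open>K > 0\<close> by (simp add: M_def)
qed

lemma spectrum_op_uminus: "- z \<in> spectrum_op (- T) \<longleftrightarrow> z \<in> spectrum_op T"
proof -
  have *: "- z \<notin> spectrum_op (- T)" if "z \<notin> spectrum_op T" for z and T :: "'h::complex_hilbert \<Rightarrow>\<^sub>L 'h"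
  proof -
    obtain R where R: "R \<in> bounded_ops" "\<And>v. R (T v - z *\<^sub>C v) = v" "\<And>v. T (R v) - z *\<^sub>C R v = v"
      using \<open>z \<notin> spectrum_op T\<close> unfolding spectrum_op_def by blast
    have "- R \<in> bounded_ops" using R(1) by (simp add: bounded_ops_def blinfun.minus_left)
    moreover have "(- R) ((- T) v - (- z) *\<^sub>C v) = v" for v
      using R(2)[of v] by (simp add: blinfun.minus_left blinfun.diff_right blinfun.add_right)
    moreover have "(- T) ((- R) v) - (- z) *\<^sub>C (- R) v = v" for v
      using R(3)[of v] by (simp add: blinfun.minus_left blinfun.minus_right)
    ultimately show ?thesis unfolding spectrum_op_def by blast
  qed
  show ?thesis using *[of z T] *[of "- z" "- T"] by auto
qed

section \<open>Variational formulas for the extreme spectral values\<close>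

context onb
begin

lemma ex_unit: "\<exists>v::'h. norm v = 1"
  using norm_e by blast

lemma lambda_max_eq:
  fixes T :: "'h \<Rightarrow>\<^sub>L 'h"
  assumes "selfadjoint T"
  shows "lambda_max T = num_sup T"
  unfolding lambda_max_def
proof (rule Greatest_equality)
  show "complex_of_real (num_sup T) \<in> spectrum_op T"
    by (rule num_sup_in_spectrum[OF assms]) (rule ex_unit)
  show "y \<le> num_sup T" if "complex_of_real y \<in> spectrum_op T" for y
    using resolvent_exists[OF assms ex_unit] that by (meson not_le)
qed

lemma lambda_min_eq:
  fixes T :: "'h \<Rightarrow>\<^sub>L 'h"
  assumes "selfadjoint T"
  shows "lambda_min T = - num_sup (- T)"
  unfolding lambda_min_def
proof (rule Least_equality)
  note m = selfadjoint_uminus[OF assms]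
  show "complex_of_real (- num_sup (- T)) \<in> spectrum_op T"
    using num_sup_in_spectrum[OF m ex_unit] spectrum_op_uminus[of "of_real (- num_sup (- T))" T] by auto
  show "- num_sup (- T) \<le> y" if "complex_of_real y \<in> spectrum_op T" for y
    using resolvent_exists[OF m ex_unit, of "- y"] that spectrum_op_uminus[of "of_real y" T] by force
qed

lemma lambda_max_ge:
  fixes T :: "'h \<Rightarrow>\<^sub>L 'h"
  assumes "selfadjoint T"
  shows "Re (cinner (T v) v) \<le> lambda_max T * (norm v)\<^sup>2"
  using num_sup_ge lambda_max_eq[OF assms] by metis

lemma lambda_min_le:
  fixes T :: "'h \<Rightarrow>\<^sub>L 'h"
  assumes "selfadjoint T"
  shows "lambda_min T * (norm v)\<^sup>2 \<le> Re (cinner (T v) v)"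
  using num_sup_ge[of "- T" v] lambda_min_eq[OF assms] by (simp add: blinfun.minus_left cinner_simps)

lemma lambda_max_le_norm:
  fixes T :: "'h \<Rightarrow>\<^sub>L 'h"
  assumes "selfadjoint T"
  shows "lambda_max T \<le> norm T"
  unfolding lambda_max_eq[OF assms] num_sup_def
proof (rule cSUP_least)
  show "{v::'h. norm v = 1} \<noteq> {}" using ex_unit by auto
  show "Re (cinner (T v) v) \<le> norm T" if "v \<in> {v. norm v = 1}" for v
    using abs_quadratic_form_le[of T v] that by simp
qed

lemma lambda_min_ge_norm:
  fixes T :: "'h \<Rightarrow>\<^sub>L 'h"
  assumes "selfadjoint T"
  shows "- lambda_min T \<le> norm T"
  using lambda_max_le_norm[OF selfadjoint_uminus[OF assms]]
  by (simp add: lambda_min_eq[OF assms] lambda_max_eq[OF selfadjoint_uminus[OF assms]])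

text \<open>In the balanced case the quadratic form lies between two opposite numbers, and its
  largest modulus is the norm.\<close>

lemma norm_eq_lambda_max:
  fixes T :: "'h \<Rightarrow>\<^sub>L 'h"
  assumes T: "selfadjoint T" and eq: "lambda_max T = - lambda_min T"
  shows "norm T = lambda_max T"
proof (rule antisym)
  show "norm T \<le> lambda_max T"
  proof (rule norm_selfadjoint_le[OF T])
    show "\<bar>Re (cinner (T v) v)\<bar> \<le> lambda_max T * (norm v)\<^sup>2" for v
      using lambda_max_ge[OF T, of v] lambda_min_le[OF T, of v] by (simp add: eq abs_le_iff)
    have "- lambda_max T \<le> lambda_max T"
      using lambda_max_ge[OF T, of "e 0"] lambda_min_le[OF T, of "e 0"] by (simp add: eq)
    then show "0 \<le> lambda_max T" by simp
  qed
qed (rule lambda_max_le_norm[OF T])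

end

section \<open>Diagonal operators\<close>

lemma cinner_eqI:
  assumes "\<And>w. cinner u w = cinner v w"
  shows "u = (v::'h::complex_hilbert)"
proof -
  have "cinner (u - v) (u - v) = 0" by (simp add: cinner_diff_left assms)
  then show ?thesis by (simp add: cinner_self_eq_0)
qed

definition rank_one :: "'h::complex_hilbert \<Rightarrow> 'h \<Rightarrow> ('h \<Rightarrow>\<^sub>L 'h)" where
  "rank_one u v = Blinfun (\<lambda>x. cinner x v *\<^sub>C u)"

lemma rank_one_apply: "rank_one u v x = cinner x v *\<^sub>C u"
proof -
  have "bounded_linear (\<lambda>x. cinner x v *\<^sub>C u)"
  proof (rule bounded_linear_intro)
    show "norm (cinner x v *\<^sub>C u) \<le> norm x * (norm v * norm u)" for x
      using mult_right_mono[OF Cauchy_Schwarz[of x v] norm_ge_zero[of u]]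
      by (simp add: norm_scaleC mult.assoc)
  qed (simp_all add: cinner_simps scaleC_add_left scaleR_scaleC scaleC_scaleC)
  then show ?thesis by (simp add: rank_one_def bounded_linear_Blinfun_apply)
qed

lemma outer_eq: "outer v = rank_one v v"
  by (simp add: outer_def rank_one_def)

lemma outer_apply: "outer v x = cinner x v *\<^sub>C v"
  by (simp add: outer_eq rank_one_apply)

lemma rank_one_bounded_ops: "rank_one u v \<in> bounded_ops"
  by (simp add: bounded_ops_def rank_one_apply cinner_simps scaleC_scaleC)

lemma selfadjoint_outer: "selfadjoint (outer v)"
  unfolding outer_eq by (simp add: selfadjoint_def rank_one_bounded_ops rank_one_apply cinner_simps mult.commute)

context onb
begin

text \<open>Orthonormality computes the squared norm and Bessel bounds it. The bound involves the
  largest coefficient and not the sum, which is why \<open>Diag\<close> converges for every null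
  sequence.\<close>

lemma norm_sum_diag:
  assumes I: "finite I" and c: "\<And>k. k \<in> I \<Longrightarrow> \<bar>a k\<bar> \<le> c" "0 \<le> c"
  shows "norm (\<Sum>k\<in>I. a k *\<^sub>R outer (e k)) \<le> c"
proof (rule norm_blinfun_bound)
  fix v
  have ap: "(\<Sum>k\<in>I. a k *\<^sub>R outer (e k)) v = (\<Sum>k\<in>I. (of_real (a k) * cinner v (e k)) *\<^sub>C e k)"
    by (simp add: blinfun.sum_left blinfun.scaleR_left outer_apply scaleR_scaleC scaleC_scaleC)
  have "cinner ((\<Sum>k\<in>I. a k *\<^sub>R outer (e k)) v) ((\<Sum>k\<in>I. a k *\<^sub>R outer (e k)) v)
      = (\<Sum>j\<in>I. (of_real (a j) * cinner v (e j)) * cnj (of_real (a j) * cinner v (e j)))"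
    unfolding ap by (simp add: cinner_simps cinner_e sum.delta I if_distrib cong: if_cong)
      (simp add: mult_ac)
  then have "complex_of_real ((norm ((\<Sum>k\<in>I. a k *\<^sub>R outer (e k)) v))\<^sup>2)
      = complex_of_real (\<Sum>j\<in>I. (cmod (of_real (a j) * cinner v (e j)))\<^sup>2)"
    by (simp only: cinner_self complex_norm_square of_real_sum)
  then have "(norm ((\<Sum>k\<in>I. a k *\<^sub>R outer (e k)) v))\<^sup>2 = (\<Sum>j\<in>I. \<bar>a j\<bar>\<^sup>2 * (cmod (cinner v (e j)))\<^sup>2)"
    by (simp only: of_real_eq_iff) (simp add: norm_mult power_mult_distrib)
  also have "\<dots> \<le> (\<Sum>j\<in>I. c\<^sup>2 * (cmod (cinner v (e j)))\<^sup>2)"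
    by (intro sum_mono mult_right_mono power_mono c) auto
  also have "\<dots> \<le> c\<^sup>2 * (norm v)\<^sup>2"
    using mult_left_mono[OF Bessel_e[OF I, of v] zero_le_power2[of c]] by (simp add: sum_distrib_left)
  finally show "norm ((\<Sum>k\<in>I. a k *\<^sub>R outer (e k)) v) \<le> c * norm v"
    using c(2) by (simp add: power_mult_distrib[symmetric] power_mono_iff)
qed fact

lemma Diag_sums: "(\<lambda>k. c0_nth x k *\<^sub>R outer (e k)) sums Diag e x"
proof -
  have "summable (\<lambda>k. c0_nth x k *\<^sub>R outer (e k))"
    unfolding summable_Cauchy
  proof (intro allI impI)
    fix r :: real assume "r > 0"
    then obtain N where N: "\<And>k. k \<ge> N \<Longrightarrow> \<bar>c0_nth x k\<bar> < r / 2"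
      using LIMSEQ_D[OF c0_nth_tendsto[of x], of "r / 2"] by auto
    have "norm (\<Sum>k\<in>{m..<n}. c0_nth x k *\<^sub>R outer (e k)) < r" if "m \<ge> N" for m n
    proof -
      have "norm (\<Sum>k\<in>{m..<n}. c0_nth x k *\<^sub>R outer (e k)) \<le> r / 2"
        using that \<open>r > 0\<close> by (intro norm_sum_diag less_imp_le[OF N]) auto
      then show ?thesis using \<open>r > 0\<close> by simp
    qed
    then show "\<exists>N. \<forall>m\<ge>N. \<forall>n. norm (\<Sum>k\<in>{m..<n}. c0_nth x k *\<^sub>R outer (e k)) < r" by blast
  qed
  then show ?thesis unfolding Diag_def by (rule summable_sums)
qed

lemma cinner_Diag_sums:
  "(\<lambda>k. of_real (c0_nth x k) * (cinner v (e k) * cinner (e k) w)) sums cinner (Diag e x v) w"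
proof -
  have "bounded_linear (\<lambda>T. cinner (blinfun_apply T v) w)"
    using bounded_linear_compose[OF bounded_linear_cinner_left[of w] blinfun.bounded_linear_left[of v]] .
  from bounded_linear.sums[OF this Diag_sums[of x]] show ?thesis
    by (simp add: blinfun.scaleR_left outer_apply cinner_simps)
qed

lemma Diag_form_sums:
  "(\<lambda>k. c0_nth x k * (cmod (cinner v (e k)))\<^sup>2) sums Re (cinner (Diag e x v) v)"
proof -
  have eq: "of_real (c0_nth x k) * (cinner v (e k) * cinner (e k) v)
      = of_real (c0_nth x k * (cmod (cinner v (e k)))\<^sup>2)" for k
    by (simp only: cinner_mult_commute of_real_mult)
  show ?thesis using sums_Re[OF cinner_Diag_sums[of x v v]] by (simp only: eq Re_complex_of_real)
qed

lemma selfadjoint_Diag: "selfadjoint (Diag e x)"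
  unfolding selfadjoint_def bounded_ops_def
proof safe
  fix c v
  show "Diag e x (c *\<^sub>C v) = c *\<^sub>C Diag e x v"
  proof (rule cinner_eqI)
    fix w
    show "cinner (Diag e x (c *\<^sub>C v)) w = cinner (c *\<^sub>C Diag e x v) w"
      using cinner_Diag_sums[of x "c *\<^sub>C v" w] sums_mult[OF cinner_Diag_sums[of x v w], of c]
      by (simp add: cinner_simps mult.left_commute mult.assoc sums_unique2)
  qed
next
  fix u v
  have "(\<lambda>k. cnj (of_real (c0_nth x k) * (cinner v (e k) * cinner (e k) u))) sums cnj (cinner (Diag e x v) u)"
    by (rule iffD2[OF sums_cnj cinner_Diag_sums])
  then have "(\<lambda>k. of_real (c0_nth x k) * (cinner u (e k) * cinner (e k) v)) sums cinner u (Diag e x v)"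
    by (simp add: mult.commute)
  then show "cinner (Diag e x u) v = cinner u (Diag e x v)"
    using cinner_Diag_sums sums_unique2 by blast
qed

lemma diagonal_Diag: "diagonal_op e (Diag e x)"
proof -
  have "cinner (Diag e x (e j)) (e k) = 0" if "j \<noteq> k" for j k
  proof -
    have z: "of_real (c0_nth x i) * (cinner (e j) (e i) * cinner (e i) (e k)) = 0" for i
      using that by (simp add: cinner_e)
    have "(\<lambda>i::nat. 0) sums cinner (Diag e x (e j)) (e k)"
      using cinner_Diag_sums[of x "e j" "e k"] by (simp only: z)
    then show ?thesis using sums_zero sums_unique2 by blast
  qed
  then show ?thesis using selfadjointD(1)[OF selfadjoint_Diag] by (simp add: diagonal_op_def)
qed

lemma Diag_add: "Diag e (x + y) = Diag e x + Diag e y"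
  using sums_unique2[OF Diag_sums[of "x + y"]] sums_add[OF Diag_sums Diag_sums, of x y]
  by (simp add: plus_c0.rep_eq scaleR_left_distrib)

lemma Diag_scaleR: "Diag e (r *\<^sub>R x) = r *\<^sub>R Diag e x"
  using sums_unique2[OF Diag_sums[of "r *\<^sub>R x"]] sums_scaleR_right[OF Diag_sums, of r x]
  by (simp add: scaleR_c0.rep_eq)

lemma norm_Diag_le: "norm (Diag e x) \<le> norm x"
proof (rule tendsto_upperbound)
  show "(\<lambda>n. norm (\<Sum>k<n. c0_nth x k *\<^sub>R outer (e k))) \<longlonglongrightarrow> norm (Diag e x)"
    using Diag_sums unfolding sums_def by (intro tendsto_norm)
  show "\<forall>\<^sub>F n in sequentially. norm (\<Sum>k<n. c0_nth x k *\<^sub>R outer (e k)) \<le> norm x"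
    by (intro always_eventually allI norm_sum_diag c0_nth_le_norm) auto
qed simp

lemma bounded_linear_Diag: "bounded_linear (Diag e)"
  by (rule bounded_linear_intro[of _ 1]) (auto simp: Diag_add Diag_scaleR norm_Diag_le)

lemma Diag_diff: "Diag e (x - y) = Diag e x - Diag e y"
  by (rule linear_diff[OF bounded_linear.linear[OF bounded_linear_Diag]])

text \<open>Continuity of \<open>D\<close> applied to the expansion of \<open>v\<close> gives the
  coordinates of \<open>D v\<close>, and Parseval then gives the form. The diagonal entries may be
  complex and need not tend to 0, as \<open>s6\<close> requires.\<close>

lemma diagonal_form_sums:
  assumes D: "diagonal_op e D"
  shows "(\<lambda>k. cinner (D (e k)) (e k) * of_real ((cmod (cinner v (e k)))\<^sup>2)) sums cinner (D v) v"
proof -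
  have coord: "cinner (D v) (e k) = cinner (D (e k)) (e k) * cinner v (e k)" for k
  proof -
    have "bounded_linear (\<lambda>u. cinner (D u) (e k))"
      using bounded_linear_compose[OF bounded_linear_cinner_left[of "e k"] blinfun.bounded_linear_right[of D]] .
    from bounded_linear.sums[OF this expansion[of v]]
    have "(\<lambda>j. cinner v (e j) * cinner (D (e j)) (e k)) sums cinner (D v) (e k)"
      using D by (simp add: diagonal_op_def bounded_opsD cinner_simps)
    moreover have "cinner v (e j) * cinner (D (e j)) (e k)
        = (if j = k then cinner v (e k) * cinner (D (e k)) (e k) else 0)" for j
      using D by (simp add: diagonal_op_def)
    ultimately have "(\<lambda>j. if j = k then cinner v (e k) * cinner (D (e k)) (e k) else 0) sums cinner (D v) (e k)"
      by simp
    then show ?thesis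
      using sums_single[of k "\<lambda>_. cinner v (e k) * cinner (D (e k)) (e k)"] sums_unique2
      by (metis (no_types, lifting) mult.commute)
  qed
  have "cinner (D v) (e k) * cinner (e k) v = cinner (D (e k)) (e k) * of_real ((cmod (cinner v (e k)))\<^sup>2)" for k
    unfolding coord mult.assoc cinner_mult_commute ..
  then show ?thesis using Parseval_sums[of "D v" v] by simp
qed

end

section \<open>Compact operators\<close>

text \<open>Total boundedness: a third of \<open>r\<close> is spent on passing to the closure, a
  third on passing to \<open>K\<close> and a third on a finite net of \<open>K\<close>.\<close>

lemma compact_closure_approx:
  fixes S :: "'a::banach set"
  assumes "\<And>r. r > 0 \<Longrightarrow> \<exists>K. compact K \<and> S \<subseteq> (\<Union>k\<in>K. ball k r)"
  shows "compact (closure S)"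
  unfolding compact_eq_totally_bounded
proof safe
  show "complete (closure S)" by (simp add: complete_eq_closed)
  fix r :: real assume "r > 0"
  obtain K where K: "compact K" "S \<subseteq> (\<Union>k\<in>K. ball k (r/3))"
    using assms[of "r/3"] \<open>r > 0\<close> by auto
  obtain F where F: "finite F" "K \<subseteq> (\<Union>k\<in>F. ball k (r/3))"
    using K(1) \<open>r > 0\<close> unfolding compact_eq_totally_bounded by (metis divide_pos_pos zero_less_numeral)
  have "closure S \<subseteq> (\<Union>k\<in>F. ball k r)"
  proof
    fix y assume "y \<in> closure S"
    then obtain z where z: "z \<in> S" "dist z y < r/3"
      using \<open>r > 0\<close> unfolding closure_approachable by (metis divide_pos_pos zero_less_numeral)
    obtain k where k: "k \<in> K" "dist k z < r/3" using K(2) z(1) by auto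
    obtain f where f: "f \<in> F" "dist f k < r/3" using F(2) k(1) by auto
    have "dist f y < r"
      using z(2) k(2) f(2) dist_triangle[of f y k] dist_triangle[of k y z] by linarith
    then show "y \<in> (\<Union>k\<in>F. ball k r)" using f(1) by auto
  qed
  then show "\<exists>k. finite k \<and> closure S \<subseteq> (\<Union>x\<in>k. ball x r)" using F(1) by blast
qed

lemma compact_closed_subset:
  fixes K :: "'a::t2_space set"
  assumes "compact K" "closed S" "S \<subseteq> K"
  shows "compact S"
  using compact_Int_closed[OF assms(1,2)] assms(3) by (simp add: inf.absorb2)

definition compact_op :: "('a::banach \<Rightarrow>\<^sub>L 'a) \<Rightarrow> bool" where
  "compact_op T \<longleftrightarrow> compact (closure (T ` cball 0 1))"

lemma compact_opI:
  fixes T :: "'a::banach \<Rightarrow>\<^sub>L 'a"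
  shows "compact K \<Longrightarrow> T ` cball 0 1 \<subseteq> K \<Longrightarrow> compact_op T"
  unfolding compact_op_def
  by (rule compact_closed_subset[OF _ closed_closure closure_minimal[OF _ compact_imp_closed]])

lemma compact_op_add:
  assumes "compact_op S" "compact_op T"
  shows "compact_op (S + T)"
proof (rule compact_opI)
  show "compact {x + y |x y. x \<in> closure (S ` cball 0 1) \<and> y \<in> closure (T ` cball 0 1)}"
    using assms unfolding compact_op_def by (rule compact_sums)
  show "(S + T) ` cball 0 1 \<subseteq> {x + y |x y. x \<in> closure (S ` cball 0 1) \<and> y \<in> closure (T ` cball 0 1)}"
    using closure_subset by (force simp: blinfun.add_left)
qed

lemma compact_op_limit:
  assumes "\<And>n. compact_op (X n)" "X \<longlonglongrightarrow> T"
  shows "compact_op T"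
  unfolding compact_op_def
proof (rule compact_closure_approx)
  fix r :: real assume "r > 0"
  then obtain n where n: "norm (X n - T) < r" using LIMSEQ_D[OF assms(2)] by blast
  have "T ` cball 0 1 \<subseteq> (\<Union>k\<in>closure (X n ` cball 0 1). ball k r)"
  proof safe
    fix v :: 'a assume v: "v \<in> cball 0 1"
    have "dist (X n v) (T v) \<le> norm (X n - T) * norm v"
      using norm_blinfun[of "X n - T" v] by (simp add: dist_norm blinfun.diff_left)
    also have "\<dots> \<le> norm (X n - T)" using v by (simp add: mult_left_le)
    finally have "T v \<in> ball (X n v) r" using n by simp
    then show "T v \<in> (\<Union>k\<in>closure (X n ` cball 0 1). ball k r)"
      by (rule UN_I[OF subsetD[OF closure_subset imageI[OF v]]])
  qed
  moreover have "compact (closure (X n ` cball 0 1))"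
    using assms(1)[of n] unfolding compact_op_def .
  ultimately show "\<exists>K. compact K \<and> T ` cball 0 1 \<subseteq> (\<Union>k\<in>K. ball k r)"
    by (intro exI conjI)
qed

lemma compact_op_outer: "compact_op (a *\<^sub>R outer (v::'h::complex_hilbert))"
proof (rule compact_opI)
  have "bounded_linear (\<lambda>c. c *\<^sub>C v)"
    by (rule bounded_linear_intro[of _ "norm v"])
      (auto simp: scaleC_add_left scaleR_scaleC scaleC_scaleC norm_scaleC scaleR_conv_of_real)
  then show "compact ((\<lambda>c. c *\<^sub>C v) ` cball 0 (\<bar>a\<bar> * norm v))"
    by (intro compact_continuous_image linear_continuous_on compact_cball)
  show "(a *\<^sub>R outer v) ` cball 0 1 \<subseteq> (\<lambda>c. c *\<^sub>C v) ` cball 0 (\<bar>a\<bar> * norm v)"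
  proof
    fix y assume "y \<in> (a *\<^sub>R outer v) ` cball 0 1"
    then obtain u where u: "norm u \<le> 1" "y = (of_real a * cinner u v) *\<^sub>C v"
      by (auto simp: blinfun.scaleR_left outer_apply scaleR_scaleC scaleC_scaleC)
    have "cmod (of_real a * cinner u v) \<le> \<bar>a\<bar> * norm v"
      using order_trans[OF Cauchy_Schwarz[of u v] mult_right_mono[OF u(1) norm_ge_zero[of v]]]
      by (simp add: norm_mult mult_left_mono)
    then show "y \<in> (\<lambda>c. c *\<^sub>C v) ` cball 0 (\<bar>a\<bar> * norm v)" using u(2) by auto
  qed
qed

lemma (in onb) compact_op_Diag: "compact_op (Diag e x)"
proof (rule compact_op_limit)
  show "(\<lambda>n. \<Sum>k<n. c0_nth x k *\<^sub>R outer (e k)) \<longlonglongrightarrow> Diag e x"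
    using Diag_sums unfolding sums_def .
  show "compact_op (\<Sum>k<n. c0_nth x k *\<^sub>R outer (e k))" for n
  proof (induction n)
    case 0
    show ?case by (rule compact_opI[of "{0}"]) auto
  next
    case (Suc n)
    then show ?case by (simp add: compact_op_add compact_op_outer)
  qed
qed

lemma compact_sa_ops_iff: "T \<in> compact_sa_ops \<longleftrightarrow> selfadjoint T \<and> compact_op T"
  by (simp add: compact_sa_ops_def compact_op_def)

text \<open>An eigenvector \<open>v\<close> of norm at most 1 equals \<open>T v\<close> divided by
  \<open>c\<close>, hence lies in a scaled copy of the compact closure of the image of the unit
  ball. Here a nonzero eigenvalue is indispensable.\<close>

lemma eigenspace_compact:
  assumes T: "compact_op T" and c: "c \<noteq> 0"
  shows "compact (eigenspace_op T c \<inter> cball 0 1)"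
proof -
  have "compact ((\<lambda>u. u /\<^sub>R c) ` closure (T ` cball 0 1))"
    using T unfolding compact_op_def by (intro compact_continuous_image continuous_intros)
  moreover have "closed (eigenspace_op T c)"
    unfolding eigenspace_op_def by (intro closed_Collect_eq continuous_intros)
  moreover have "eigenspace_op T c \<inter> cball 0 1 \<subseteq> (\<lambda>u. u /\<^sub>R c) ` closure (T ` cball 0 1)"
  proof
    fix v assume v: "v \<in> eigenspace_op T c \<inter> cball 0 1"
    then have "v = T v /\<^sub>R c" using c by (simp add: eigenspace_op_def)
    moreover have "T v \<in> closure (T ` cball 0 1)"
      using v closure_subset by (metis IntD2 image_eqI subsetD)
    ultimately show "v \<in> (\<lambda>u. u /\<^sub>R c) ` closure (T ` cball 0 1)" by blast
  qed
  ultimately show ?thesis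
    by (intro compact_closed_subset[OF _ closed_Int[OF _ closed_cball]])
qed

section \<open>Subspaces and projections\<close>

lemma orthonormal_dist:
  assumes "orthonormal_set B" "a \<in> B" "b \<in> B" "a \<noteq> b"
  shows "1 \<le> dist a b"
proof -
  have "cinner (a - b) (a - b) = 2"
    using assms by (simp add: cinner_simps orthonormal_setD[OF assms(1)])
  then have "(norm (a - b))\<^sup>2 = 2" using Re_cinner_self[of "a - b"] by simp
  then show ?thesis unfolding dist_norm by (intro power2_le_imp_le[of 1]) auto
qed

text \<open>Distinct members are at distance at least 1, so an orthonormal set has no accumulation
  point.\<close>

lemma orthonormal_compact_finite:
  assumes "orthonormal_set B" "B \<subseteq> K" "compact K"
  shows "finite B"
proof (rule ccontr)
  assume "infinite B"
  then obtain x where x: "x islimpt B"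
    using assms(2,3) unfolding compact_eq_Bolzano_Weierstrass by blast
  obtain a where a: "a \<in> B" "a \<noteq> x" "dist a x < 1/2"
    using x[unfolded islimpt_approachable, rule_format, of "1/2"] by auto
  obtain b where b: "b \<in> B" "b \<noteq> x" "dist b x < dist a x"
    using x[unfolded islimpt_approachable, rule_format, of "dist a x"] a(2) by auto
  have "a \<noteq> b" using b(3) by auto
  then have "1 \<le> dist a b" using orthonormal_dist assms(1) a(1) b(1) by blast
  then show False using dist_triangle2[of a b x] a(3) b(3) by linarith
qed

text \<open>A maximal orthonormal subset of \<open>S\<close>, given by Zorn, is finite by
  compactness of the ball. A vector of \<open>S\<close> outside its span would have a nonzero
  residual whose normalisation enlarges the set.\<close>

lemma finite_orthonormal_basis:
  fixes S :: "'h::complex_hilbert set"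
  assumes S: "complex_vector.subspace S" and K: "compact (S \<inter> cball 0 1)"
  shows "\<exists>F. finite F \<and> orthonormal_set F \<and> complex_vector.span F = S"
proof -
  let ?A = "{B. B \<subseteq> S \<and> orthonormal_set B}"
  have "\<exists>M\<in>?A. \<forall>X\<in>?A. M \<subseteq> X \<longrightarrow> X = M"
  proof (rule subset_Zorn')
    fix C assume C: "subset.chain ?A C"
    then have C_sub: "\<And>B. B \<in> C \<Longrightarrow> B \<subseteq> S \<and> orthonormal_set B"
      and chain: "\<And>B B'. B \<in> C \<Longrightarrow> B' \<in> C \<Longrightarrow> B \<subseteq> B' \<or> B' \<subseteq> B"
      unfolding subset_chain_def by auto
    have "cinner f g = (if f = g then 1 else 0)" if fg: "f \<in> \<Union>C" "g \<in> \<Union>C" for f g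
    proof -
      obtain B where B: "B \<in> C" "f \<in> B" "g \<in> B"
        using fg chain by (meson UnionE subsetD)
      then show ?thesis using C_sub orthonormal_setD by blast
    qed
    then have "orthonormal_set (\<Union>C)" unfolding orthonormal_set_def by blast
    then show "\<Union>C \<in> ?A" using C_sub by auto
  qed
  then obtain M where M: "M \<subseteq> S" "orthonormal_set M"
    and max: "\<And>X. X \<subseteq> S \<Longrightarrow> orthonormal_set X \<Longrightarrow> M \<subseteq> X \<Longrightarrow> X = M" by auto
  have "M \<subseteq> S \<inter> cball 0 1" using M orthonormal_set_norm[OF M(2)] by fastforce
  then have fin: "finite M" using orthonormal_compact_finite M(2) K by blast
  have span: "complex_vector.span M \<subseteq> S" using M(1) S by (rule complex_vector.span_minimal)
  have "v \<in> complex_vector.span M" if v: "v \<in> S" for v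
  proof (rule ccontr)
    assume n: "v \<notin> complex_vector.span M"
    define w where "w = v - proj_sum M v"
    have w: "w \<in> S" "w \<noteq> 0"
      using v span proj_sum_in_span[of M v] n S unfolding w_def
      by (auto intro: complex_vector.subspace_diff)
    have orth: "cinner w f = 0" if "f \<in> M" for f
      using cinner_proj_sum[OF M(2) fin that, of v] by (simp add: w_def cinner_simps)
    define u where "u = sgn w"
    have uw: "u = of_real (inverse (norm w)) *\<^sub>C w"
      by (simp add: u_def sgn_div_norm scaleR_scaleC)
    have "norm u = 1" using w(2) by (simp add: u_def norm_sgn)
    then have u: "u \<in> S" "cinner u u = 1"
      using w(1) S by (auto simp: cinner_self) (simp add: uw complex_vector.subspace_scale)
    have uo: "cinner u f = 0" "cinner f u = 0" if "f \<in> M" for f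
      using orth[OF that] cnj_cinner[of w f] by (simp_all add: uw cinner_simps)
    have "u \<notin> M" using u(2) uo by force
    have "orthonormal_set (insert u M)"
      using M(2) u(2) uo \<open>u \<notin> M\<close> unfolding orthonormal_set_def by auto
    then have "insert u M = M" using max u(1) M(1) by blast
    then show False using \<open>u \<notin> M\<close> by blast
  qed
  then show ?thesis using fin M(2) span by blast
qed

text \<open>\<open>orth_proj\<close> is a definite description and says nothing until existence is
  known. This predicate lets an explicit projection be exhibited first and then identified with
  \<open>orth_proj S\<close>.\<close>

definition is_orth_proj :: "('h::complex_hilbert \<Rightarrow>\<^sub>L 'h) \<Rightarrow> 'h set \<Rightarrow> bool" where
  "is_orth_proj P S \<longleftrightarrow> complex_vector.subspace S \<and> P \<in> bounded_ops \<and>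
     (\<forall>v. P v \<in> S \<and> (\<forall>s\<in>S. cinner (v - P v) s = 0))"

lemma is_orth_projD:
  assumes P: "is_orth_proj P S"
  shows "P v \<in> S" "s \<in> S \<Longrightarrow> P s = s" "cinner (P u) v = cinner u (P v)" "orth_proj S = P"
    "P \<in> bounded_ops" "s \<in> S \<Longrightarrow> cinner (P v) s = cinner v s"
proof -
  have S: "complex_vector.subspace S" and b: "P \<in> bounded_ops"
    and in_S: "\<And>v. P v \<in> S" and orth: "\<And>v s. s \<in> S \<Longrightarrow> cinner (v - P v) s = 0"
    using P unfolding is_orth_proj_def by auto
  have unique: "a = b" if "a \<in> S" "b \<in> S" "\<And>s. s \<in> S \<Longrightarrow> cinner (v - a) s = 0"
    "\<And>s. s \<in> S \<Longrightarrow> cinner (v - b) s = 0" for a b v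
  proof -
    have "a - b \<in> S" using that S by (intro complex_vector.subspace_diff)
    then have "cinner (v - b) (a - b) = 0" "cinner (v - a) (a - b) = 0" using that by blast+
    then have "cinner (a - b) (a - b) = 0" by (simp add: cinner_diff_left)
    then show ?thesis by (simp add: cinner_self_eq_0)
  qed
  show "P v \<in> S" by (rule in_S)
  show "P \<in> bounded_ops" by (rule b)
  show "P s = s" if "s \<in> S" using unique[of "P s" s s] in_S orth that by simp
  show left: "cinner (P v) s = cinner v s" if "s \<in> S" for v s
    using orth[OF that, of v] by (simp add: cinner_simps)
  show "cinner (P u) v = cinner u (P v)"
    using left[OF in_S, of u v] left[OF in_S, of v u] by (metis cnj_cinner)
  show "orth_proj S = P"
    unfolding orth_proj_def
  proof (rule the_equality)
    show "P \<in> bounded_ops \<and> (\<forall>v. P v \<in> S \<and> (\<forall>s\<in>S. cinner (v - P v) s = 0))"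
      using P unfolding is_orth_proj_def by blast
    show "Q = P" if "Q \<in> bounded_ops \<and> (\<forall>v. Q v \<in> S \<and> (\<forall>s\<in>S. cinner (v - Q v) s = 0))" for Q
      by (rule blinfun_eqI, rule unique) (use that in_S orth in auto)
  qed
qed

lemma is_orth_proj_UNIV: "is_orth_proj id_blinfun UNIV"
  by (simp add: is_orth_proj_def bounded_ops_def)

lemma bounded_linear_proj_sum: "bounded_linear (proj_sum F)"
  unfolding proj_sum_def
proof (intro bounded_linear_sum)
  fix f :: 'a assume "f \<in> F"
  show "bounded_linear (\<lambda>v. cinner v f *\<^sub>C f)"
    using blinfun.bounded_linear_right[of "outer f"] by (simp add: outer_apply)
qed

lemma is_orth_proj_span:
  assumes F: "finite F" "orthonormal_set F"
  shows "is_orth_proj (Blinfun (proj_sum F)) (complex_vector.span F)"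
proof -
  have "cinner (v - proj_sum F v) s = 0" if "s \<in> complex_vector.span F" for v s
    using that
  proof (induction rule: complex_vector.span_induct_alt)
    case (step c f y)
    then show ?case
      using cinner_proj_sum[OF F(2,1) step(1), of v] by (simp add: cinner_simps)
  qed simp
  then show ?thesis
    unfolding is_orth_proj_def bounded_ops_def
    by (simp add: bounded_linear_Blinfun_apply[OF bounded_linear_proj_sum] proj_sum_in_span)
      (simp add: proj_sum_def cinner_simps complex_vector.scale_sum_right scaleC_scaleC)
qed

lemma orth_proj_span:
  assumes F: "finite F" "orthonormal_set F"
  shows "orth_proj (complex_vector.span F) v = proj_sum F v"
  using is_orth_projD(4)[OF is_orth_proj_span[OF F]]
  by (simp add: bounded_linear_Blinfun_apply[OF bounded_linear_proj_sum])

lemma dim_span_orthonormal: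
  assumes F: "finite F" "orthonormal_set F"
  shows "complex_vector.dim (complex_vector.span F) = card F"
proof -
  have "complex_vector.independent F"
  proof (rule complex_vector.independent_if_scalars_zero[OF F(1)])
    fix c f assume *: "(\<Sum>x\<in>F. c x *\<^sub>C x) = 0" and f: "f \<in> F"
    have "0 = cinner (\<Sum>x\<in>F. c x *\<^sub>C x) f" by (simp add: *)
    also have "\<dots> = (\<Sum>x\<in>F. if x = f then c f else 0)"
      unfolding cinner_sum_left
      by (intro sum.cong) (auto simp: cinner_scaleC_left orthonormal_setD[OF F(2) _ f])
    also have "\<dots> = c f" using F f by simp
    finally show "c f = 0" by simp
  qed
  then show ?thesis by (rule complex_vector.dim_span_eq_card_independent)
qed

lemma eigenspace_subspace:
  assumes "T \<in> bounded_ops"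
  shows "complex_vector.subspace (eigenspace_op T c)"
  unfolding complex_vector.subspace_def eigenspace_op_def
  using assms by (auto simp: blinfun.add_right bounded_opsD scaleR_scaleC scaleC_add_right scaleC_scaleC mult.commute)

section \<open>Weighted vector systems\<close>

text \<open>Trace of the sum of the rank-one operators of the listed vectors;
  \<open>vec_density\<close> below is the diagonal of the same operator. Squared norms act as the
  weights of a convex combination, and lists admit repetitions and zero vectors, so that combining
  two systems is mere concatenation.\<close>

definition mass :: "'h::complex_hilbert list \<Rightarrow> real" where
  "mass ws = (\<Sum>w\<leftarrow>ws. (norm w)\<^sup>2)"

definition vec_density :: "(nat \<Rightarrow> 'h::complex_hilbert) \<Rightarrow> 'h list \<Rightarrow> nat \<Rightarrow> real" where
  "vec_density e ws k = (\<Sum>w\<leftarrow>ws. (cmod (cinner w (e k)))\<^sup>2)"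

lemma mass_simps [simp]: "mass [] = 0" "mass (w # ws) = (norm w)\<^sup>2 + mass ws"
  "mass (ws @ us) = mass ws + mass us"
  by (simp_all add: mass_def)

lemma vec_density_simps [simp]: "vec_density e [] k = 0"
  "vec_density e (w # ws) k = (cmod (cinner w (e k)))\<^sup>2 + vec_density e ws k"
  "vec_density e (ws @ us) k = vec_density e ws k + vec_density e us k"
  by (simp_all add: vec_density_def)

lemma mass_nonneg: "0 \<le> mass ws"
  by (induction ws) auto

lemma vec_density_nonneg: "0 \<le> vec_density e ws k"
  by (induction ws) auto

lemma mass_scale: "mass (map (\<lambda>w. r *\<^sub>R w) ws) = r\<^sup>2 * mass ws"
  by (induction ws) (auto simp: power_mult_distrib algebra_simps)

lemma vec_density_scale: "vec_density e (map (\<lambda>w. r *\<^sub>R w) ws) k = r\<^sup>2 * vec_density e ws k"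
  by (induction ws) (auto simp: cinner_simps norm_mult power_mult_distrib algebra_simps)

text \<open>Parseval for each vector. As a consequence the diagonal determines the mass, so systems
  with equal densities have equal masses.\<close>

lemma (in onb) vec_density_sums: "vec_density e ws sums mass ws"
proof (induction ws)
  case (Cons w ws)
  then show ?case using sums_add[OF norm_sums[of w] Cons.IH] by simp
qed (simp add: vec_density_def)

lemma (in onb) vec_density_le_mass: "vec_density e ws k \<le> mass ws"
proof -
  have "(\<Sum>j\<in>{k}. vec_density e ws j) \<le> suminf (vec_density e ws)"
    by (rule sum_le_suminf) (auto intro: vec_density_nonneg sums_summable[OF vec_density_sums])
  then show ?thesis by (simp add: sums_unique[OF vec_density_sums, symmetric])
qed

lemma sum_sum_list: "(\<Sum>v\<in>F. \<Sum>w\<leftarrow>ws. g v w) = (\<Sum>w\<leftarrow>ws. \<Sum>v\<in>F. (g v w :: 'a::comm_monoid_add))"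
  by (induction ws) (auto simp: sum.distrib)

lemma subspace_scaleR:
  "complex_vector.subspace S \<Longrightarrow> v \<in> S \<Longrightarrow> r *\<^sub>R (v::'h::complex_hilbert) \<in> S"
  by (simp add: scaleR_scaleC complex_vector.subspace_scale)

lemma set_scale_subset:
  "complex_vector.subspace S \<Longrightarrow> set ws \<subseteq> S \<Longrightarrow> set (map (\<lambda>w. r *\<^sub>R w) ws) \<subseteq> (S :: 'h::complex_hilbert set)"
  by (auto intro: subspace_scaleR)

text \<open>A weight \<open>t v\<close> is absorbed into the vector by the factor
  \<open>sqrt (t v)\<close>; conversely the weight of a listed vector is its squared norm and its
  direction is \<open>sgn w\<close>.\<close>

lemma moment_iff:
  assumes S: "complex_vector.subspace S"
  shows "a \<in> moment e S \<longleftrightarrow> (\<exists>ws. set ws \<subseteq> S \<and> mass ws = 1 \<and> a = vec_density e ws)"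
proof
  assume "a \<in> moment e S"
  then obtain F t where F: "finite F" "F \<subseteq> {v \<in> S. norm v = 1}" "\<And>v. v \<in> F \<Longrightarrow> 0 \<le> t v" "sum t F = 1"
    and a: "a = (\<lambda>k. \<Sum>v\<in>F. t v * (cmod (cinner v (e k)))\<^sup>2)"
    unfolding moment_def by blast
  obtain xs where xs: "set xs = F" "distinct xs" using finite_distinct_list[OF F(1)] by blast
  define ws where "ws = map (\<lambda>v. sqrt (t v) *\<^sub>R v) xs"
  have "mass ws = (\<Sum>v\<in>F. (norm (sqrt (t v) *\<^sub>R v))\<^sup>2)"
    unfolding mass_def ws_def map_map comp_def using xs by (simp add: sum_list_distinct_conv_sum_set)
  also have "\<dots> = sum t F"
    using F by (intro sum.cong) (auto simp: power_mult_distrib)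
  finally have "mass ws = 1" using F by simp
  moreover have "vec_density e ws k = a k" for k
  proof -
    have "vec_density e ws k = (\<Sum>v\<in>F. (cmod (cinner (sqrt (t v) *\<^sub>R v) (e k)))\<^sup>2)"
      unfolding vec_density_def ws_def map_map comp_def using xs by (simp add: sum_list_distinct_conv_sum_set)
    also have "\<dots> = a k"
      unfolding a using F by (intro sum.cong) (auto simp: power_mult_distrib cinner_simps norm_mult)
    finally show ?thesis .
  qed
  moreover have "set ws \<subseteq> S" unfolding ws_def using xs F(2) S by (auto intro: subspace_scaleR)
  ultimately show "\<exists>ws. set ws \<subseteq> S \<and> mass ws = 1 \<and> a = vec_density e ws" by (metis ext)
next
  assume "\<exists>ws. set ws \<subseteq> S \<and> mass ws = 1 \<and> a = vec_density e ws"
  then obtain ws where ws: "set ws \<subseteq> S" "mass ws = 1" "a = vec_density e ws" by blast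
  define F where "F = sgn ` (set ws - {0})"
  \<comment> \<open>The moment is indexed by a set, so list entries with a common direction are
    merged into one weight. Zero entries have no direction and are skipped.\<close>
  define t where "t v = (\<Sum>w\<leftarrow>ws. if w \<noteq> 0 \<and> v = sgn w then (norm w)\<^sup>2 else 0)" for v
  have F: "finite F" "F \<subseteq> {v \<in> S. norm v = 1}"
    unfolding F_def using ws(1) S by (auto simp: norm_sgn) (auto simp: sgn_div_norm intro: subspace_scaleR)
  have key: "(\<Sum>v\<in>F. t v * h v) = (\<Sum>w\<leftarrow>ws. (norm w)\<^sup>2 * h (sgn w))" for h :: "'a \<Rightarrow> real"
  proof -
    have "(\<Sum>v\<in>F. t v * h v) = (\<Sum>v\<in>F. \<Sum>w\<leftarrow>ws. (if w \<noteq> 0 \<and> v = sgn w then (norm w)\<^sup>2 else 0) * h v)"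
      unfolding t_def by (simp add: sum_list_mult_const)
    also have "\<dots> = (\<Sum>w\<leftarrow>ws. \<Sum>v\<in>F. (if w \<noteq> 0 \<and> v = sgn w then (norm w)\<^sup>2 else 0) * h v)"
      by (rule sum_sum_list)
    also have "\<dots> = (\<Sum>w\<leftarrow>ws. (norm w)\<^sup>2 * h (sgn w))"
    proof (rule arg_cong[of _ _ sum_list], rule map_cong[OF refl])
      fix w assume w: "w \<in> set ws"
      have "(\<Sum>v\<in>F. (if w \<noteq> 0 \<and> v = sgn w then (norm w)\<^sup>2 else 0) * h v)
          = (\<Sum>v\<in>F. if v = sgn w then (norm w)\<^sup>2 * h (sgn w) else 0)"
        by (intro sum.cong) auto
      also have "\<dots> = (norm w)\<^sup>2 * h (sgn w)"
        using w F(1) by (cases "w = 0") (auto simp: F_def)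
      finally show "(\<Sum>v\<in>F. (if w \<noteq> 0 \<and> v = sgn w then (norm w)\<^sup>2 else 0) * h v) = (norm w)\<^sup>2 * h (sgn w)" .
    qed
    finally show ?thesis .
  qed
  have "sum t F = 1" using key[of "\<lambda>_. 1"] ws(2) by (simp add: mass_def)
  moreover have "0 \<le> t v" for v unfolding t_def by (rule sum_list_nonneg) auto
  moreover have "a k = (\<Sum>v\<in>F. t v * (cmod (cinner v (e k)))\<^sup>2)" for k
  proof -
    have "(norm w)\<^sup>2 * (cmod (cinner (sgn w) (e k)))\<^sup>2 = (cmod (cinner w (e k)))\<^sup>2" for w
      by (cases "w = 0") (auto simp: sgn_div_norm cinner_simps norm_mult norm_divide power_divide
        power_mult_distrib norm_inverse field_simps)
    then show ?thesis unfolding key ws(3) vec_density_def by simp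
  qed
  ultimately show "a \<in> moment e S" unfolding moment_def using F by blast
qed

text \<open>Cholesky decomposition by induction on the orthonormal basis: each basis vector is a
  pivot that contributes one vector, and the Schur complement is decomposed on the remaining span.
  The exact length is what later bounds the size of vector systems.\<close>

lemma psd_form_Cholesky:
  assumes "finite F" "orthonormal_set F" "psd_form q"
  shows "\<exists>ws. set ws \<subseteq> complex_vector.span F \<and> length ws = card F \<and>
    (\<forall>u\<in>complex_vector.span F. Re (q u u) = (\<Sum>w\<leftarrow>ws. (cmod (cinner w u))\<^sup>2))"
  using assms
proof (induction F arbitrary: q rule: finite_induct)
  case empty
  then show ?case using psd_formD(7)[of q] by simp
next
  case (insert f F q)
  note Q = psd_formD[OF insert.prems(2)]
  note oF = orthonormal_set_subset[OF insert.prems(1) subset_insertI]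
  have orth: "cinner f g = 0" "cinner g f = 0" if "g \<in> F" for g
    using orthonormal_setD[OF insert.prems(1), of f g] orthonormal_setD[OF insert.prems(1), of g f]
      that insert.hyps(2) by auto
  have orth_span: "cinner v f = 0" "cinner f v = 0" if "v \<in> complex_vector.span F" for v
    using that by (induction rule: complex_vector.span_induct_alt) (auto simp: cinner_simps orth)
  have split: "\<exists>v c. v \<in> complex_vector.span F \<and> u = v + c *\<^sub>C f"
    if uF: "u \<in> complex_vector.span (insert f F)" for u
  proof -
    obtain k where "u - k *\<^sub>C f \<in> complex_vector.span F"
      using uF unfolding complex_vector.span_insert by blast
    then show ?thesis by (intro exI[of _ "u - k *\<^sub>C f"] exI[of _ k]) simp
  qed
  have sub: "complex_vector.span F \<subseteq> complex_vector.span (insert f F)"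
    by (rule complex_vector.span_mono) auto
  define m where "m = Re (q f f)"
  show ?case
  proof (cases "m = 0")
    case True
    \<comment> \<open>A zero pivot puts \<open>f\<close> into the kernel of \<open>q\<close>, by
      Cauchy-Schwarz.\<close>
    have qf: "q u f = 0" "q f u = 0" for u
    proof -
      have "(cmod (q u f))\<^sup>2 \<le> 0"
        using psd_form_Cauchy_Schwarz[OF insert.prems(2), of u f] True by (simp add: m_def)
      then show "q u f = 0" by simp
      then show "q f u = 0" using Q(5)[of f u] by simp
    qed
    obtain ws where ws: "set ws \<subseteq> complex_vector.span F" "length ws = card F"
      "\<And>u. u \<in> complex_vector.span F \<Longrightarrow> Re (q u u) = (\<Sum>w\<leftarrow>ws. (cmod (cinner w u))\<^sup>2)"
      using insert.IH[OF oF insert.prems(2)] by blast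
    have "Re (q u u) = (\<Sum>w\<leftarrow>0 # ws. (cmod (cinner w u))\<^sup>2)"
      if "u \<in> complex_vector.span (insert f F)" for u
    proof -
      obtain v c where v: "v \<in> complex_vector.span F" "u = v + c *\<^sub>C f" using split \<open>u \<in> _\<close> by blast
      have "Re (q u u) = Re (q v v)" unfolding v(2) by (simp add: Q(1-4) qf)
      moreover have "(\<Sum>w\<leftarrow>ws. (cmod (cinner w u))\<^sup>2) = (\<Sum>w\<leftarrow>ws. (cmod (cinner w v))\<^sup>2)"
        using ws(1) orth_span unfolding v(2)
        by (intro arg_cong[of _ _ sum_list] map_cong[OF refl]) (auto simp: cinner_simps subset_iff)
      ultimately show ?thesis using ws(3)[OF v(1)] by simp
    qed
    \<comment> \<open>The zero vector is prepended only to keep the length equal to the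
      cardinality.\<close>
    then show ?thesis using ws sub insert.hyps
      by (intro exI[of _ "0 # ws"]) (auto simp: complex_vector.span_zero)
  next
    case False
    then have m: "m > 0" using Q(6)[of f] by (simp add: m_def)
    have qff: "q f f = of_real m" unfolding m_def by (rule Q(9))
    \<comment> \<open>The Schur complement of the pivot. It has \<open>f\<close> in its kernel, so
      its values on the larger span are determined on \<open>span F\<close>, and Cauchy-Schwarz for
      \<open>q\<close> is precisely its positivity.\<close>
    define q' where "q' u v = q u v - q u f * q f v / of_real m" for u v
    have q'_f: "q' u f = 0" "q' f u = 0" for u
      using m by (simp_all add: q'_def qff)
    have norm_q: "q u f * q f u = of_real ((cmod (q u f))\<^sup>2)" for u
      using Q(5)[of f u] by (simp only: complex_norm_square)
    have Re_q': "Re (q' u u) = Re (q u u) - (cmod (q u f))\<^sup>2 / m" for u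
      by (simp only: q'_def norm_q minus_complex.simps of_real_divide[symmetric] Re_complex_of_real)
    have q': "psd_form q'"
      unfolding psd_form_def
    proof (intro conjI allI)
      fix u v w c
      show "q' (u + v) w = q' u w + q' v w" by (simp add: q'_def Q(1) add_divide_distrib algebra_simps)
      show "q' (c *\<^sub>C u) v = c * q' u v" by (simp add: q'_def Q(3) algebra_simps)
      show "q' u v = cnj (q' v u)"
        unfolding q'_def by (simp flip: Q(5) add: mult.commute)
      show "0 \<le> Re (q' u u)"
        using psd_form_Cauchy_Schwarz[OF insert.prems(2), of u f] m
        by (simp add: Re_q' field_simps flip: m_def)
    qed
    obtain ws where ws: "set ws \<subseteq> complex_vector.span F" "length ws = card F"
      "\<And>u. u \<in> complex_vector.span F \<Longrightarrow> Re (q' u u) = (\<Sum>w\<leftarrow>ws. (cmod (cinner w u))\<^sup>2)"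
      using insert.IH[OF oF q'] by blast
    \<comment> \<open>The Riesz vector of the functional \<open>q f u / sqrt m\<close> on the span;
      its squared coefficient restores the term removed in \<open>q'\<close>.\<close>
    define w0 where "w0 = (1 / sqrt m) *\<^sub>R (\<Sum>g\<in>insert f F. q f g *\<^sub>C g)"
    have w0: "w0 \<in> complex_vector.span (insert f F)"
      unfolding w0_def
      by (rule subspace_scaleR[OF complex_vector.subspace_span], rule complex_vector.span_sum,
          rule complex_vector.span_scale, rule complex_vector.span_base)
    have w0_q: "cinner w0 u = q f u / sqrt m" if "u \<in> complex_vector.span (insert f F)" for u
      using that
    proof (induction rule: complex_vector.span_induct_alt)
      case base
      then show ?case by (simp add: Q(8))
    next
      case (step c g u)
      have "(\<Sum>h\<in>insert f F. q f h * cinner h g) = (\<Sum>h\<in>insert f F. if h = g then q f g else 0)"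
        by (intro sum.cong) (auto simp: orthonormal_setD[OF insert.prems(1) _ step(1)])
      also have "\<dots> = q f g" using step(1) insert.hyps(1) by simp
      finally have "cinner w0 g = q f g / sqrt m"
        by (simp add: w0_def cinner_scaleR_left cinner_sum_left cinner_scaleC_left del: sum.insert)
      then show ?case using step by (simp add: cinner_simps Q(2,4) add_divide_distrib)
    qed
    have "Re (q u u) = (\<Sum>w\<leftarrow>w0 # ws. (cmod (cinner w u))\<^sup>2)"
      if u: "u \<in> complex_vector.span (insert f F)" for u
    proof -
      obtain v c where v: "v \<in> complex_vector.span F" "u = v + c *\<^sub>C f" using split u by blast
      note Q' = psd_formD[OF q']
      have "Re (q' u u) = Re (q' v v)" unfolding v(2) by (simp add: Q'(1-4) q'_f)
      moreover have "(\<Sum>w\<leftarrow>ws. (cmod (cinner w u))\<^sup>2) = (\<Sum>w\<leftarrow>ws. (cmod (cinner w v))\<^sup>2)"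
        using ws(1) orth_span unfolding v(2)
        by (intro arg_cong[of _ _ sum_list] map_cong[OF refl]) (auto simp: cinner_simps subset_iff)
      moreover have "(cmod (cinner w0 u))\<^sup>2 = (cmod (q u f))\<^sup>2 / m"
        using m Q(5)[of f u] by (simp add: w0_q[OF u] norm_divide power_divide)
      moreover have "Re (q u u) = Re (q' u u) + (cmod (q u f))\<^sup>2 / m"
        by (simp add: Re_q')
      ultimately show ?thesis using ws(3)[OF v(1)] by simp
    qed
    then show ?thesis using ws sub w0 insert.hyps by (intro exI[of _ "w0 # ws"]) auto
  qed
qed

lemma norm_span:
  assumes "finite F" "orthonormal_set F" "w \<in> complex_vector.span F"
  shows "(\<Sum>f\<in>F. (cmod (cinner w f))\<^sup>2) = (norm w)\<^sup>2"
  using proj_sum_Pythagoras[OF assms(2,1), of w] proj_sum_span[OF assms(2,1,3)] by simp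

text \<open>Vectors of the span do not distinguish \<open>e k\<close> from its projection, so the
  Cholesky identity at the projected basis vectors yields the density, and at the members of
  \<open>F\<close> it yields the mass.\<close>

lemma psd_form_vector_system:
  assumes F: "finite F" "orthonormal_set F" and q: "psd_form q"
  shows "\<exists>ws. set ws \<subseteq> complex_vector.span F \<and> length ws = card F \<and> mass ws = (\<Sum>f\<in>F. Re (q f f)) \<and>
    (\<forall>k. vec_density e ws k = Re (q (proj_sum F (e k)) (proj_sum F (e k))))"
proof -
  obtain ws where ws: "set ws \<subseteq> complex_vector.span F" "length ws = card F"
    "\<And>u. u \<in> complex_vector.span F \<Longrightarrow> Re (q u u) = (\<Sum>w\<leftarrow>ws. (cmod (cinner w u))\<^sup>2)"
    using psd_form_Cholesky[OF F q] by blast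
  have "(\<Sum>f\<in>F. Re (q f f)) = (\<Sum>f\<in>F. \<Sum>w\<leftarrow>ws. (cmod (cinner w f))\<^sup>2)"
    by (intro sum.cong ws(3) complex_vector.span_base) auto
  also have "\<dots> = (\<Sum>w\<leftarrow>ws. \<Sum>f\<in>F. (cmod (cinner w f))\<^sup>2)" by (rule sum_sum_list)
  also have "\<dots> = mass ws"
    unfolding mass_def
    using ws(1) norm_span[OF F]
    by (intro arg_cong[of _ _ sum_list] map_cong[OF refl]) (simp add: subset_iff)
  finally have "mass ws = (\<Sum>f\<in>F. Re (q f f))" by simp
  moreover have "vec_density e ws k = Re (q (proj_sum F (e k)) (proj_sum F (e k)))" for k
    unfolding vec_density_def ws(3)[OF proj_sum_in_span]
    using ws(1) proj_sum_span[OF F(2,1)]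
    by (intro arg_cong[of _ _ sum_list] map_cong[OF refl]) (simp add: subset_iff flip: proj_sum_sym)
  ultimately show ?thesis using ws(1,2) by (intro exI[of _ ws] conjI allI)
qed

lemma Re_cinner_mult: "Re (cinner u w * cinner w (u::'h::complex_hilbert)) = (cmod (cinner w u))\<^sup>2"
  by (simp only: cinner_mult_commute Re_complex_of_real cmod_cinner_commute[of w u])

lemma psd_form_add: "psd_form p \<Longrightarrow> psd_form q \<Longrightarrow> psd_form (\<lambda>u v. p u v + q u v)"
proof -
  assume "psd_form p" "psd_form q"
  note P = psd_formD[OF this(1)] and Q = psd_formD[OF this(2)]
  show ?thesis unfolding psd_form_def
  proof (intro conjI allI)
    fix u v
    show "p u v + q u v = cnj (p v u + q v u)" using P(5)[of u v] Q(5)[of u v] by simp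
  qed (simp_all add: P(1,3,6) Q(1,3,6) distrib_left)
qed

lemma psd_form_rank_one: "psd_form (\<lambda>u v. cinner u w * cinner w v)"
proof -
  have "0 \<le> Re (cinner u w * cinner w u)" for u
    unfolding Re_cinner_mult by simp
  then show ?thesis unfolding psd_form_def
    by (simp add: cinner_add_left cinner_scaleC_left distrib_right mult.commute[of "cinner w _"]
        mult.assoc del: times_complex.simps)
qed

lemma psd_form_list: "psd_form (\<lambda>u v. \<Sum>w\<leftarrow>ws. cinner u w * cinner w v)"
proof (induction ws)
  case (Cons w ws)
  then show ?case using psd_form_add[OF psd_form_rank_one Cons.IH] by simp
qed (simp add: psd_form_def)

text \<open>The operator of \<open>ws\<close> is decomposed anew, with as many vectors as the
  dimension. This plays the part of Caratheodory's theorem: the number of vectors becomes bounded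
  while mass and density stay the same.\<close>

lemma vector_system_reduce:
  assumes F: "finite F" "orthonormal_set F" and ws: "set ws \<subseteq> complex_vector.span F"
  shows "\<exists>us. set us \<subseteq> complex_vector.span F \<and> length us = card F \<and> mass us = mass ws \<and>
    vec_density e us = vec_density e ws"
proof -
  have q: "Re (\<Sum>w\<leftarrow>ws. cinner u w * cinner w u) = (\<Sum>w\<leftarrow>ws. (cmod (cinner w u))\<^sup>2)" for u
    by (induction ws) (simp_all only: list.map sum_list.Nil sum_list.Cons plus_complex.simps
        zero_complex.simps Re_cinner_mult)
  obtain us where us: "set us \<subseteq> complex_vector.span F" "length us = card F"
    "mass us = (\<Sum>f\<in>F. \<Sum>w\<leftarrow>ws. (cmod (cinner w f))\<^sup>2)"
    "\<And>k. vec_density e us k = (\<Sum>w\<leftarrow>ws. (cmod (cinner w (proj_sum F (e k))))\<^sup>2)"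
    using psd_form_vector_system[OF F psd_form_list[of ws], of e] unfolding q by blast
  have "mass us = (\<Sum>w\<leftarrow>ws. (norm w)\<^sup>2)"
    unfolding us(3) sum_sum_list
    using ws norm_span[OF F]
    by (intro arg_cong[of _ _ sum_list] map_cong[OF refl]) (simp add: subset_iff)
  moreover have "vec_density e us k = vec_density e ws k" for k
    unfolding us(4) vec_density_def[of e ws]
    using ws proj_sum_span[OF F(2,1)]
    by (intro arg_cong[of _ _ sum_list] map_cong[OF refl]) (simp add: subset_iff flip: proj_sum_sym)
  ultimately show ?thesis using us(1,2) unfolding mass_def[of ws, symmetric] by blast
qed

section \<open>Sequential limits of vector systems of fixed length\<close>

lemma list_seq_compact:
  fixes K :: "'a::metric_space set"
  assumes K: "compact K" and ws: "\<And>n. length (ws n) = r" "\<And>n. set (ws n) \<subseteq> K"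
  shows "\<exists>l \<sigma>. strict_mono (\<sigma> :: nat \<Rightarrow> nat) \<and> length l = r \<and> set l \<subseteq> K \<and>
    (\<forall>i<r. (\<lambda>n. ws (\<sigma> n) ! i) \<longlonglongrightarrow> l ! i)"
  using ws
proof (induction r arbitrary: ws)
  case 0
  then show ?case by (intro exI[of _ "[]"] exI[of _ id]) (auto simp: strict_mono_def)
next
  case (Suc r)
  have split: "ws n = hd (ws n) # tl (ws n)" for n
    using Suc.prems(1)[of n] by (cases "ws n") auto
  have hd: "hd (ws n) \<in> K" and tl: "length (tl (ws n)) = r" "set (tl (ws n)) \<subseteq> K" for n
    using Suc.prems[of n] by (cases "ws n"; simp)+
  obtain l \<sigma> where l: "strict_mono (\<sigma> :: nat \<Rightarrow> nat)" "length l = r" "set l \<subseteq> K"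
    "\<And>i. i < r \<Longrightarrow> (\<lambda>n. tl (ws (\<sigma> n)) ! i) \<longlonglongrightarrow> l ! i"
    using Suc.IH[of "\<lambda>n. tl (ws n)", OF tl] by (elim exE conjE) auto
  obtain x \<tau> where x: "x \<in> K" "strict_mono (\<tau> :: nat \<Rightarrow> nat)" "((\<lambda>n. hd (ws (\<sigma> n))) \<circ> \<tau>) \<longlonglongrightarrow> x"
    using K[unfolded compact_def, rule_format, of "\<lambda>n. hd (ws (\<sigma> n))"] hd by auto
  have "(\<lambda>n. ws (\<sigma> (\<tau> n)) ! i) \<longlonglongrightarrow> (x # l) ! i" if "i < Suc r" for i
  proof (cases i)
    case 0
    have "ws n ! 0 = hd (ws n)" for n by (metis split nth_Cons_0)
    then show ?thesis using x(3) 0 by (simp add: comp_def)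
  next
    case (Suc j)
    then have "(\<lambda>n. tl (ws (\<sigma> (\<tau> n))) ! j) \<longlonglongrightarrow> l ! j"
      using LIMSEQ_subseq_LIMSEQ[OF l(4) x(2), of j] that by (simp add: comp_def)
    moreover have "ws (\<sigma> (\<tau> n)) ! i = tl (ws (\<sigma> (\<tau> n))) ! j" for n
      using split Suc by (metis nth_Cons_Suc)
    ultimately show ?thesis using Suc by simp
  qed
  then show ?case
    using l x strict_mono_o[OF l(1) x(2)]
    by (intro exI[of _ "x # l"] exI[of _ "\<sigma> \<circ> \<tau>"]) (auto simp: comp_def)
qed

lemma mass_tendsto:
  assumes "\<And>n. length (ws n) = length l" "\<And>i. i < length l \<Longrightarrow> (\<lambda>n. ws n ! i) \<longlonglongrightarrow> l ! i"
  shows "(\<lambda>n. mass (ws n)) \<longlonglongrightarrow> mass l"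
proof -
  have "mass us = (\<Sum>i<length us. (norm (us ! i))\<^sup>2)" for us :: "'a list"
    by (simp add: mass_def sum_list_sum_nth atLeast0LessThan)
  moreover have "(\<lambda>n. \<Sum>i<length l. (norm (ws n ! i))\<^sup>2) \<longlonglongrightarrow> (\<Sum>i<length l. (norm (l ! i))\<^sup>2)"
    by (intro tendsto_sum tendsto_power tendsto_norm assms(2)) simp
  ultimately show ?thesis by (simp add: assms(1))
qed

lemma vec_density_tendsto:
  assumes "\<And>n. length (ws n) = length l" "\<And>i. i < length l \<Longrightarrow> (\<lambda>n. ws n ! i) \<longlonglongrightarrow> l ! i"
  shows "(\<lambda>n. vec_density e (ws n) k) \<longlonglongrightarrow> vec_density e l k"
proof -
  have "vec_density e us k = (\<Sum>i<length us. (cmod (cinner (us ! i) (e k)))\<^sup>2)" for us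
    by (simp add: vec_density_def sum_list_sum_nth atLeast0LessThan)
  moreover have "(\<lambda>n. \<Sum>i<length l. (cmod (cinner (ws n ! i) (e k)))\<^sup>2)
      \<longlonglongrightarrow> (\<Sum>i<length l. (cmod (cinner (l ! i) (e k)))\<^sup>2)"
    by (intro tendsto_sum tendsto_power tendsto_norm tendsto_cinner assms(2) tendsto_const) simp
  ultimately show ?thesis by (simp add: assms(1))
qed

section \<open>Perturbation of the norm\<close>

text \<open>The near-maximisers \<open>v n\<close> of the perturbed form satisfy
  \<open>N (v n) \<longlonglongrightarrow> 0\<close> for \<open>N = M - T\<close>. Compactness makes
  a subsequence of \<open>T (v n)\<close> converge, hence also \<open>v n\<close>, since
  \<open>M v = N v + T v\<close>; the limit is an eigenvector. The tolerance
  \<open>(t n)\<^sup>2\<close> is of second order, so it still vanishes after division by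
  \<open>t n\<close>, which leaves the sign of \<open>Y\<close> at the limit.\<close>

lemma selfadjoint_perturbation_upper:
  fixes T Y :: "'h::complex_hilbert \<Rightarrow>\<^sub>L 'h"
  assumes T: "selfadjoint T" "compact_op T" and M: "0 < M" "\<And>v. Re (cinner (T v) v) \<le> M * (norm v)\<^sup>2"
    and t: "\<And>n. 0 < t n" "t \<longlonglongrightarrow> 0"
    and v: "\<And>n::nat. norm (v n) = 1"
    and near: "\<And>n. M - (t n)\<^sup>2 \<le> Re (cinner ((T + t n *\<^sub>R Y) (v n)) (v n))"
  shows "\<exists>u. norm u = 1 \<and> T u = M *\<^sub>R u \<and> 0 \<le> Re (cinner (Y u) u)"
proof -
  have near': "M - (t n)\<^sup>2 \<le> Re (cinner (T (v n)) (v n)) + t n * Re (cinner (Y (v n)) (v n))" for n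
    using near[of n] by (simp add: blinfun.add_left blinfun.scaleR_left cinner_simps)
  define N where "N = M *\<^sub>R id_blinfun - T"
  have N_apply: "N u = M *\<^sub>R u - T u" for u
    by (simp add: N_def blinfun.diff_left blinfun.scaleR_left)
  have form: "Re (cinner (N u) u) = M * (norm u)\<^sup>2 - Re (cinner (T u) u)" for u
    by (simp add: N_apply cinner_simps cinner_self)
  have "selfadjoint N" unfolding N_def
    by (intro selfadjoint_diff selfadjoint_scaleR selfadjoint_id T)
  then have N: "positive_op N" using M(2) by (simp add: positive_op_def form)
  have Y_le: "\<bar>Re (cinner (Y (v n)) (v n))\<bar> \<le> norm Y" for n
    using abs_quadratic_form_le[of Y "v n"] v[of n] by simp
  have le: "(norm (N (v n)))\<^sup>2 \<le> norm N * (t n * norm Y + (t n)\<^sup>2)" for n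
  proof -
    have "t n * Re (cinner (Y (v n)) (v n)) \<le> t n * norm Y"
      using Y_le[of n] t(1)[of n] by (intro mult_left_mono) auto
    then have "Re (cinner (N (v n)) (v n)) \<le> t n * norm Y + (t n)\<^sup>2"
      using near'[of n] v[of n] by (simp add: form)
    then have "norm N * Re (cinner (N (v n)) (v n)) \<le> norm N * (t n * norm Y + (t n)\<^sup>2)"
      by (rule mult_left_mono) simp
    with positive_op_norm_le[OF N] show ?thesis by (rule order_trans)
  qed
  have lim: "(\<lambda>n. norm N * (t n * norm Y + (t n)\<^sup>2)) \<longlonglongrightarrow> norm N * (0 * norm Y + 0\<^sup>2)"
    by (intro tendsto_mult tendsto_add tendsto_power tendsto_const t(2))
  have "(\<lambda>n. (norm (N (v n)))\<^sup>2) \<longlonglongrightarrow> 0"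
  proof (rule Lim_null_comparison)
    show "\<forall>\<^sub>F n in sequentially. norm ((norm (N (v n)))\<^sup>2) \<le> norm N * (t n * norm Y + (t n)\<^sup>2)"
      using le by (intro always_eventually) simp
    show "(\<lambda>n. norm N * (t n * norm Y + (t n)\<^sup>2)) \<longlonglongrightarrow> 0" using lim by simp
  qed
  then have "(\<lambda>n. sqrt ((norm (N (v n)))\<^sup>2)) \<longlonglongrightarrow> sqrt 0" by (rule tendsto_real_sqrt)
  then have Nv: "(\<lambda>n. N (v n)) \<longlonglongrightarrow> 0" by (simp add: tendsto_norm_zero_iff)
  have "T (v n) \<in> closure (T ` cball 0 1)" for n
    by (rule subsetD[OF closure_subset], rule imageI) (simp add: v)
  then obtain w r where r: "strict_mono (r :: nat \<Rightarrow> nat)" "((\<lambda>n. T (v n)) \<circ> r) \<longlonglongrightarrow> w"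
    using T(2)[unfolded compact_op_def compact_def, rule_format, of "\<lambda>n. T (v n)"] by auto
  have Nr: "(\<lambda>n. N (v (r n))) \<longlonglongrightarrow> 0"
    using LIMSEQ_subseq_LIMSEQ[OF Nv r(1)] by (simp add: comp_def)
  define u where "u = (1 / M) *\<^sub>R w"
  have "(\<lambda>n. (1 / M) *\<^sub>R (N (v (r n)) + T (v (r n)))) \<longlonglongrightarrow> (1 / M) *\<^sub>R (0 + w)"
    using r(2) by (intro tendsto_intros Nr) (simp add: comp_def)
  then have vu: "(\<lambda>n. v (r n)) \<longlonglongrightarrow> u"
    using M(1) by (simp add: N_apply u_def)
  have "(\<lambda>n. norm (v (r n))) \<longlonglongrightarrow> norm u" by (intro tendsto_intros vu)
  then have u1: "norm u = 1" by (simp add: v LIMSEQ_const_iff)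
  have "(\<lambda>n. N (v (r n))) \<longlonglongrightarrow> N u" by (intro tendsto_intros vu)
  then have "N u = 0" using Nr LIMSEQ_unique by blast
  then have Tu: "T u = M *\<^sub>R u" by (simp add: N_apply)
  \<comment> \<open>The form of \<open>T\<close> alone cannot exceed \<open>M\<close>, so the
    perturbation term has to make up the difference down to the tolerance.\<close>
  have "- t n \<le> Re (cinner (Y (v n)) (v n))" for n
  proof -
    have "- (t n)\<^sup>2 \<le> t n * Re (cinner (Y (v n)) (v n))"
      using near'[of n] M(2)[of "v n"] v[of n] by simp
    then have "t n * - t n \<le> t n * Re (cinner (Y (v n)) (v n))" by (simp add: power2_eq_square)
    then show ?thesis using t(1)[of n] by (simp only: mult_le_cancel_left_pos)
  qed
  moreover have "(\<lambda>n. Re (cinner (Y (v (r n))) (v (r n)))) \<longlonglongrightarrow> Re (cinner (Y u) u)"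
    by (intro tendsto_intros vu)
  moreover have "(\<lambda>n. - t (r n)) \<longlonglongrightarrow> - 0"
    using LIMSEQ_subseq_LIMSEQ[OF t(2) r(1)] by (intro tendsto_minus) (simp add: comp_def)
  ultimately have "- 0 \<le> Re (cinner (Y u) u)"
    by (meson LIMSEQ_le)
  then show ?thesis using u1 Tu by auto
qed

text \<open>The first-order condition for a norm minimum along a line. The norms for
  \<open>t = 1 / (n + 1)\<close> are nearly attained by the absolute quadratic form, and one of its
  two signs occurs infinitely often.\<close>

lemma selfadjoint_perturbation:
  fixes T Y :: "'h::complex_hilbert \<Rightarrow>\<^sub>L 'h"
  assumes T: "selfadjoint T" "compact_op T" "T \<noteq> 0" and Y: "selfadjoint Y"
    and min: "\<And>t. norm T \<le> norm (T + t *\<^sub>R Y)"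
  shows "(\<exists>u. norm u = 1 \<and> T u = norm T *\<^sub>R u \<and> 0 \<le> Re (cinner (Y u) u)) \<or>
         (\<exists>u. norm u = 1 \<and> T u = (- norm T) *\<^sub>R u \<and> Re (cinner (Y u) u) \<le> 0)"
proof -
  define M where "M = norm T"
  have M: "0 < M" using T(3) by (simp add: M_def)
  have up: "Re (cinner (T v) v) \<le> M * (norm v)\<^sup>2" "- Re (cinner (T v) v) \<le> M * (norm v)\<^sup>2" for v
    using abs_quadratic_form_le[of T v] by (auto simp: M_def abs_le_iff)
  define t where "t n = inverse (real (Suc n))" for n
  have t: "0 < t n" "t \<longlonglongrightarrow> 0" for n
    unfolding t_def using LIMSEQ_inverse_real_of_nat by simp_all
  have "\<exists>v. norm v = 1 \<and> M - (t n)\<^sup>2 \<le> \<bar>Re (cinner ((T + t n *\<^sub>R Y) v) v)\<bar>" for n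
  proof -
    have "\<exists>v. norm v = 1 \<and> max 0 (M - (t n)\<^sup>2) < \<bar>Re (cinner ((T + t n *\<^sub>R Y) v) v)\<bar>"
    proof (rule norm_selfadjoint_approx)
      show "selfadjoint (T + t n *\<^sub>R Y)" by (intro selfadjoint_add selfadjoint_scaleR T Y)
      have "max 0 (M - (t n)\<^sup>2) < M" using M t(1)[of n] by simp
      also have "M \<le> norm (T + t n *\<^sub>R Y)" unfolding M_def by (rule min)
      finally show "max 0 (M - (t n)\<^sup>2) < norm (T + t n *\<^sub>R Y)" .
    qed simp
    then show ?thesis by (meson less_imp_le max_less_iff_conj)
  qed
  then obtain v where v: "\<And>n. norm (v n) = 1"
    and near: "\<And>n. M - (t n)\<^sup>2 \<le> \<bar>Re (cinner ((T + t n *\<^sub>R Y) (v n)) (v n))\<bar>" by metis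
  define P where "P = {n. M - (t n)\<^sup>2 \<le> Re (cinner ((T + t n *\<^sub>R Y) (v n)) (v n))}"
  define Q where "Q = {n. M - (t n)\<^sup>2 \<le> - Re (cinner ((T + t n *\<^sub>R Y) (v n)) (v n))}"
  have "n \<in> P \<union> Q" for n
    using near[of n] unfolding P_def Q_def by (auto simp: abs_if split: if_splits)
  then have "infinite (P \<union> Q)" by (metis UNIV_eq_I infinite_UNIV_nat)
  then consider "infinite P" | "infinite Q" by auto
  then show ?thesis
  proof cases
    case 1
    obtain r where r: "strict_mono (r :: nat \<Rightarrow> nat)" "\<And>n. r n \<in> P"
      using infinite_enumerate[OF 1] by blast
    have "\<exists>u. norm u = 1 \<and> T u = M *\<^sub>R u \<and> 0 \<le> Re (cinner (Y u) u)"
    proof (rule selfadjoint_perturbation_upper[where t = "t \<circ> r" and v = "v \<circ> r"])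
      show "(t \<circ> r) \<longlonglongrightarrow> 0" using LIMSEQ_subseq_LIMSEQ[OF t(2) r(1)] .
      show "M - ((t \<circ> r) n)\<^sup>2 \<le> Re (cinner ((T + (t \<circ> r) n *\<^sub>R Y) ((v \<circ> r) n)) ((v \<circ> r) n))" for n
        using r(2)[of n] by (simp add: P_def)
    qed (use T M up t v in auto)
    then show ?thesis unfolding M_def by blast
  next
    case 2
    obtain r where r: "strict_mono (r :: nat \<Rightarrow> nat)" "\<And>n. r n \<in> Q"
      using infinite_enumerate[OF 2] by blast
    \<comment> \<open>For the negative sign the one-sided lemma is applied to \<open>- T\<close> and
      \<open>- Y\<close>; the resulting eigenvalue and inequality are then negated.\<close>
    have "\<exists>u. norm u = 1 \<and> (- T) u = M *\<^sub>R u \<and> 0 \<le> Re (cinner ((- Y) u) u)"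
    proof (rule selfadjoint_perturbation_upper[where t = "t \<circ> r" and v = "v \<circ> r"])
      show "selfadjoint (- T)" by (intro selfadjoint_uminus T)
      have "(- T) ` cball 0 1 = uminus ` (T ` cball 0 1)"
        by (auto simp: blinfun.minus_left image_image)
      also have "\<dots> \<subseteq> uminus ` closure (T ` cball 0 1)" by (intro image_mono closure_subset)
      finally show "compact_op (- T)"
        using T(2) by (intro compact_opI[OF compact_negations]) (auto simp: compact_op_def)
      show "(t \<circ> r) \<longlonglongrightarrow> 0" using LIMSEQ_subseq_LIMSEQ[OF t(2) r(1)] .
      show "M - ((t \<circ> r) n)\<^sup>2 \<le> Re (cinner ((- T + (t \<circ> r) n *\<^sub>R - Y) ((v \<circ> r) n)) ((v \<circ> r) n))" for n
        using r(2)[of n] by (simp add: Q_def blinfun.minus_left blinfun.diff_left blinfun.add_left cinner_simps)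
      show "Re (cinner ((- T) v) v) \<le> M * (norm v)\<^sup>2" for v
        using up(2)[of v] by (simp add: blinfun.minus_left cinner_simps)
    qed (use M t v in auto)
    then obtain u where "norm u = 1" "- T u = M *\<^sub>R u" "Re (cinner (Y u) u) \<le> 0"
      by (auto simp: blinfun.minus_left cinner_simps)
    then have "T u = (- M) *\<^sub>R u" by (metis minus_equation_iff scaleR_minus_left)
    with \<open>norm u = 1\<close> \<open>Re (cinner (Y u) u) \<le> 0\<close> show ?thesis
      unfolding M_def by (intro disjI2 exI[of _ u] conjI)
  qed
qed

section \<open>The convex hull of the moment of one subspace and the negative moment of another\<close>

text \<open>The hull described in the overview: the division of the total mass 1 between
  \<open>ws\<close> and \<open>us\<close> is the convex weight, and an empty list on one side gives
  the points of a single moment.\<close>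

definition signed_moment ::
  "(nat \<Rightarrow> 'h::complex_hilbert) \<Rightarrow> 'h set \<Rightarrow> 'h set \<Rightarrow> (nat \<Rightarrow> real) set" where
  "signed_moment e S T = {(\<lambda>k. vec_density e ws k - vec_density e us k) | ws us.
     set ws \<subseteq> S \<and> set us \<subseteq> T \<and> mass ws + mass us = 1}"

lemma signed_moment_convex:
  assumes S: "complex_vector.subspace S" "complex_vector.subspace T"
    and c: "c \<in> signed_moment e S T" "d \<in> signed_moment e S T" and s: "0 \<le> s" "s \<le> 1"
  shows "(\<lambda>k. (1 - s) * c k + s * d k) \<in> signed_moment e S T"
proof -
  obtain ws us where 1: "set ws \<subseteq> S" "set us \<subseteq> T" "mass ws + mass us = 1"
    "c = (\<lambda>k. vec_density e ws k - vec_density e us k)"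
    using c(1) unfolding signed_moment_def by blast
  obtain ws' us' where 2: "set ws' \<subseteq> S" "set us' \<subseteq> T" "mass ws' + mass us' = 1"
    "d = (\<lambda>k. vec_density e ws' k - vec_density e us' k)"
    using c(2) unfolding signed_moment_def by blast
  let ?f = "\<lambda>r ws. map (\<lambda>w. sqrt r *\<^sub>R w) ws"
  let ?w = "?f (1 - s) ws @ ?f s ws'" and ?u = "?f (1 - s) us @ ?f s us'"
  have "set ?w \<subseteq> S" "set ?u \<subseteq> T"
    using set_scale_subset[OF S(1) 1(1)] set_scale_subset[OF S(2) 1(2)]
      set_scale_subset[OF S(1) 2(1)] set_scale_subset[OF S(2) 2(2)] by (simp_all del: set_map)
  moreover have "mass ?w + mass ?u = 1"
  proof -
    have "mass ?w + mass ?u = (1 - s) * (mass ws + mass us) + s * (mass ws' + mass us')"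
      using s by (simp add: mass_scale algebra_simps)
    then show ?thesis by (simp add: 1(3) 2(3))
  qed
  moreover have "(\<lambda>k. (1 - s) * c k + s * d k) = (\<lambda>k. vec_density e ?w k - vec_density e ?u k)"
    using s by (simp add: vec_density_scale 1(4) 2(4) algebra_simps)
  ultimately show ?thesis
    unfolding signed_moment_def by (intro CollectI exI[of _ ?w] exI[of _ ?u] conjI)
qed

context onb
begin

text \<open>The sum of both densities dominates their difference and has total 1. This puts the hull
  into the summable sequences, hence into the square summable and the null sequences.\<close>

lemma signed_moment_bound:
  assumes "c \<in> signed_moment e S T"
  obtains p where "p sums 1" "\<And>k. \<bar>c k\<bar> \<le> p k" "\<And>k. p k \<le> 1"
proof -
  obtain ws us where 1: "mass ws + mass us = 1" "c = (\<lambda>k. vec_density e ws k - vec_density e us k)"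
    using assms unfolding signed_moment_def by blast
  show ?thesis
  proof (rule that[of "\<lambda>k. vec_density e ws k + vec_density e us k"])
    show "(\<lambda>k. vec_density e ws k + vec_density e us k) sums 1"
      using sums_add[OF vec_density_sums[of ws] vec_density_sums[of us]] by (simp add: 1(1))
    show "\<bar>c k\<bar> \<le> vec_density e ws k + vec_density e us k" for k
      using vec_density_nonneg[of e ws k] vec_density_nonneg[of e us k] by (simp add: 1(2))
    show "vec_density e ws k + vec_density e us k \<le> 1" for k
      using vec_density_le_mass[of ws k] vec_density_le_mass[of us k] by (simp flip: 1(1))
  qed
qed

lemma signed_moment_mult_summable:
  assumes "c \<in> signed_moment e S T" "d \<in> signed_moment e S T"
  shows "summable (\<lambda>k. c k * d k)" "(\<Sum>k. c k * d k) \<le> 1"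
proof -
  obtain p where p: "p sums 1" "\<And>k. \<bar>c k\<bar> \<le> p k" "\<And>k. p k \<le> 1"
    using signed_moment_bound[OF assms(1)] by blast
  obtain q where q: "q sums 1" "\<And>k. \<bar>d k\<bar> \<le> q k" "\<And>k. q k \<le> 1"
    using signed_moment_bound[OF assms(2)] by blast
  have le: "\<bar>c k * d k\<bar> \<le> p k" for k
  proof -
    have "\<bar>c k\<bar> * \<bar>d k\<bar> \<le> p k * 1"
      using p(2)[of k] q(2,3)[of k] by (intro mult_mono) auto
    then show ?thesis by (simp add: abs_mult)
  qed
  show "summable (\<lambda>k. c k * d k)"
    by (rule summable_comparison_test'[OF sums_summable[OF p(1)], of 0]) (use le in simp)
  then have "(\<Sum>k. c k * d k) \<le> suminf p"
    by (rule suminf_le[OF abs_le_D1[OF le] _ sums_summable[OF p(1)]])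
  then show "(\<Sum>k. c k * d k) \<le> 1" using sums_unique[OF p(1)] by simp
qed

text \<open>Each point is rewritten with \<open>card F\<close> and \<open>card G\<close> vectors
  from the unit balls, which are compact. Along a common subsequence these vectors converge in norm,
  so both the total mass 1 and the densities pass to the limit.\<close>

lemma signed_moment_closed_0:
  assumes F: "finite F" "orthonormal_set F" "complex_vector.span F = S" "compact (S \<inter> cball 0 1)"
    and G: "finite G" "orthonormal_set G" "complex_vector.span G = T" "compact (T \<inter> cball 0 1)"
    and c: "\<And>n::nat. c n \<in> signed_moment e S T" "\<And>k. (\<lambda>n. c n k) \<longlonglongrightarrow> 0"
  shows "(\<lambda>_. 0) \<in> signed_moment e S T"
proof -
  \<comment> \<open>A normal form of the n-th point with list lengths independent of
    \<open>n\<close>.\<close>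
  define R where "R n ws us \<longleftrightarrow> set ws \<subseteq> S \<inter> cball 0 1 \<and> set us \<subseteq> T \<inter> cball 0 1 \<and>
      length ws = card F \<and> length us = card G \<and> mass ws + mass us = 1 \<and>
      c n = (\<lambda>k. vec_density e ws k - vec_density e us k)" for n ws us
  have "\<exists>ws us. R n ws us" for n
  proof -
    obtain ws us where 1: "set ws \<subseteq> S" "set us \<subseteq> T" "mass ws + mass us = 1"
      "c n = (\<lambda>k. vec_density e ws k - vec_density e us k)"
      using c(1)[of n] unfolding signed_moment_def by blast
    obtain ws' where w: "set ws' \<subseteq> S" "length ws' = card F" "mass ws' = mass ws" "vec_density e ws' = vec_density e ws"
      using vector_system_reduce[OF F(1,2), of ws e] 1(1) unfolding F(3) by auto
    obtain us' where u: "set us' \<subseteq> T" "length us' = card G" "mass us' = mass us" "vec_density e us' = vec_density e us"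
      using vector_system_reduce[OF G(1,2), of us e] 1(2) unfolding G(3) by auto
    have le: "norm x \<le> 1" if "x \<in> set xs" "mass xs \<le> 1" for x :: 'h and xs
    proof -
      have "(norm x)\<^sup>2 \<le> mass xs" using that(1)
      proof (induction xs)
        case (Cons y ys)
        then show ?case using mass_nonneg[of ys] by (auto simp: add_increasing)
      qed simp
      then have "(norm x)\<^sup>2 \<le> 1" using that(2) by simp
      then show ?thesis by (simp add: power2_nonneg_ge_1_iff abs_square_le_1)
    qed
    have "mass ws' \<le> 1" "mass us' \<le> 1"
      using 1(3) w(3) u(3) mass_nonneg[of ws] mass_nonneg[of us] by linarith+
    then have "set ws' \<subseteq> S \<inter> cball 0 1" "set us' \<subseteq> T \<inter> cball 0 1"
      using w(1) u(1) le by auto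
    then show ?thesis using w u 1 unfolding R_def by (intro exI[of _ ws'] exI[of _ us']) simp
  qed
  then obtain W where "\<forall>n. \<exists>us. R n (W n) us" using choice[of "\<lambda>n ws. \<exists>us. R n ws us"] by blast
  from choice[OF this] obtain U where "\<And>n. R n (W n) (U n)" by blast
  then have
    W: "\<And>n. length (W n) = card F" "\<And>n. set (W n) \<subseteq> S \<inter> cball 0 1" and
    U: "\<And>n. length (U n) = card G" "\<And>n. set (U n) \<subseteq> T \<inter> cball 0 1" and
    m: "\<And>n. mass (W n) + mass (U n) = 1" and
    cn: "\<And>n. c n = (\<lambda>k. vec_density e (W n) k - vec_density e (U n) k)"
    by (simp_all add: R_def)
  obtain l \<sigma> where l: "strict_mono (\<sigma> :: nat \<Rightarrow> nat)" "length l = card F" "set l \<subseteq> S \<inter> cball 0 1"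
    "\<And>i. i < card F \<Longrightarrow> (\<lambda>n. W (\<sigma> n) ! i) \<longlonglongrightarrow> l ! i"
    using list_seq_compact[where ws = W, OF F(4) W] by (elim exE conjE) auto
  obtain l' \<tau> where l': "strict_mono (\<tau> :: nat \<Rightarrow> nat)" "length l' = card G" "set l' \<subseteq> T \<inter> cball 0 1"
    "\<And>i. i < card G \<Longrightarrow> (\<lambda>n. U (\<sigma> (\<tau> n)) ! i) \<longlonglongrightarrow> l' ! i"
    using list_seq_compact[where ws = "\<lambda>n. U (\<sigma> n)", OF G(4) U] by (elim exE conjE) auto
  have lW: "(\<lambda>n. W (\<sigma> (\<tau> n)) ! i) \<longlonglongrightarrow> l ! i" if "i < card F" for i
    using LIMSEQ_subseq_LIMSEQ[OF l(4)[OF that] l'(1)] by (simp add: comp_def)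
  have "(\<lambda>n. mass (W (\<sigma> (\<tau> n))) + mass (U (\<sigma> (\<tau> n)))) \<longlonglongrightarrow> mass l + mass l'"
    by (intro tendsto_add mass_tendsto) (use W U l l' lW in auto)
  then have ml: "mass l + mass l' = 1" by (simp add: m LIMSEQ_const_iff)
  have "vec_density e l k - vec_density e l' k = 0" for k
  proof -
    have "(\<lambda>n. vec_density e (W (\<sigma> (\<tau> n))) k - vec_density e (U (\<sigma> (\<tau> n))) k)
        \<longlonglongrightarrow> vec_density e l k - vec_density e l' k"
      by (intro tendsto_diff vec_density_tendsto) (use W U l l' lW in auto)
    moreover have "(\<lambda>n. c (\<sigma> (\<tau> n)) k) \<longlonglongrightarrow> 0"
      using LIMSEQ_subseq_LIMSEQ[OF c(2) strict_mono_o[OF l(1) l'(1)], of k] by (simp add: comp_def)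
    ultimately show ?thesis unfolding cn using LIMSEQ_unique by blast
  qed
  then have "(\<lambda>_. 0) = (\<lambda>k. vec_density e l k - vec_density e l' k)" by simp
  then show ?thesis unfolding signed_moment_def using l(3) l'(3) ml by blast
qed

lemma moments_intersect:
  assumes S: "complex_vector.subspace S" "complex_vector.subspace T"
    and ws: "set ws \<subseteq> S" "set us \<subseteq> T" "vec_density e ws = vec_density e us" "mass ws \<noteq> 0"
  shows "moment e S \<inter> moment e T \<noteq> {}"
proof -
  have m: "mass us = mass ws"
    using vec_density_sums[of ws] vec_density_sums[of us] ws(3) by (simp add: sums_unique2)
  have pos: "mass ws > 0" using ws(4) mass_nonneg[of ws] by simp
  let ?f = "map (\<lambda>w. (1 / sqrt (mass ws)) *\<^sub>R w)"
  have "vec_density e (?f ws) = vec_density e (?f us)"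
    by (rule ext) (simp add: vec_density_scale ws(3) del: map_map)
  moreover have "mass (?f ws) = 1" "mass (?f us) = 1"
    using pos by (simp_all add: mass_scale m power_divide)
  moreover have "set (?f ws) \<subseteq> S" "set (?f us) \<subseteq> T"
    by (rule set_scale_subset[OF S(1) ws(1)], rule set_scale_subset[OF S(2) ws(2)])
  ultimately have "vec_density e (?f ws) \<in> moment e S" and "vec_density e (?f ws) \<in> moment e T"
    unfolding moment_iff[OF S(1)] moment_iff[OF S(2)] by (metis, metis)
  then show ?thesis by blast
qed

text \<open>Equal densities force equal masses, so both masses are one half and the lists can be
  rescaled to mass 1. This excludes a trivial cancellation.\<close>

lemma signed_moment_0_imp:
  assumes S: "complex_vector.subspace S" "complex_vector.subspace T"
    and 0: "(\<lambda>_. 0) \<in> signed_moment e S T"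
  shows "moment e S \<inter> moment e T \<noteq> {}"
proof -
  obtain ws us where 1: "set ws \<subseteq> S" "set us \<subseteq> T" "mass ws + mass us = 1"
    "(\<lambda>_. 0) = (\<lambda>k. vec_density e ws k - vec_density e us k)"
    using 0 unfolding signed_moment_def by blast
  have "vec_density e ws k = vec_density e us k" for k using fun_cong[OF 1(4), of k] by simp
  then have eq: "vec_density e ws = vec_density e us" by blast
  then have "mass us = mass ws"
    using vec_density_sums[of ws] vec_density_sums[of us] by (simp add: sums_unique2)
  then have "mass ws \<noteq> 0" using 1(3) by auto
  then show ?thesis by (rule moments_intersect[OF S 1(1,2) eq])
qed

text \<open>A near-minimiser \<open>z\<close> of the \<open>\<ell>\<^sup>2\<close> norm over the signed moment separates it from \<open>0\<close>; a
  minimiser would do as well, but its existence would need one more compactness argument.\<close>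

lemma signed_moment_separation:
  assumes S: "complex_vector.subspace S" "complex_vector.subspace T"
    and ne: "signed_moment e S T \<noteq> {}" and d: "0 < d" "\<And>c. c \<in> signed_moment e S T \<Longrightarrow> d \<le> (\<Sum>k. c k * c k)"
    and inf: "\<And>r. d < r \<Longrightarrow> \<exists>c\<in>signed_moment e S T. (\<Sum>k. c k * c k) < r"
  shows "\<exists>z\<in>signed_moment e S T. \<forall>c\<in>signed_moment e S T. 0 < (\<Sum>k. z k * c k)"
proof -
  note sm = signed_moment_mult_summable
  have d1: "d \<le> 1" using ne d(2) sm(2) by (meson all_not_in_conv order_trans)
  \<comment> \<open>The slack \<open>d\<^sup>2 / 2\<close> is small enough for the step length
    \<open>d / 2\<close> below to bring the squared norm strictly below \<open>d\<close>.\<close>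
  obtain z where z: "z \<in> signed_moment e S T" "(\<Sum>k. z k * z k) < d + d\<^sup>2 / 2"
    using inf[of "d + d\<^sup>2 / 2"] d(1) by auto
  have "0 < (\<Sum>k. z k * c k)" if c: "c \<in> signed_moment e S T" for c
  proof (rule ccontr)
    assume neg: "\<not> ?thesis"
    \<comment> \<open>If \<open>c\<close> had no positive product with \<open>z\<close>, moving from
      \<open>z\<close> towards \<open>c\<close> by \<open>d / 2\<close> would give squared norm at
      most \<open>d - 3 / 8 * d ^ 3\<close>, below the infimum.\<close>
    define s where "s = d / 2"
    have s: "0 \<le> s" "s \<le> 1" using d(1) d1 by (simp_all add: s_def)
    define x where "x k = (1 - s) * z k + s * c k" for k
    have "x \<in> signed_moment e S T" unfolding x_def using signed_moment_convex[OF S z(1) c s] .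
    then have "d \<le> (\<Sum>k. x k * x k)" by (rule d(2))
    also have "(\<Sum>k. x k * x k) = (1 - s)\<^sup>2 * (\<Sum>k. z k * z k) + 2 * s * (1 - s) * (\<Sum>k. z k * c k) + s\<^sup>2 * (\<Sum>k. c k * c k)"
    proof -
      have sums: "(\<lambda>k. (1 - s)\<^sup>2 * (z k * z k) + 2 * s * (1 - s) * (z k * c k) + s\<^sup>2 * (c k * c k)) sums
        ((1 - s)\<^sup>2 * (\<Sum>k. z k * z k) + 2 * s * (1 - s) * (\<Sum>k. z k * c k) + s\<^sup>2 * (\<Sum>k. c k * c k))"
        using sm(1)[OF z(1) z(1)] sm(1)[OF z(1) c] sm(1)[OF c c]
        by (intro sums_add sums_mult summable_sums)
      have x: "x k * x k = (1 - s)\<^sup>2 * (z k * z k) + 2 * s * (1 - s) * (z k * c k) + s\<^sup>2 * (c k * c k)" for k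
        by (simp add: x_def power2_eq_square algebra_simps)
      show ?thesis by (simp only: x sums_unique[OF sums, symmetric])
    qed
    also have "\<dots> \<le> (1 - s)\<^sup>2 * (\<Sum>k. z k * z k) + s\<^sup>2"
    proof -
      have "2 * s * (1 - s) * (\<Sum>k. z k * c k) \<le> 0"
        using neg s by (intro mult_nonneg_nonpos) auto
      moreover have "s\<^sup>2 * (\<Sum>k. c k * c k) \<le> s\<^sup>2 * 1"
        using sm(2)[OF c c] by (intro mult_left_mono) auto
      ultimately show ?thesis by simp
    qed
    finally have "d \<le> (1 - s)\<^sup>2 * (\<Sum>k. z k * z k) + s\<^sup>2" .
    moreover have "(1 - s)\<^sup>2 * (\<Sum>k. z k * z k) \<le> (1 - 3 / 2 * s) * (\<Sum>k. z k * z k)"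
    proof (rule mult_right_mono)
      \<comment> \<open>As \<open>d \<le> 1\<close>, the step is at most one half, which replaces
        the square of \<open>1 - s\<close> by a linear bound.\<close>
      have "s * s \<le> s * (1 / 2)" using s d1 by (intro mult_left_mono) (auto simp: s_def)
      then show "(1 - s)\<^sup>2 \<le> 1 - 3 / 2 * s" by (simp add: power2_eq_square algebra_simps)
      show "0 \<le> (\<Sum>k. z k * z k)" using d(1) d(2)[OF z(1)] by simp
    qed
    moreover have "(1 - 3 / 2 * s) * (\<Sum>k. z k * z k) \<le> (1 - 3 / 2 * s) * (d + d\<^sup>2 / 2)"
      using z(2) d1 by (intro mult_left_mono) (auto simp: s_def)
    moreover have "(1 - 3 / 2 * s) * (d + d\<^sup>2 / 2) + s\<^sup>2 = d - 3 / 8 * d ^ 3"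
      by (simp add: s_def power2_eq_square power3_eq_cube algebra_simps)
    ultimately have "d \<le> d - 3 / 8 * d ^ 3" by linarith
    then show False using zero_less_power[OF d(1), of 3] by linarith
  qed
  then show ?thesis using z(1) by blast
qed

end

section \<open>Quadratic forms on vector systems\<close>

definition quad :: "('h::complex_hilbert \<Rightarrow>\<^sub>L 'h) \<Rightarrow> 'h list \<Rightarrow> real" where
  "quad T ws = (\<Sum>w\<leftarrow>ws. Re (cinner (T w) w))"

lemma quad_simps [simp]: "quad T [] = 0" "quad T (w # ws) = Re (cinner (T w) w) + quad T ws"
  by (simp_all add: quad_def)

lemma quad_add: "quad (S + T) ws = quad S ws + quad T ws"
  by (induction ws) (auto simp: blinfun.add_left cinner_simps)

lemma quad_scaleR: "quad (r *\<^sub>R T) ws = r * quad T ws"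
  by (induction ws) (auto simp: blinfun.scaleR_left cinner_simps algebra_simps)

lemma abs_quad_le: "\<bar>quad T ws\<bar> \<le> norm T * mass ws"
proof (induction ws)
  case (Cons w ws)
  then show ?case using abs_quadratic_form_le[of T w] by (simp add: distrib_left)
qed simp

lemma quad_eigenspace: "set ws \<subseteq> eigenspace_op T c \<Longrightarrow> quad T ws = c * mass ws"
  by (induction ws) (auto simp: eigenspace_op_def cinner_simps cinner_self distrib_left)

context onb
begin

lemma quad_le_lambda_max:
  fixes T :: "'h \<Rightarrow>\<^sub>L 'h"
  assumes "selfadjoint T"
  shows "quad T ws \<le> lambda_max T * mass ws"
proof (induction ws)
  case (Cons w ws)
  then show ?case using lambda_max_ge[OF assms, of w] by (simp add: distrib_left)
qed simp

lemma lambda_min_le_quad: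
  fixes T :: "'h \<Rightarrow>\<^sub>L 'h"
  assumes "selfadjoint T"
  shows "lambda_min T * mass ws \<le> quad T ws"
proof (induction ws)
  case (Cons w ws)
  then show ?case using lambda_min_le[OF assms, of w] by (simp add: distrib_left)
qed simp

lemma quad_diagonal_sums:
  assumes D: "diagonal_op e D"
  shows "(\<lambda>k. Re (cinner (D (e k)) (e k)) * vec_density e ws k) sums quad D ws"
proof (induction ws)
  case (Cons w ws)
  have "(\<lambda>k. Re (cinner (D (e k)) (e k)) * (cmod (cinner w (e k)))\<^sup>2) sums Re (cinner (D w) w)"
    using sums_Re[OF diagonal_form_sums[OF D, of w]] by simp
  from sums_add[OF this Cons.IH] show ?case by (simp add: distrib_left)
qed simp

lemma quad_Diag_sums: "(\<lambda>k. c0_nth y k * vec_density e ws k) sums quad (Diag e y) ws"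
proof (induction ws)
  case (Cons w ws)
  from sums_add[OF Diag_form_sums[of y w] Cons.IH] show ?case by (simp add: distrib_left)
qed simp

text \<open>A diagonal operator sees only the diagonal of a vector system. This is the cancellation
  behind all lower bounds from a common moment point.\<close>

lemma quad_diagonal_cong:
  assumes "diagonal_op e D" "vec_density e ws = vec_density e us"
  shows "quad D ws = quad D us"
  using quad_diagonal_sums[OF assms(1), of ws] quad_diagonal_sums[OF assms(1), of us] assms(2)
  by (simp add: sums_unique2)

end

section \<open>Joint numerical ranges of compressed diagonal projections\<close>

definition list_op :: "'h::complex_hilbert list \<Rightarrow> ('h \<Rightarrow>\<^sub>L 'h)" where
  "list_op ws = (\<Sum>w\<leftarrow>ws. outer w)"

lemma list_op_apply: "list_op ws u = (\<Sum>w\<leftarrow>ws. cinner u w *\<^sub>C w)"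
  unfolding list_op_def by (induction ws) (auto simp: blinfun.add_left outer_apply)

lemma cinner_list_op: "cinner (list_op ws u) v = (\<Sum>w\<leftarrow>ws. cinner u w * cinner w v)"
  unfolding list_op_apply by (induction ws) (auto simp: cinner_simps)

lemma selfadjoint_list_op: "selfadjoint (list_op ws)"
proof (induction ws)
  case Nil
  show ?case by (simp add: list_op_def selfadjoint_def bounded_ops_def)
next
  case (Cons w ws)
  then show ?case unfolding list_op_def by (simp add: selfadjoint_add selfadjoint_outer)
qed

lemma list_op_form: "cinner (list_op ws u) u = of_real (\<Sum>w\<leftarrow>ws. (cmod (cinner w u))\<^sup>2)"
  unfolding cinner_list_op
proof (induction ws)
  case (Cons w ws)
  have "cinner u w * cinner w u = of_real ((cmod (cinner w u))\<^sup>2)"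
    by (simp only: cinner_mult_commute cmod_cinner_commute[of u w])
  with Cons show ?case by (simp only: list.map sum_list.Cons of_real_add)
qed simp

lemma positive_op_list_op: "positive_op (list_op ws)"
  unfolding positive_op_def list_op_form
  by (auto simp: selfadjoint_list_op intro!: sum_list_nonneg)

lemma compression_outer:
  assumes P: "is_orth_proj P S"
  shows "compression S (outer v) = outer (P v)"
  unfolding compression_def is_orth_projD(4)[OF P]
  by (rule blinfun_eqI)
    (simp add: outer_apply bounded_opsD[OF is_orth_projD(5)[OF P]] is_orth_projD(3)[OF P])

context onb
begin

text \<open>Parseval for \<open>R g\<close> and \<open>g\<close>. Only traces against rank-one
  operators occur, so no general theory of the trace is needed.\<close>

lemma trace_op_compose_outer: "trace_op e (R o\<^sub>L outer g) = cinner (R g) g" if "R \<in> bounded_ops"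
proof -
  have "cinner ((R o\<^sub>L outer g) (e k)) (e k) = cinner (R g) (e k) * cinner (e k) g" for k
    using that by (simp add: outer_apply bounded_opsD cinner_simps)
  then show ?thesis
    unfolding trace_op_def using infsumI[OF Parseval_has_sum[of "R g" g]] by simp
qed

lemma list_op_has_sum:
  "((\<lambda>k. cinner (list_op ws (e k)) (e k)) has_sum of_real (mass ws)) UNIV"
proof -
  have "(\<lambda>k. vec_density e ws k) sums mass ws" by (rule vec_density_sums)
  then have "(vec_density e ws has_sum mass ws) UNIV"
    by (rule norm_summable_imp_has_sum[rotated])
      (use sums_summable[OF vec_density_sums] in \<open>simp add: abs_of_nonneg vec_density_nonneg\<close>)
  then have "((\<lambda>k. complex_of_real (vec_density e ws k)) has_sum of_real (mass ws)) UNIV"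
    by (rule has_sum_of_real)
  then show ?thesis by (simp add: list_op_form vec_density_def)
qed

text \<open>\<open>list_op ws\<close> is the density operator. The vectors may lie anywhere in the
  space, which also covers states supported off \<open>S\<close>.\<close>

lemma density_mem_joint_numerical_range:
  assumes P: "is_orth_proj P S" and ws: "mass ws = 1"
  shows "(\<lambda>j. of_real (\<Sum>w\<leftarrow>ws. (cmod (cinner w (P (e j))))\<^sup>2))
    \<in> joint_numerical_range e (\<lambda>i. compression S (outer (e i)))"
proof -
  have "trace_class e (list_op ws)"
    unfolding trace_class_def
    \<comment> \<open>A positive operator is its own absolute value, hence the witness
      \<open>list_op ws\<close>.\<close>
    using positive_op_list_op selfadjointD(1)[OF selfadjoint_list_op] has_sum_imp_summable[OF list_op_has_sum]
    by (intro conjI exI[of _ "list_op ws"]) auto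
  moreover have "trace_op e (list_op ws) = 1"
    unfolding trace_op_def using infsumI[OF list_op_has_sum[of ws]] ws by simp
  moreover have "trace_op e (list_op ws o\<^sub>L compression S (outer (e j)))
      = of_real (\<Sum>w\<leftarrow>ws. (cmod (cinner w (P (e j))))\<^sup>2)" for j
    unfolding compression_outer[OF P] trace_op_compose_outer[OF selfadjointD(1)[OF selfadjoint_list_op]]
    by (rule list_op_form)
  ultimately show ?thesis
    unfolding joint_numerical_range_def
    by (intro CollectI exI[of _ "list_op ws"]) (auto simp: selfadjoint_list_op positive_op_list_op)
qed

lemma moment_joint_numerical_range:
  assumes P: "is_orth_proj P S" and a: "a \<in> moment e S"
  shows "(\<lambda>j. of_real (a j)) \<in> joint_numerical_range e (\<lambda>i. compression S (outer (e i)))"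
proof -
  have S: "complex_vector.subspace S" using P by (simp add: is_orth_proj_def)
  obtain ws where ws: "set ws \<subseteq> S" "mass ws = 1" "a = vec_density e ws"
    using a unfolding moment_iff[OF S] by blast
  have "(\<Sum>w\<leftarrow>ws. (cmod (cinner w (P (e j))))\<^sup>2) = vec_density e ws j" for j
    unfolding vec_density_def using ws(1)
    by (intro arg_cong[of _ _ sum_list] map_cong[OF refl])
      (simp add: subset_iff is_orth_projD(2)[OF P] flip: is_orth_projD(3)[OF P])
  then show ?thesis using density_mem_joint_numerical_range[OF P ws(2)] ws(3) by simp
qed

text \<open>The compressed operators see only the form of the density operator on the span, and
  Cholesky turns that form into vectors. Nothing is asserted about their mass, since part of the
  trace may lie off the span.\<close>

lemma joint_numerical_range_density:
  assumes F: "finite F" "orthonormal_set F"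
    and c: "c \<in> joint_numerical_range e (\<lambda>i. compression (complex_vector.span F) (outer (e i)))"
  shows "\<exists>ws. set ws \<subseteq> complex_vector.span F \<and> c = (\<lambda>j. of_real (vec_density e ws j))"
proof -
  obtain R where R: "positive_op R"
    "c = (\<lambda>j. trace_op e (R o\<^sub>L compression (complex_vector.span F) (outer (e j))))"
    using c unfolding joint_numerical_range_def by blast
  have b: "R \<in> bounded_ops" using R(1) by (simp add: positive_op_def selfadjoint_def)
  have cj: "c j = cinner (R (proj_sum F (e j))) (proj_sum F (e j))" for j
    unfolding R(2) compression_outer[OF is_orth_proj_span[OF F]] trace_op_compose_outer[OF b]
    by (simp add: bounded_linear_Blinfun_apply[OF bounded_linear_proj_sum])
  note Q = positive_op_psd_form[OF R(1)]
  obtain ws where ws: "set ws \<subseteq> complex_vector.span F"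
    "\<And>k. vec_density e ws k = Re (cinner (R (proj_sum F (e k))) (proj_sum F (e k)))"
    using psd_form_vector_system[OF F Q, of e] by (elim exE conjE) auto
  have "c j = of_real (vec_density e ws j)" for j
    unfolding cj ws(2) by (rule psd_formD(9)[OF Q])
  then show ?thesis using ws(1) by (intro exI[of _ ws] conjI ext)
qed

text \<open>In infinite dimension some unit vector is orthogonal to the span, and its state
  annihilates every compressed operator. Hence the inequality with the zero singleton in
  \<open>s4\<close> means that a nonzero common point exists.\<close>

lemma zero_mem_joint_numerical_range:
  assumes F: "finite F" "orthonormal_set F"
  shows "(\<lambda>_. 0) \<in> joint_numerical_range e (\<lambda>i. compression (complex_vector.span F) (outer (e i)))"
proof -
  obtain k where k: "e k \<notin> complex_vector.span F" using e_notin_finite[OF F(2,1)] by blast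
  define z where "z = e k - proj_sum F (e k)"
  have "z \<noteq> 0" using k proj_sum_in_span[of F "e k"] by (auto simp: z_def)
  then have "mass [sgn z] = 1" by (simp add: norm_sgn)
  note P = is_orth_proj_span[OF F]
  have "proj_sum F z = 0"
    using proj_sum_span[OF F(2,1) proj_sum_in_span[of F "e k"]] unfolding z_def
    by (simp add: linear_diff[OF bounded_linear.linear[OF bounded_linear_proj_sum]])
  then have "proj_sum F (sgn z) = 0"
    by (simp add: sgn_div_norm linear_scale[OF bounded_linear.linear[OF bounded_linear_proj_sum]])
  then have "cinner (sgn z) (proj_sum F v) = 0" for v
    by (simp flip: proj_sum_sym)
  then show ?thesis
    using density_mem_joint_numerical_range[OF P \<open>mass [sgn z] = 1\<close>]
    by (simp add: bounded_linear_Blinfun_apply[OF bounded_linear_proj_sum])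
qed

end

section \<open>Equivalence of the analytic conditions\<close>

locale minimality = onb e for e :: "nat \<Rightarrow> 'h::complex_hilbert" +
  fixes A0 :: "'h \<Rightarrow>\<^sub>L 'h" and x :: c0
  assumes A0: "A0 \<in> compact_sa_ops"
    and balanced: "lambda_max (A0 + Diag e x) = - lambda_min (A0 + Diag e x)"
begin

abbreviation "A y \<equiv> A0 + Diag e y"
abbreviation "Smax \<equiv> eigenspace_op (A x) (lambda_max (A x))"
abbreviation "Smin \<equiv> eigenspace_op (A x) (lambda_min (A x))"
abbreviation "norm_minimal \<equiv> 0 \<in> subdifferential (\<lambda>y. norm (A y)) x"

lemma selfadjoint_A: "selfadjoint (A y)"
  using A0 by (simp add: compact_sa_ops_iff selfadjoint_add selfadjoint_Diag)

lemma compact_A: "compact_op (A y)"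
  using A0 by (simp add: compact_sa_ops_iff compact_op_add compact_op_Diag)

lemma lambda_A: "lambda_max (A x) = norm (A x)" "lambda_min (A x) = - norm (A x)"
  using norm_eq_lambda_max[OF selfadjoint_A balanced] balanced by simp_all

lemma subspace_eig: "complex_vector.subspace Smax" "complex_vector.subspace Smin"
  by (intro eigenspace_subspace selfadjointD selfadjoint_A)+

lemma A_diff: "A y = A x + Diag e (y - x)"
  by (simp add: Diag_diff)

lemma norm_minimal_iff: "norm_minimal \<longleftrightarrow> (\<forall>y. norm (A x) \<le> norm (A y))"
  by (simp add: subdifferential_def)

lemma quad_eig:
  "set ws \<subseteq> Smax \<Longrightarrow> quad (A x + D) ws = norm (A x) * mass ws + quad D ws"
  "set ws \<subseteq> Smin \<Longrightarrow> quad (A x + D) ws = - norm (A x) * mass ws + quad D ws"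
  by (simp_all add: quad_add[of "A x"] quad_eigenspace lambda_A)

text \<open>With the common value \<open>q\<close> of the form of \<open>D\<close>, the two systems
  bound \<open>norm (A x + D)\<close> below by \<open>norm (A x) + q\<close> and
  \<open>norm (A x) - q\<close>. The bounds use only the modulus of the form, so \<open>D\<close>
  may fail to be self-adjoint.\<close>

lemma moments_imp_minimal:
  assumes "moment e Smax \<inter> moment e Smin \<noteq> {}" "diagonal_op e D"
  shows "norm (A x) \<le> norm (A x + D)"
proof -
  obtain ws us where ws: "set ws \<subseteq> Smax" "mass ws = 1" and us: "set us \<subseteq> Smin" "mass us = 1"
    and eq: "vec_density e ws = vec_density e us"
    using assms(1) unfolding disjoint_iff moment_iff[OF subspace_eig(1)] moment_iff[OF subspace_eig(2)] by auto
  show ?thesis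
    using abs_quad_le[of "A x + D" ws] abs_quad_le[of "A x + D" us] quad_diagonal_cong[OF assms(2) eq]
      quad_eig(1)[OF ws(1), of D] quad_eig(2)[OF us(1), of D] ws(2) us(2) by (simp add: abs_le_iff)
qed

lemma minimal_imp_norm_minimal:
  assumes "\<And>D. diagonal_op e D \<Longrightarrow> norm (A x) \<le> norm (A x + D)"
  shows norm_minimal
  unfolding norm_minimal_iff using assms[OF diagonal_Diag] A_diff by metis

text \<open>The subgradient is the trace pairing of \<open>Diag e y\<close> with the common
  diagonal. Read through \<open>ws\<close> it supports \<open>lambda_max\<close>; read through
  \<open>us\<close>, its negative supports \<open>- lambda_min\<close>.\<close>

lemma moments_imp_subdifferentials:
  assumes "moment e Smax \<inter> moment e Smin \<noteq> {}"
  shows "\<exists>\<phi> \<psi>. 0 = \<phi> + \<psi> \<and> \<phi> \<in> subdifferential (\<lambda>y. lambda_max (A y)) x \<and>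
    \<psi> \<in> subdifferential (\<lambda>y. - lambda_min (A y)) x"
proof -
  obtain ws us where ws: "set ws \<subseteq> Smax" "mass ws = 1" and us: "set us \<subseteq> Smin" "mass us = 1"
    and eq: "vec_density e ws = vec_density e us"
    using assms(1) unfolding disjoint_iff moment_iff[OF subspace_eig(1)] moment_iff[OF subspace_eig(2)] by auto
  have bl: "bounded_linear (\<lambda>y. quad (Diag e y) ws)"
  proof (rule bounded_linear_intro)
    show "norm (quad (Diag e y) ws) \<le> norm y * 1" for y
      using abs_quad_le[of "Diag e y" ws] norm_Diag_le[of y] ws(2) by simp
  qed (simp_all add: Diag_add quad_add Diag_scaleR quad_scaleR)
  define \<phi> where "\<phi> = Blinfun (\<lambda>y. quad (Diag e y) ws)"
  have \<phi>: "\<phi> y = quad (Diag e y) ws" "\<phi> y = quad (Diag e y) us" for y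
    using quad_diagonal_cong[OF diagonal_Diag eq, of y]
    by (simp_all add: \<phi>_def bounded_linear_Blinfun_apply[OF bl])
  have "\<phi> \<in> subdifferential (\<lambda>y. lambda_max (A y)) x"
    unfolding subdifferential_def
  proof (intro CollectI allI)
    fix y
    show "blinfun_apply \<phi> (y - x) \<le> lambda_max (A y) - lambda_max (A x)"
      using quad_le_lambda_max[OF selfadjoint_A, of y ws] quad_eig(1)[OF ws(1), of "Diag e (y - x)"] ws(2)
      by (simp add: \<phi>(1) A_diff[of y, symmetric] lambda_A)
  qed
  moreover have "- \<phi> \<in> subdifferential (\<lambda>y. - lambda_min (A y)) x"
    unfolding subdifferential_def
  proof (intro CollectI allI)
    fix y
    show "blinfun_apply (- \<phi>) (y - x) \<le> - lambda_min (A y) - - lambda_min (A x)"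
      using lambda_min_le_quad[OF selfadjoint_A, of y us] quad_eig(2)[OF us(1), of "Diag e (y - x)"] us(2)
      by (simp add: blinfun.minus_left \<phi>(2) A_diff[of y, symmetric] lambda_A)
  qed
  ultimately show ?thesis by (intro exI[of _ \<phi>] exI[of _ "- \<phi>"]) simp
qed

text \<open>Adding the two subgradient inequalities cancels the functionals and compares spectral
  widths: the width at \<open>x\<close> is \<open>2 * norm (A x)\<close>, and the width at
  \<open>y\<close> is at most \<open>2 * norm (A y)\<close>.\<close>

lemma subdifferentials_imp_norm_minimal:
  assumes "0 = \<phi> + \<psi>" "\<phi> \<in> subdifferential (\<lambda>y. lambda_max (A y)) x"
    "\<psi> \<in> subdifferential (\<lambda>y. - lambda_min (A y)) x"
  shows norm_minimal
  unfolding norm_minimal_iff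
proof
  fix y
  have "blinfun_apply \<phi> (y - x) + blinfun_apply \<psi> (y - x) = 0"
    using assms(1) by (metis blinfun.add_left blinfun.zero_left)
  moreover have "blinfun_apply \<phi> (y - x) \<le> lambda_max (A y) - lambda_max (A x)"
    "blinfun_apply \<psi> (y - x) \<le> - lambda_min (A y) - - lambda_min (A x)"
    using assms(2,3) unfolding subdifferential_def by blast+
  ultimately show "norm (A x) \<le> norm (A y)"
    using lambda_max_le_norm[OF selfadjoint_A[of y]] lambda_min_ge_norm[OF selfadjoint_A[of y]]
    unfolding lambda_A by linarith
qed

lemma eig_basis:
  assumes "A x \<noteq> 0"
  shows "\<exists>F. finite F \<and> orthonormal_set F \<and> complex_vector.span F = Smax"
    "\<exists>G. finite G \<and> orthonormal_set G \<and> complex_vector.span G = Smin"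
    "compact (Smax \<inter> cball 0 1)" "compact (Smin \<inter> cball 0 1)"
proof -
  show c: "compact (Smax \<inter> cball 0 1)" "compact (Smin \<inter> cball 0 1)"
    using assms by (auto intro!: eigenspace_compact compact_A simp: lambda_A)
  show "\<exists>F. finite F \<and> orthonormal_set F \<and> complex_vector.span F = Smax"
    "\<exists>G. finite G \<and> orthonormal_set G \<and> complex_vector.span G = Smin"
    by (intro finite_orthonormal_basis subspace_eig c)+
qed

lemma norm_minimal_imp_moments:
  assumes nz: "A x \<noteq> 0" and min: norm_minimal
  shows "moment e Smax \<inter> moment e Smin \<noteq> {}"
proof (rule ccontr)
  assume disj: "\<not> ?thesis"
  let ?C = "signed_moment e Smax Smin"
  obtain F G where F: "finite F" "orthonormal_set F" "complex_vector.span F = Smax"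
    and G: "finite G" "orthonormal_set G" "complex_vector.span G = Smin"
    using eig_basis(1,2)[OF nz] by blast
  have single: "(\<lambda>k. (cmod (cinner u (e k)))\<^sup>2) \<in> ?C" if "norm u = 1" "u \<in> Smax" for u
    unfolding signed_moment_def using that
    by (intro CollectI exI[of _ "[u]"] exI[of _ "[]"]) auto
  have single': "(\<lambda>k. - (cmod (cinner u (e k)))\<^sup>2) \<in> ?C" if "norm u = 1" "u \<in> Smin" for u
    unfolding signed_moment_def using that
    by (intro CollectI exI[of _ "[]"] exI[of _ "[u]"]) auto
  \<comment> \<open>The first-order condition in direction \<open>y\<close>: some extreme unit
    eigenvector is not strictly improved.\<close>
  have pert: "(\<exists>u. norm u = 1 \<and> u \<in> Smax \<and> 0 \<le> Re (cinner (Diag e y u) u)) \<or>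
      (\<exists>u. norm u = 1 \<and> u \<in> Smin \<and> Re (cinner (Diag e y u) u) \<le> 0)" for y
  proof -
    have "norm (A x) \<le> norm (A x + t *\<^sub>R Diag e y)" for t
      using min[unfolded norm_minimal_iff, rule_format, of "x + t *\<^sub>R y"]
      by (simp add: Diag_add Diag_scaleR add.assoc)
    from selfadjoint_perturbation[OF selfadjoint_A compact_A nz selfadjoint_Diag this]
    show ?thesis unfolding eigenspace_op_def lambda_A by auto
  qed
  \<comment> \<open>The zero direction already produces a unit eigenvector for one of the extreme
    eigenvalues.\<close>
  have ne: "?C \<noteq> {}" using pert[of 0] single single' by blast
  have bdd: "bdd_below ((\<lambda>c. \<Sum>k. c k * c k) ` ?C)"
    by (rule bdd_belowI2[of _ 0]) (auto intro!: suminf_nonneg signed_moment_mult_summable)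
  define d where "d = (INF c\<in>?C. \<Sum>k. c k * c k)"
  have d_le: "d \<le> (\<Sum>k. c k * c k)" if "c \<in> ?C" for c
    unfolding d_def using bdd that by (rule cINF_lower)
  have d_inf: "\<exists>c\<in>?C. (\<Sum>k. c k * c k) < r" if "d < r" for r
    using that unfolding d_def cINF_less_iff[OF ne bdd] .
  have "d \<ge> 0" unfolding d_def
    by (rule cINF_greatest[OF ne]) (auto intro!: suminf_nonneg signed_moment_mult_summable)
  show False
  proof (cases "d = 0")
    case True
    have "\<forall>n. \<exists>c. c \<in> ?C \<and> (\<Sum>k. c k * c k) < inverse (real (Suc n))"
      using d_inf True by (metis inverse_positive_iff_positive of_nat_0_less_iff zero_less_Suc)
    from choice[OF this] obtain c where c: "\<And>n. c n \<in> ?C"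
      "\<And>n. (\<Sum>k. c n k * c n k) < inverse (real (Suc n))" by blast
    \<comment> \<open>A single squared entry is at most the whole sum, so a vanishing infimum gives
      coordinatewise convergence to 0 and closedness puts 0 in the hull.\<close>
    have "(\<lambda>n. c n k) \<longlonglongrightarrow> 0" for k
    proof -
      have "(c n k)\<^sup>2 \<le> inverse (real (Suc n))" for n
      proof -
        have "(\<Sum>j\<in>{k}. c n j * c n j) \<le> (\<Sum>k. c n k * c n k)"
          by (rule sum_le_suminf) (auto intro: signed_moment_mult_summable c)
        then show ?thesis using c(2)[of n] by (simp add: power2_eq_square)
      qed
      then have "(\<lambda>n. (c n k)\<^sup>2) \<longlonglongrightarrow> 0"
        by (intro Lim_null_comparison[OF always_eventually LIMSEQ_inverse_real_of_nat]) simp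
      then have "(\<lambda>n. sqrt ((c n k)\<^sup>2)) \<longlonglongrightarrow> sqrt 0" by (rule tendsto_real_sqrt)
      then show ?thesis by (simp add: tendsto_rabs_zero_iff)
    qed
    from signed_moment_closed_0[OF F eig_basis(3)[OF nz] G eig_basis(4)[OF nz] c(1) this]
    show False using disj signed_moment_0_imp[OF subspace_eig] by blast
  next
    case False
    then have "0 < d" using \<open>d \<ge> 0\<close> by simp
    from signed_moment_separation[OF subspace_eig ne this d_le d_inf]
    obtain z where z: "z \<in> ?C" "\<And>c. c \<in> ?C \<Longrightarrow> 0 < (\<Sum>k. z k * c k)" by blast
    obtain p where p: "p sums 1" "\<And>k. \<bar>z k\<bar> \<le> p k" "\<And>k. p k \<le> 1"
      using signed_moment_bound[OF z(1)] by blast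
    have "z \<longlonglongrightarrow> 0"
      by (rule Lim_null_comparison[OF always_eventually summable_LIMSEQ_zero[OF sums_summable[OF p(1)]]])
        (simp add: p(2))
    then have z0: "c0_nth (Abs_c0 z) = z" by (simp add: Abs_c0_inverse)
    \<comment> \<open>The descent direction: along \<open>y\<close> the form decreases strictly at
      every unit vector of \<open>Smax\<close> and increases strictly at every unit vector of
      \<open>Smin\<close>, contrary to \<open>pert\<close>.\<close>
    define y where "y = - Abs_c0 z"
    have y: "Re (cinner (Diag e y u) u) = - (\<Sum>k. z k * (cmod (cinner u (e k)))\<^sup>2)" for u
    proof -
      have "(\<lambda>k. - (z k * (cmod (cinner u (e k)))\<^sup>2)) sums Re (cinner (Diag e y u) u)"
        using Diag_form_sums[of y u] by (simp add: y_def uminus_c0.rep_eq z0)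
      from sums_minus[OF this] show ?thesis by (simp add: sums_iff)
    qed
    from pert[of y] show False
    proof (elim disjE exE conjE)
      fix u assume u: "norm u = 1" "u \<in> Smax" "0 \<le> Re (cinner (Diag e y u) u)"
      then show False using z(2)[OF single[OF u(1,2)]] by (simp add: y)
    next
      fix u assume u: "norm u = 1" "u \<in> Smin" "Re (cinner (Diag e y u) u) \<le> 0"
      have "summable (\<lambda>k. z k * - (cmod (cinner u (e k)))\<^sup>2)"
        by (rule signed_moment_mult_summable[OF z(1) single'[OF u(1,2)]])
      then have "(\<Sum>k. z k * - (cmod (cinner u (e k)))\<^sup>2) = - (\<Sum>k. z k * (cmod (cinner u (e k)))\<^sup>2)"
        using suminf_minus[of "\<lambda>k. z k * (cmod (cinner u (e k)))\<^sup>2"] by (simp add: summable_minus_iff)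
      then show False using z(2)[OF single'[OF u(1,2)]] u(3) by (simp add: y)
    qed
  qed
qed

end

section \<open>Matrix models of finite-dimensional corners\<close>

lemma mat_adjoint_carrier:
  assumes "X \<in> carrier_mat r r"
  shows "mat_adjoint X \<in> carrier_mat r r"
  unfolding mat_adjoint_def using assms by (intro carrier_matI) simp_all

lemma index_mat_adjoint:
  assumes "X \<in> carrier_mat r r" "i < r" "j < r"
  shows "mat_adjoint X $$ (i, j) = cnj (X $$ (j, i))"
proof -
  have d: "dim_row X = r" "dim_col X = r" by (rule carrier_matD[OF assms(1)])+
  have "mat_adjoint X $$ (i, j) = map conjugate (cols X) ! i $ j"
    unfolding mat_adjoint_def by (rule mat_of_rows_index) (simp_all only: length_map cols_length d assms(2,3))
  also have "map conjugate (cols X) ! i = conjugate (col X i)"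
    using assms(2) d by (subst nth_map) (simp_all only: cols_length cols_nth)
  also have "conjugate (col X i) $ j = conjugate (col X i $ j)"
    by (rule vec_index_conjugate) (simp only: dim_col d assms)
  also have "col X i $ j = X $$ (j, i)"
    by (rule index_col) (simp_all only: d assms)
  finally show ?thesis by (simp only: conjugate_complex_def)
qed
lemma index_mult_square:
  assumes "X \<in> carrier_mat r r" "Y \<in> carrier_mat r r" "i < r" "j < r"
  shows "(X * Y) $$ (i, j) = (\<Sum>k<r. X $$ (i, k) * Y $$ (k, j))"
  using assms by (auto simp: scalar_prod_def atLeast0LessThan)

lemma trace_mult:
  assumes "X \<in> carrier_mat r r" "Y \<in> carrier_mat r r"
  shows "trace_mat (X * Y) = (\<Sum>i<r. \<Sum>k<r. X $$ (i, k) * Y $$ (k, i))"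
proof -
  have "trace_mat (X * Y) = (\<Sum>i<r. (X * Y) $$ (i, i))"
    using assms unfolding trace_mat_def by auto
  also have "\<dots> = (\<Sum>i<r. \<Sum>k<r. X $$ (i, k) * Y $$ (k, i))"
    by (intro sum.cong refl index_mult_square[OF assms]) auto
  finally show ?thesis .
qed

lemma trace_mult_add:
  assumes "X \<in> carrier_mat r r" "Y \<in> carrier_mat r r" "Z \<in> carrier_mat r r"
  shows "trace_mat (X * (Y + Z)) = trace_mat (X * Y) + trace_mat (X * (Z :: complex mat))"
proof -
  have "Y + Z \<in> carrier_mat r r" using assms by auto
  then show ?thesis
    using assms by (simp add: trace_mult[OF assms(1)] distrib_left sum.distrib)
qed

lemma trace_mult_smult:
  assumes "X \<in> carrier_mat r r" "Y \<in> carrier_mat r r"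
  shows "trace_mat (X * (c \<cdot>\<^sub>m Y)) = c * trace_mat (X * (Y :: complex mat))"
proof -
  have "c \<cdot>\<^sub>m Y \<in> carrier_mat r r" using assms by auto
  then show ?thesis
    using assms by (simp add: trace_mult[OF assms(1)] sum_distrib_left mult.left_commute)
qed

lemma trace_mult_adjoint:
  assumes R: "R \<in> hermitian_mats r" and X: "X \<in> carrier_mat r r"
  shows "trace_mat (R * mat_adjoint X) = cnj (trace_mat (R * X))"
proof -
  have Rc: "R \<in> carrier_mat r r" and RR: "mat_adjoint R = R"
    using R by (auto simp: hermitian_mats_def)
  have Rh: "R $$ (i, k) = cnj (R $$ (k, i))" if "i < r" "k < r" for i k
    using index_mat_adjoint[OF Rc that] by (simp add: RR)
  have "trace_mat (R * mat_adjoint X) = (\<Sum>i<r. \<Sum>k<r. cnj (R $$ (k, i) * X $$ (i, k)))"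
    unfolding trace_mult[OF Rc mat_adjoint_carrier[OF X]]
  proof (intro sum.cong refl)
    fix i k assume "i \<in> {..<r}" "k \<in> {..<r}"
    then show "R $$ (i, k) * mat_adjoint X $$ (k, i) = cnj (R $$ (k, i) * X $$ (i, k))"
      using Rh[of i k] by (simp add: index_mat_adjoint[OF X])
  qed
  also have "\<dots> = (\<Sum>k<r. \<Sum>i<r. cnj (R $$ (k, i) * X $$ (i, k)))"
    by (rule sum.swap)
  also have "\<dots> = cnj (trace_mat (R * X))"
    by (simp add: trace_mult[OF Rc X])
  finally show ?thesis .
qed

lemma cscalar_mult_mat_vec:
  assumes R: "R \<in> carrier_mat r r" and v: "v \<in> carrier_vec r"
  shows "scalar_prod (R *\<^sub>v v) (conjugate v) = (\<Sum>i<r. \<Sum>k<r. R $$ (i, k) * v $ k * cnj (v $ i))"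
proof -
  have d: "dim_row R = r" "dim_col R = r" "dim_vec v = r"
    by (rule carrier_matD[OF R] carrier_vecD[OF v])+
  have "(R *\<^sub>v v) $ i * conjugate v $ i = (\<Sum>k<r. R $$ (i, k) * v $ k * cnj (v $ i))" if i: "i < r" for i
  proof -
    have "(R *\<^sub>v v) $ i = scalar_prod (row R i) v"
      by (rule index_mult_mat_vec) (simp only: d i)
    also have "\<dots> = (\<Sum>k<r. R $$ (i, k) * v $ k)"
      unfolding scalar_prod_def d atLeast0LessThan
      by (intro sum.cong refl arg_cong2[of _ _ _ _ "(*)"] index_row) (simp_all only: d i lessThan_iff)
    moreover have "conjugate v $ i = cnj (v $ i)"
      unfolding conjugate_complex_def[symmetric] by (rule vec_index_conjugate) (simp only: d i)
    ultimately show ?thesis by (simp only: sum_distrib_right)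
  qed
  then show ?thesis
    unfolding scalar_prod_def dim_vec_conjugate d atLeast0LessThan by (intro sum.cong refl) simp_all
qed

text \<open>Expanding the trace by the columns of \<open>X\<close> gives a sum of values of the
  quadratic form of \<open>R\<close>.\<close>

lemma trace_mult_square_nonneg:
  assumes R: "R \<in> density_mats r" and X: "X \<in> carrier_mat r r"
  shows "0 \<le> Re (trace_mat (R * (X * mat_adjoint X)))"
proof -
  have Rc: "R \<in> carrier_mat r r"
    and pos: "\<And>v. v \<in> carrier_vec r \<Longrightarrow> 0 \<le> Re (scalar_prod (R *\<^sub>v v) (conjugate v))"
    using R by (auto simp: density_mats_def hermitian_mats_def)
  note Xa = mat_adjoint_carrier[OF X]
  have "trace_mat (R * (X * mat_adjoint X))
      = (\<Sum>i<r. \<Sum>k<r. \<Sum>l<r. R $$ (i, k) * X $$ (k, l) * cnj (X $$ (i, l)))"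
    unfolding trace_mult[OF Rc mult_carrier_mat[OF X Xa]]
    by (intro sum.cong refl)
      (simp add: index_mult_square[OF X Xa] index_mat_adjoint[OF X] sum_distrib_left mult.assoc)
  also have "\<dots> = (\<Sum>i<r. \<Sum>l<r. \<Sum>k<r. R $$ (i, k) * X $$ (k, l) * cnj (X $$ (i, l)))"
    by (intro sum.cong refl sum.swap)
  also have "\<dots> = (\<Sum>l<r. \<Sum>i<r. \<Sum>k<r. R $$ (i, k) * X $$ (k, l) * cnj (X $$ (i, l)))"
    by (rule sum.swap)
  also have "\<dots> = (\<Sum>l<r. scalar_prod (R *\<^sub>v col X l) (conjugate (col X l)))"
  proof (intro sum.cong refl)
    fix l assume "l \<in> {..<r}"
    moreover from this have "col X l \<in> carrier_vec r" using X by auto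
    ultimately show "(\<Sum>i<r. \<Sum>k<r. R $$ (i, k) * X $$ (k, l) * cnj (X $$ (i, l)))
        = scalar_prod (R *\<^sub>v col X l) (conjugate (col X l))"
      using X by (simp add: cscalar_mult_mat_vec[OF Rc])
  qed
  finally have "Re (trace_mat (R * (X * mat_adjoint X)))
      = (\<Sum>l<r. Re (scalar_prod (R *\<^sub>v col X l) (conjugate (col X l))))"
    by simp
  also have "0 \<le> \<dots>"
    using X by (intro sum_nonneg pos) auto
  finally show ?thesis .
qed

section \<open>The matrix model given by an enumerated orthonormal basis\<close>

locale frame =
  fixes f :: "nat \<Rightarrow> 'h::complex_hilbert" and r :: nat
  assumes orth: "\<And>a b. a < r \<Longrightarrow> b < r \<Longrightarrow> cinner (f a) (f b) = (if a = b then 1 else 0)"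
begin

definition frame_proj :: "'h \<Rightarrow> 'h" where
  "frame_proj v = (\<Sum>a<r. cinner v (f a) *\<^sub>C f a)"

definition corner_op :: "complex mat \<Rightarrow> ('h \<Rightarrow>\<^sub>L 'h)" where
  "corner_op X = (\<Sum>a<r. \<Sum>b<r. rank_one (X $$ (a, b) *\<^sub>C f a) (f b))"

definition frame_mat :: "('h \<Rightarrow>\<^sub>L 'h) \<Rightarrow> complex mat" where
  "frame_mat T = mat r r (\<lambda>(a, b). cinner (T (f b)) (f a))"

lemma frame_mat_carrier [simp]: "frame_mat T \<in> carrier_mat r r"
  by (simp add: frame_mat_def)

lemma index_frame_mat: "a < r \<Longrightarrow> b < r \<Longrightarrow> frame_mat T $$ (a, b) = cinner (T (f b)) (f a)"
  by (simp add: frame_mat_def)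

lemma cinner_corner_op:
  "cinner (corner_op X v) w = (\<Sum>a<r. \<Sum>b<r. X $$ (a, b) * cinner v (f b) * cinner (f a) w)"
  by (simp add: corner_op_def blinfun.sum_left rank_one_apply cinner_simps mult_ac)

lemma corner_op_bounded_ops: "corner_op X \<in> bounded_ops"
  unfolding bounded_ops_def
proof (intro CollectI allI)
  fix c v
  show "corner_op X (c *\<^sub>C v) = c *\<^sub>C corner_op X v"
    by (rule cinner_eqI) (simp add: cinner_corner_op cinner_scaleC_left sum_distrib_left mult_ac)
qed

lemma cinner_corner_op_frame:
  assumes "a < r"
  shows "cinner (corner_op X v) (f a) = (\<Sum>b<r. X $$ (a, b) * cinner v (f b))"
proof -
  have "cinner (corner_op X v) (f a)
      = (\<Sum>c<r. if c = a then \<Sum>b<r. X $$ (a, b) * cinner v (f b) else 0)"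
    unfolding cinner_corner_op using assms by (intro sum.cong refl) (auto simp: orth)
  then show ?thesis using assms by simp
qed

lemma frame_mat_corner_op:
  assumes X: "X \<in> carrier_mat r r"
  shows "frame_mat (corner_op X) = X"
proof (rule eq_matI)
  fix a b assume "a < dim_row X" "b < dim_col X"
  then have a: "a < r" "b < r" using X by auto
  have "cinner (corner_op X (f b)) (f a) = (\<Sum>c<r. if c = b then X $$ (a, b) else 0)"
    unfolding cinner_corner_op_frame[OF a(1)] using a by (intro sum.cong refl) (auto simp: orth)
  then show "frame_mat (corner_op X) $$ (a, b) = X $$ (a, b)"
    using a by (simp add: index_frame_mat)
qed (use X in \<open>auto simp: frame_mat_def\<close>)

lemma inj_f: "inj_on f {..<r}"
  by (rule inj_onI) (metis lessThan_iff orth zero_neq_one)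

lemma orthonormal_frame: "orthonormal_set (f ` {..<r})"
  unfolding orthonormal_set_def
proof (intro ballI)
  fix u v assume "u \<in> f ` {..<r}" "v \<in> f ` {..<r}"
  then obtain a b where "a < r" "b < r" "u = f a" "v = f b" by auto
  then show "cinner u v = (if u = v then 1 else 0)"
    using inj_f orth by (auto simp: inj_on_eq_iff)
qed

abbreviation "S \<equiv> complex_vector.span (f ` {..<r})"

lemma proj_sum_frame: "proj_sum (f ` {..<r}) v = frame_proj v"
  unfolding proj_sum_def frame_proj_def by (simp add: sum.reindex[OF inj_f])

lemma frame_orth_proj: "is_orth_proj (orth_proj S) S" "orth_proj S v = frame_proj v"
  using is_orth_proj_span[OF _ orthonormal_frame] is_orth_projD(4)[OF is_orth_proj_span[OF _ orthonormal_frame]]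
    orth_proj_span[OF _ orthonormal_frame] proj_sum_frame by simp_all

lemma cinner_T_frame_proj:
  assumes "T \<in> bounded_ops"
  shows "cinner (T (frame_proj v)) (frame_proj w)
    = (\<Sum>a<r. \<Sum>b<r. cinner (T (f b)) (f a) * cinner v (f b) * cinner (f a) w)"
proof -
  have "T (frame_proj v) = (\<Sum>b<r. cinner v (f b) *\<^sub>C T (f b))"
    by (simp add: frame_proj_def blinfun.sum_right bounded_opsD[OF assms])
  then have "cinner (T (frame_proj v)) (frame_proj w)
      = (\<Sum>a<r. cnj (cinner w (f a)) * (\<Sum>b<r. cinner v (f b) * cinner (T (f b)) (f a)))"
    unfolding frame_proj_def[of w] cinner_sum_right cinner_scaleC_right
    by (simp add: cinner_sum_left cinner_scaleC_left)
  then show ?thesis by (simp add: sum_distrib_left mult_ac)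
qed

lemma frame_proj_sym: "cinner (frame_proj v) w = cinner v (frame_proj w)"
  unfolding proj_sum_frame[symmetric] by (rule proj_sum_sym)

lemma compression_frame:
  assumes T: "T \<in> bounded_ops"
  shows "compression S T = corner_op (frame_mat T)"
proof (rule blinfun_eqI, rule cinner_eqI)
  fix v w
  have "cinner (compression S T v) w = cinner (T (frame_proj v)) (frame_proj w)"
    by (simp add: compression_def frame_proj_sym frame_orth_proj(2))
  also have "\<dots> = cinner (corner_op (frame_mat T) v) w"
    unfolding cinner_T_frame_proj[OF T] cinner_corner_op
    by (intro sum.cong refl) (simp add: index_frame_mat)
  finally show "cinner (compression S T v) w = cinner (corner_op (frame_mat T) v) w" .
qed

text \<open>\<open>frame_mat\<close> inverts \<open>corner_op\<close> on matrices, and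
  \<open>compression_frame\<close> identifies the image with the corner. The algebraic identities
  are verified on inner products.\<close>

lemma cstar_iso_corner_op: "cstar_iso_corner r S corner_op"
  unfolding cstar_iso_corner_def
proof (intro conjI ballI allI)
  have "inj_on corner_op (carrier_mat r r)"
    by (rule inj_on_inverseI[of _ frame_mat]) (rule frame_mat_corner_op)
  moreover have "corner_op ` carrier_mat r r = compression S ` bounded_ops"
  proof
    show "corner_op ` carrier_mat r r \<subseteq> compression S ` bounded_ops"
    proof
      fix T assume "T \<in> corner_op ` carrier_mat r r"
      then obtain X where X: "X \<in> carrier_mat r r" "T = corner_op X" by blast
      then have "T = compression S (corner_op X)"
        by (simp add: compression_frame[OF corner_op_bounded_ops] frame_mat_corner_op)
      then show "T \<in> compression S ` bounded_ops" using corner_op_bounded_ops by blast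
    qed
    show "compression S ` bounded_ops \<subseteq> corner_op ` carrier_mat r r"
      using compression_frame by auto
  qed
  ultimately show "bij_betw corner_op (carrier_mat r r) (compression S ` bounded_ops)"
    by (simp add: bij_betw_def)
next
  fix X Y :: "complex mat" assume XY: "X \<in> carrier_mat r r" "Y \<in> carrier_mat r r"
  show "corner_op (X + Y) = corner_op X + corner_op Y"
    by (rule blinfun_eqI, rule cinner_eqI)
      (use XY in \<open>simp add: blinfun.add_left cinner_add_left cinner_corner_op distrib_right sum.distrib\<close>)
  show "corner_op (X * Y) = corner_op X o\<^sub>L corner_op Y"
  proof (rule blinfun_eqI, rule cinner_eqI)
    fix v w
    have "cinner (corner_op (X * Y) v) w
        = (\<Sum>a<r. \<Sum>b<r. \<Sum>k<r. X $$ (a, k) * Y $$ (k, b) * cinner v (f b) * cinner (f a) w)"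
      unfolding cinner_corner_op
      by (intro sum.cong refl) (simp add: index_mult_square[OF XY] sum_distrib_right)
    also have "\<dots> = (\<Sum>a<r. \<Sum>k<r. \<Sum>b<r. X $$ (a, k) * Y $$ (k, b) * cinner v (f b) * cinner (f a) w)"
      by (intro sum.cong refl sum.swap)
    also have "\<dots> = cinner (corner_op X (corner_op Y v)) w"
      unfolding cinner_corner_op[of X]
      by (intro sum.cong refl)
        (simp add: cinner_corner_op_frame sum_distrib_left sum_distrib_right mult.assoc)
    finally show "cinner (corner_op (X * Y) v) w = cinner ((corner_op X o\<^sub>L corner_op Y) v) w"
      by simp
  qed
next
  fix c :: complex and X :: "complex mat" and v assume X: "X \<in> carrier_mat r r"
  show "corner_op (c \<cdot>\<^sub>m X) v = c *\<^sub>C corner_op X v"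
    by (rule cinner_eqI)
      (use X in \<open>simp add: cinner_scaleC_left cinner_corner_op sum_distrib_left mult.assoc\<close>)
next
  fix X :: "complex mat" and u v assume X: "X \<in> carrier_mat r r"
  have "cinner u (corner_op (mat_adjoint X) v) = cnj (cinner (corner_op (mat_adjoint X) v) u)" by simp
  also have "\<dots> = (\<Sum>a<r. \<Sum>b<r. X $$ (b, a) * cinner u (f a) * cinner (f b) v)"
    unfolding cinner_corner_op cnj_sum
    by (intro sum.cong refl) (simp add: index_mat_adjoint[OF X] mult_ac)
  also have "\<dots> = cinner (corner_op X u) v"
    unfolding cinner_corner_op by (rule sum.swap)
  finally show "cinner (corner_op X u) v = cinner u (corner_op (mat_adjoint X) v)" by simp
qed

lemma inv_corner_op:
  assumes "T \<in> bounded_ops"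
  shows "inv_into (carrier_mat r r) corner_op (compression S T) = frame_mat T"
proof (rule inv_into_f_eq)
  show "inj_on corner_op (carrier_mat r r)"
    by (rule inj_on_inverseI[of _ frame_mat]) (rule frame_mat_corner_op)
qed (simp_all add: compression_frame[OF assms])

lemma frame_mat_hermitian:
  assumes "selfadjoint T"
  shows "frame_mat T \<in> hermitian_mats r"
proof -
  have "mat_adjoint (frame_mat T) = frame_mat T"
  proof (rule eq_matI)
    fix a b assume "a < dim_row (frame_mat T)" "b < dim_col (frame_mat T)"
    then have "a < r" "b < r" by (simp_all add: frame_mat_def)
    then show "mat_adjoint (frame_mat T) $$ (a, b) = frame_mat T $$ (a, b)"
      by (simp add: index_mat_adjoint[OF frame_mat_carrier] index_frame_mat selfadjointD(2)[OF assms])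
  qed (simp_all add: mat_adjoint_def frame_mat_def)
  then show ?thesis by (simp add: hermitian_mats_def)
qed

text \<open>The matrix form at a coordinate vector is the form of \<open>list_op ws\<close> at the
  corresponding combination of the frame. The trace is the full mass because the vectors lie in
  \<open>S\<close>.\<close>

lemma frame_mat_list_op_density:
  assumes ws: "set ws \<subseteq> S" "mass ws = 1"
  shows "frame_mat (list_op ws) \<in> density_mats r"
  unfolding density_mats_def
proof (intro CollectI conjI ballI)
  let ?T = "list_op ws"
  have b: "?T \<in> bounded_ops" by (rule selfadjointD(1)[OF selfadjoint_list_op])
  show "frame_mat ?T \<in> hermitian_mats r" by (rule frame_mat_hermitian[OF selfadjoint_list_op])
  fix v :: "complex vec" assume v: "v \<in> carrier_vec r"
  define u where "u = (\<Sum>a<r. v $ a *\<^sub>C f a)"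
  have "?T u = (\<Sum>b<r. v $ b *\<^sub>C ?T (f b))"
    by (simp add: u_def blinfun.sum_right bounded_opsD[OF b])
  then have "cinner (?T u) u = (\<Sum>a<r. cnj (v $ a) * (\<Sum>b<r. v $ b * cinner (?T (f b)) (f a)))"
    by (simp add: u_def[of] cinner_sum_right cinner_scaleC_right)
      (simp add: cinner_sum_left cinner_scaleC_left)
  also have "\<dots> = scalar_prod (frame_mat ?T *\<^sub>v v) (conjugate v)"
    unfolding cscalar_mult_mat_vec[OF frame_mat_carrier v] sum_distrib_left
    by (intro sum.cong refl) (simp add: index_frame_mat mult_ac)
  finally show "0 \<le> Re (scalar_prod (frame_mat ?T *\<^sub>v v) (conjugate v))"
    using positive_op_list_op[of ws] unfolding positive_op_def by metis
next
  let ?T = "list_op ws"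
  have "trace_mat (frame_mat ?T) = (\<Sum>a<r. cinner (?T (f a)) (f a))"
    by (simp add: trace_mat_def frame_mat_def)
  also have "\<dots> = of_real (\<Sum>a<r. \<Sum>w\<leftarrow>ws. (cmod (cinner w (f a)))\<^sup>2)"
    by (simp only: list_op_form of_real_sum)
  also have "(\<Sum>a<r. \<Sum>w\<leftarrow>ws. (cmod (cinner w (f a)))\<^sup>2) = (\<Sum>w\<leftarrow>ws. \<Sum>a<r. (cmod (cinner w (f a)))\<^sup>2)"
    by (rule sum_sum_list)
  also have "\<dots> = mass ws"
    unfolding mass_def
  proof (intro arg_cong[of _ _ sum_list] map_cong[OF refl])
    fix w assume "w \<in> set ws"
    then show "(\<Sum>a<r. (cmod (cinner w (f a)))\<^sup>2) = (norm w)\<^sup>2"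
      using norm_span[OF _ orthonormal_frame, of w] ws(1) by (auto simp: sum.reindex[OF inj_f])
  qed
  finally show "trace_mat (frame_mat ?T) = 1" by (simp add: ws(2))
qed

lemma trace_frame_mat_list_op:
  assumes ws: "set ws \<subseteq> S"
  shows "trace_mat (frame_mat (list_op ws) * frame_mat (outer g)) = of_real (\<Sum>w\<leftarrow>ws. (cmod (cinner w g))\<^sup>2)"
proof -
  let ?T = "list_op ws"
  have b: "?T \<in> bounded_ops" by (rule selfadjointD(1)[OF selfadjoint_list_op])
  have "trace_mat (frame_mat ?T * frame_mat (outer g))
      = (\<Sum>a<r. \<Sum>b<r. cinner (?T (f b)) (f a) * cinner g (f b) * cinner (f a) g)"
    unfolding trace_mult[OF frame_mat_carrier frame_mat_carrier]
    by (intro sum.cong refl) (simp add: index_frame_mat outer_apply cinner_scaleC_left)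
  also have "\<dots> = cinner (?T (frame_proj g)) (frame_proj g)"
    by (rule cinner_T_frame_proj[OF b, symmetric])
  also have "\<dots> = of_real (\<Sum>w\<leftarrow>ws. (cmod (cinner w (frame_proj g)))\<^sup>2)"
    by (rule list_op_form)
  also have "(\<Sum>w\<leftarrow>ws. (cmod (cinner w (frame_proj g)))\<^sup>2) = (\<Sum>w\<leftarrow>ws. (cmod (cinner w g))\<^sup>2)"
  proof (intro arg_cong[of _ _ sum_list] map_cong[OF refl])
    fix w assume "w \<in> set ws"
    then have "w \<in> S" using ws by blast
    then have "cinner w (frame_proj g) = cinner w g"
      using is_orth_projD(2,3)[OF frame_orth_proj(1)] frame_orth_proj(2) by metis
    then show "(cmod (cinner w (frame_proj g)))\<^sup>2 = (cmod (cinner w g))\<^sup>2" by simp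
  qed
  finally show ?thesis .
qed

end

section \<open>Frames of a span, and states on an arbitrary matrix model of a corner\<close>

lemma frame_exists:
  assumes F: "finite F" "orthonormal_set (F :: 'h::complex_hilbert set)"
  shows "\<exists>f. frame f (card F) \<and> f ` {..<card F} = F"
proof -
  obtain f where f: "bij_betw f {0..<card F} F" using ex_bij_betw_nat_finite[OF F(1)] by blast
  then have im: "f ` {..<card F} = F" and inj: "inj_on f {..<card F}"
    by (auto simp: bij_betw_def atLeast0LessThan)
  have "frame f (card F)"
  proof
    fix a b assume ab: "a < card F" "b < card F"
    then have "f a \<in> F" "f b \<in> F" using im by auto
    then show "cinner (f a) (f b) = (if a = b then 1 else 0)"
      using ab inj_on_eq_iff[OF inj, of a b] by (simp add: orthonormal_setD[OF F(2)])
  qed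
  then show ?thesis using im by blast
qed

text \<open>A state on the corner is positive, so \<open>(u, v) \<mapsto> \<phi>(P u (P v)\<^sup>*)\<close> is a positive form and
  decomposes into vectors of \<open>S\<close>. In particular the isomorphism need not be known to be spatial.\<close>

lemma corner_state_vector_system:
  fixes F :: "'h::complex_hilbert set" and U :: "complex mat \<Rightarrow> ('h \<Rightarrow>\<^sub>L 'h)"
  assumes F: "finite F" "orthonormal_set F" and U: "cstar_iso_corner r (complex_vector.span F) U"
    and R: "R \<in> density_mats r"
  shows "\<exists>ws. set ws \<subseteq> complex_vector.span F \<and> mass ws = 1 \<and>
    (\<forall>j. trace_mat (R * inv_into (carrier_mat r r) U (compression (complex_vector.span F) (outer (e j))))
      = of_real (vec_density e ws j))"
proof -
  let ?S = "complex_vector.span F"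
  let ?C = "compression ?S ` bounded_ops"
  define P where "P = orth_proj ?S"
  have P: "is_orth_proj P ?S" and P_apply: "P v = proj_sum F v" for v
    using is_orth_proj_span[OF F] is_orth_projD(4)[OF is_orth_proj_span[OF F]] orth_proj_span[OF F]
    by (simp_all add: P_def)
  have P_idem: "P (P v) = P v" for v using is_orth_projD(1,2)[OF P] by blast
  have bij: "bij_betw U (carrier_mat r r) ?C"
    and U_add: "\<And>X Y. X \<in> carrier_mat r r \<Longrightarrow> Y \<in> carrier_mat r r \<Longrightarrow> U (X + Y) = U X + U Y"
    and U_smult: "\<And>c X v. X \<in> carrier_mat r r \<Longrightarrow> blinfun_apply (U (c \<cdot>\<^sub>m X)) v = c *\<^sub>C blinfun_apply (U X) v"
    and U_mult: "\<And>X Y. X \<in> carrier_mat r r \<Longrightarrow> Y \<in> carrier_mat r r \<Longrightarrow> U (X * Y) = U X o\<^sub>L U Y"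
    and U_adj: "\<And>X u v. X \<in> carrier_mat r r \<Longrightarrow>
        cinner (blinfun_apply (U X) u) v = cinner u (blinfun_apply (U (mat_adjoint X)) v)"
    using U unfolding cstar_iso_corner_def by auto
  define V where "V = inv_into (carrier_mat r r) U"
  have inj: "inj_on U (carrier_mat r r)" and im: "U ` carrier_mat r r = ?C"
    using bij by (auto simp: bij_betw_def)
  have V: "V T \<in> carrier_mat r r" "U (V T) = T" if "T \<in> ?C" for T
    using that unfolding V_def im[symmetric] by (auto intro: inv_into_into f_inv_into_f)
  have V_U: "V T = X" if "X \<in> carrier_mat r r" "U X = T" for X T
    unfolding V_def using that inj by (auto intro: inv_into_f_eq)
  have Rh: "R \<in> hermitian_mats r" and Rc: "R \<in> carrier_mat r r" and R1: "trace_mat R = 1"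
    using R by (auto simp: density_mats_def hermitian_mats_def)
  have compression_C: "T \<in> ?C" if "T \<in> bounded_ops" "compression ?S T = T" for T
    using that by (metis imageI)
  \<comment> \<open>Rank-one elements of the corner, linear in \<open>u\<close> and conjugate-linear
    in \<open>v\<close>, which turn a linear functional on the corner into a sesquilinear
    form.\<close>
  define K where "K u v = rank_one (P u) (P v)" for u v
  have K_C: "K u v \<in> ?C" for u v
  proof (rule compression_C)
    show "K u v \<in> bounded_ops" unfolding K_def by (rule rank_one_bounded_ops)
    show "compression ?S (K u v) = K u v"
      unfolding compression_def P_def[symmetric] K_def
      by (rule blinfun_eqI)
        (simp add: rank_one_apply bounded_opsD[OF is_orth_projD(5)[OF P]] is_orth_projD(3)[OF P] P_idem)
  qed
  define q where "q u v = trace_mat (R * V (K u v))" for u v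
  have q_add: "q (u + v) w = q u w + q v w" for u v w
  proof -
    have "K (u + v) w = K u w + K v w"
      by (rule blinfun_eqI) (simp add: K_def rank_one_apply blinfun.add_left blinfun.add_right scaleC_add_right)
    then have "V (K (u + v) w) = V (K u w) + V (K v w)"
      by (intro V_U) (simp_all add: V[OF K_C] U_add)
    then show ?thesis by (simp add: q_def trace_mult_add[OF Rc] V[OF K_C])
  qed
  have K_smult: "V (K (c *\<^sub>C u) v) = c \<cdot>\<^sub>m V (K u v)" for c u v
  proof (rule V_U)
    show "U (c \<cdot>\<^sub>m V (K u v)) = K (c *\<^sub>C u) v"
      by (rule blinfun_eqI, unfold U_smult[OF V(1)[OF K_C]] V(2)[OF K_C])
        (simp add: K_def rank_one_apply bounded_opsD[OF is_orth_projD(5)[OF P]] scaleC_scaleC mult.commute)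
  qed (simp add: V[OF K_C])
  have q_smult: "q (c *\<^sub>C u) v = c * q u v" for c u v
    by (simp add: q_def K_smult trace_mult_smult[OF Rc] V[OF K_C])
  have K_adj: "V (K v u) = mat_adjoint (V (K u v))" for u v
  proof (rule V_U)
    show "mat_adjoint (V (K u v)) \<in> carrier_mat r r" by (rule mat_adjoint_carrier[OF V(1)[OF K_C]])
    have "cinner (U (mat_adjoint (V (K u v))) y) z = cinner (K v u y) z" for y z
    proof -
      have "cinner z (U (mat_adjoint (V (K u v))) y) = cinner (K u v z) y"
        using U_adj[OF V(1)[OF K_C], of u v z y] by (simp add: V[OF K_C])
      also have "\<dots> = cinner z (K v u y)"
        by (simp add: K_def rank_one_apply cinner_simps mult.commute)
      finally show ?thesis by (metis cnj_cinner)
    qed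
    then show "U (mat_adjoint (V (K u v))) = K v u" by (intro blinfun_eqI cinner_eqI)
  qed
  have q_herm: "q u v = cnj (q v u)" for u v
    unfolding q_def K_adj[of u v] by (rule trace_mult_adjoint[OF Rh V(1)[OF K_C]])
  \<comment> \<open>\<open>K u u\<close> is self-adjoint and its square is the multiple of it by the
    squared norm of \<open>P u\<close>. So a positive multiple of \<open>q u u\<close> is the trace
    of \<open>R\<close> against a matrix times its adjoint, unless \<open>P u = 0\<close>.\<close>
  have q_pos: "0 \<le> Re (q u u)" for u
  proof (cases "P u = 0")
    case True
    then have "K u u = K (0 *\<^sub>C u) u"
      by (simp add: K_def blinfun.zero_right)
    then have "q u u = q (0 *\<^sub>C u) u" by (simp only: q_def)
    then show ?thesis by (simp only: q_smult) simp
  next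
    case False
    let ?X = "V (K u u)" and ?n = "(norm (P u))\<^sup>2"
    have "K u u o\<^sub>L K u u = K (of_real ?n *\<^sub>C u) u"
      by (rule blinfun_eqI)
        (simp add: K_def rank_one_apply bounded_opsD[OF is_orth_projD(5)[OF P]] cinner_scaleC_left
          cinner_self scaleC_scaleC)
    then have "V (K (of_real ?n *\<^sub>C u) u) = ?X * ?X"
      by (intro V_U) (simp_all add: U_mult V[OF K_C] mult_carrier_mat[OF V(1)[OF K_C] V(1)[OF K_C]])
    then have "of_real ?n * q u u = trace_mat (R * (?X * mat_adjoint ?X))"
      unfolding q_smult[symmetric] by (simp add: q_def K_adj[of u u, symmetric])
    then have "0 \<le> Re (of_real ?n * q u u)"
      using trace_mult_square_nonneg[OF R V(1)[OF K_C]] by simp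
    then show ?thesis using False by (simp add: zero_le_mult_iff flip: of_real_power)
  qed
  have psd: "psd_form q"
    unfolding psd_form_def using q_add q_smult q_herm q_pos by (intro conjI allI)
  obtain ws where ws: "set ws \<subseteq> ?S" "mass ws = (\<Sum>g\<in>F. Re (q g g))"
    "\<And>k. vec_density e ws k = Re (q (proj_sum F (e k)) (proj_sum F (e k)))"
    using psd_form_vector_system[OF F psd, of e] by (elim exE conjE) auto
  \<comment> \<open>Finite sums are built on the matrix side, where the additivity of
    \<open>U\<close> applies directly.\<close>
  have partial: "\<exists>X\<in>carrier_mat r r. U X = (\<Sum>g\<in>G. K g g) \<and> trace_mat (R * X) = (\<Sum>g\<in>G. q g g)"
    if "finite G" for G
    using that
  proof (induction G rule: finite_induct)
    case empty
    have z: "0\<^sub>m r r \<in> carrier_mat r r" by simp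
    have "U (0\<^sub>m r r) = 0" using U_add[OF z z] by simp
    moreover have "trace_mat (R * 0\<^sub>m r r) = 0" using trace_mult_add[OF Rc z z] by simp
    ultimately show ?case using z by auto
  next
    case (insert g G)
    then obtain X where X: "X \<in> carrier_mat r r" "U X = (\<Sum>g\<in>G. K g g)"
      "trace_mat (R * X) = (\<Sum>g\<in>G. q g g)" by blast
    show ?case
      using X insert.hyps V[OF K_C, of g g]
      by (intro bexI[of _ "V (K g g) + X"])
        (simp_all add: U_add trace_mult_add[OF Rc] q_def)
  qed
  obtain X where X: "X \<in> carrier_mat r r" "U X = (\<Sum>g\<in>F. K g g)" "trace_mat (R * X) = (\<Sum>g\<in>F. q g g)"
    using partial[OF F(1)] by blast
  have UX: "U X = P"
  proof (rule blinfun_eqI)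
    fix v
    have Pg: "P g = g" if "g \<in> F" for g
      by (rule is_orth_projD(2)[OF P complex_vector.span_base[OF that]])
    have "U X v = (\<Sum>g\<in>F. cinner v (P g) *\<^sub>C P g)"
      unfolding X(2) by (simp add: blinfun.sum_left K_def rank_one_apply)
    also have "\<dots> = (\<Sum>g\<in>F. cinner v g *\<^sub>C g)"
      by (intro sum.cong refl) (simp only: Pg)
    finally show "U X v = P v" by (simp only: P_apply proj_sum_def)
  qed
  \<comment> \<open>Unitality is not among the requirements on \<open>U\<close> but follows:
    \<open>U (1\<^sub>m r)\<close> lies in the corner, is therefore unchanged by composition with
    \<open>P = U X\<close>, and multiplicativity with injectivity gives
    \<open>X = 1\<^sub>m r\<close>. Hence the trace of \<open>R\<close> is the mass.\<close>
  have one: "1\<^sub>m r \<in> carrier_mat r r" by simp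
  have "U (1\<^sub>m r) \<in> ?C" using im one by blast
  then obtain T where T: "U (1\<^sub>m r) = compression ?S T" by blast
  have "U (1\<^sub>m r) = U (1\<^sub>m r) o\<^sub>L P"
    unfolding T compression_def P_def[symmetric] by (rule blinfun_eqI) (simp add: P_idem)
  also have "\<dots> = U (1\<^sub>m r * X)" unfolding U_mult[OF one X(1)] UX ..
  also have "1\<^sub>m r * X = X" using X(1) by simp
  finally have "X = 1\<^sub>m r" using inj X(1) one by (metis inj_on_eq_iff)
  then have "(\<Sum>g\<in>F. q g g) = 1" using X(3) R1 Rc by simp
  then have "mass ws = 1" unfolding ws(2) by (metis Re_sum one_complex.sel(1))
  moreover have "trace_mat (R * inv_into (carrier_mat r r) U (compression ?S (outer (e j))))
      = of_real (vec_density e ws j)" for j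
  proof -
    have "compression ?S (outer (e j)) = K (proj_sum F (e j)) (proj_sum F (e j))"
      using compression_outer[OF P, of "e j"] by (simp add: outer_eq K_def P_idem flip: P_apply)
    then show ?thesis
      unfolding ws(3) psd_formD(9)[OF psd, symmetric] by (simp add: q_def V_def)
  qed
  ultimately show ?thesis using ws(1) by (intro exI[of _ ws] conjI allI)
qed

section \<open>Truncated agreement of densities, and joint numerical ranges\<close>

context minimality
begin

text \<open>For given \<open>y\<close> and \<open>d\<close> the entries of \<open>y - x\<close> are
  below \<open>d\<close> beyond some index, so systems agreeing up to that index cancel the
  perturbation up to an error proportional to \<open>d\<close>. The index depends on
  \<open>y\<close> and \<open>d\<close>, hence agreement is required for every large
  \<open>n\<close>; the systems may vary with \<open>n\<close>.\<close>

lemma partial_moments_imp_norm_minimal: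
  assumes "\<And>n. n \<ge> m \<Longrightarrow> \<exists>ws us. set ws \<subseteq> Smax \<and> set us \<subseteq> Smin \<and> mass ws = 1 \<and> mass us = 1 \<and>
    (\<forall>k<n. vec_density e ws k = vec_density e us k)"
  shows norm_minimal
  unfolding norm_minimal_iff
proof
  fix y
  let ?z = "y - x"
  have "norm (A x) \<le> norm (A y) + d" if "d > 0" for d
  proof -
    obtain N where N: "\<And>k. k \<ge> N \<Longrightarrow> \<bar>c0_nth ?z k\<bar> < d"
      using LIMSEQ_D[OF c0_nth_tendsto[of ?z] \<open>d > 0\<close>] by auto
    obtain ws us where ws: "set ws \<subseteq> Smax" "mass ws = 1" and us: "set us \<subseteq> Smin" "mass us = 1"
      and eq: "\<And>k. k < max m N \<Longrightarrow> vec_density e ws k = vec_density e us k"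
      using assms[of "max m N"] by auto
    \<comment> \<open>Where the densities agree the right-hand side is 0; elsewhere the entry of
      \<open>y - x\<close> is below \<open>d\<close>. Summed over \<open>k\<close>, the loss is
      \<open>d\<close> times the total mass 2, and it is shared by the two norm bounds.\<close>
    have "- d * (vec_density e ws k + vec_density e us k)
        \<le> c0_nth ?z k * vec_density e ws k - c0_nth ?z k * vec_density e us k" for k
    proof (cases "k < max m N")
      case True
      then show ?thesis using eq[OF True] \<open>d > 0\<close> vec_density_nonneg[of e us k] by simp
    next
      case False
      then have z: "\<bar>c0_nth ?z k\<bar> < d" by (intro N) simp
      have "- d * vec_density e ws k \<le> c0_nth ?z k * vec_density e ws k"
        "c0_nth ?z k * vec_density e us k \<le> d * vec_density e us k"
        using z by (intro mult_right_mono vec_density_nonneg; simp)+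
      then show ?thesis by (simp add: algebra_simps)
    qed
    then have "- d * (mass ws + mass us) \<le> quad (Diag e ?z) ws - quad (Diag e ?z) us"
      using sums_mult[OF sums_add[OF vec_density_sums[of ws] vec_density_sums[of us]], of "- d"]
        sums_diff[OF quad_Diag_sums[of ?z ws] quad_Diag_sums[of ?z us]]
      by (rule sums_le)
    then show ?thesis
      using abs_quad_le[of "A y" ws] abs_quad_le[of "A y" us]
        quad_eig(1)[OF ws(1), of "Diag e ?z"] quad_eig(2)[OF us(1), of "Diag e ?z"] ws(2) us(2)
      by (simp add: abs_le_iff A_diff[of y, symmetric])
  qed
  then show "norm (A x) \<le> norm (A y)" by (rule field_le_epsilon)
qed

lemma moment_nonzero:
  assumes "complex_vector.subspace S" "a \<in> moment e S"
  shows "\<exists>k. a k \<noteq> 0"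
proof (rule ccontr)
  assume "\<not> ?thesis"
  then have z: "a = (\<lambda>_. 0)" by auto
  obtain ws where "mass ws = 1" "a = vec_density e ws" using assms(2) unfolding moment_iff[OF assms(1)] by blast
  then have "(\<lambda>_::nat. 0::real) sums 1" using vec_density_sums[of ws] z by simp
  then show False using sums_unique2[OF sums_zero] by fastforce
qed

lemma moments_iff_joint_numerical_ranges:
  assumes nz: "A x \<noteq> 0"
  shows "moment e Smax \<inter> moment e Smin \<noteq> {} \<longleftrightarrow>
    joint_numerical_range e (\<lambda>i. compression Smax (outer (e i))) \<inter>
    joint_numerical_range e (\<lambda>i. compression Smin (outer (e i))) \<noteq> {\<lambda>_. 0}"
proof -
  obtain F G where F: "finite F" "orthonormal_set F" "complex_vector.span F = Smax"
    and G: "finite G" "orthonormal_set G" "complex_vector.span G = Smin"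
    using eig_basis(1,2)[OF nz] by blast
  let ?W = "joint_numerical_range e (\<lambda>i. compression Smax (outer (e i)))"
  let ?V = "joint_numerical_range e (\<lambda>i. compression Smin (outer (e i)))"
  have P: "is_orth_proj (Blinfun (proj_sum F)) Smax" "is_orth_proj (Blinfun (proj_sum G)) Smin"
    using is_orth_proj_span[OF F(1,2)] is_orth_proj_span[OF G(1,2)] by (simp_all add: F G)
  show ?thesis
  proof
    assume "moment e Smax \<inter> moment e Smin \<noteq> {}"
    then obtain a where a: "a \<in> moment e Smax" "a \<in> moment e Smin" by blast
    have "(\<lambda>j. of_real (a j)) \<in> ?W \<inter> ?V"
      using moment_joint_numerical_range[OF P(1) a(1)] moment_joint_numerical_range[OF P(2) a(2)] by blast
    moreover have "(\<lambda>j. complex_of_real (a j)) \<noteq> (\<lambda>_. 0)"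
      using moment_nonzero[OF subspace_eig(1) a(1)] by (metis of_real_eq_0_iff)
    ultimately show "?W \<inter> ?V \<noteq> {\<lambda>_. 0}" by blast
  next
    assume ne: "?W \<inter> ?V \<noteq> {\<lambda>_. 0}"
    have "(\<lambda>_. 0) \<in> ?W" "(\<lambda>_. 0) \<in> ?V"
      using zero_mem_joint_numerical_range[OF F(1,2)] zero_mem_joint_numerical_range[OF G(1,2)]
      by (simp_all add: F G)
    then obtain c where c: "c \<in> ?W" "c \<in> ?V" "c \<noteq> (\<lambda>_. 0)" using ne by blast
    obtain ws where ws: "set ws \<subseteq> Smax" "c = (\<lambda>j. of_real (vec_density e ws j))"
      using joint_numerical_range_density[OF F(1,2)] c(1) unfolding F(3) by blast
    obtain us where us: "set us \<subseteq> Smin" "c = (\<lambda>j. of_real (vec_density e us j))"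
      using joint_numerical_range_density[OF G(1,2)] c(2) unfolding G(3) by blast
    \<comment> \<open>A density of mass 0 would vanish, but \<open>c\<close> is nonzero; positive
      mass permits rescaling to a moment point.\<close>
    have "mass ws \<noteq> 0"
    proof
      assume "mass ws = 0"
      then have "vec_density e ws k = 0" for k
        using vec_density_le_mass[of ws k] vec_density_nonneg[of e ws k] by simp
      then show False using c(3) ws(2) by simp
    qed
    moreover have "vec_density e ws = vec_density e us"
      using ws(2) us(2) by (metis ext of_real_eq_iff)
    ultimately show "moment e Smax \<inter> moment e Smin \<noteq> {}"
      by (intro moments_intersect[OF subspace_eig ws(1) us(1)])
  qed
qed

end

section \<open>The matrix condition and the zero operator\<close>

context minimality
begin

lemma moments_imp_matrix_ranges:
  assumes nz: "A x \<noteq> 0" and mom: "moment e Smax \<inter> moment e Smin \<noteq> {}"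
  shows "\<exists>m U V B C. cstar_iso_corner (complex_vector.dim Smax) Smax U \<and>
    cstar_iso_corner (complex_vector.dim Smin) Smin V \<and>
    (\<forall>j. B j \<in> hermitian_mats (complex_vector.dim Smax) \<and>
      B j = inv_into (carrier_mat (complex_vector.dim Smax) (complex_vector.dim Smax)) U
        (compression Smax (outer (e j)))) \<and>
    (\<forall>j. C j \<in> hermitian_mats (complex_vector.dim Smin) \<and>
      C j = inv_into (carrier_mat (complex_vector.dim Smin) (complex_vector.dim Smin)) V
        (compression Smin (outer (e j)))) \<and>
    (\<forall>n\<ge>m. \<not> joint_numerical_range_mat (complex_vector.dim Smax) n B \<inter>
      joint_numerical_range_mat (complex_vector.dim Smin) n C \<subseteq> {0\<^sub>v n})"
proof -
  obtain F G where F: "finite F" "orthonormal_set F" "complex_vector.span F = Smax"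
    and G: "finite G" "orthonormal_set G" "complex_vector.span G = Smin"
    using eig_basis(1,2)[OF nz] by blast
  obtain f where f: "frame f (card F)" "f ` {..<card F} = F" using frame_exists[OF F(1,2)] by blast
  obtain g where g: "frame g (card G)" "g ` {..<card G} = G" using frame_exists[OF G(1,2)] by blast
  interpret mx: frame f "card F" by (rule f(1))
  interpret mn: frame g "card G" by (rule g(1))
  have dim: "complex_vector.dim Smax = card F" "complex_vector.dim Smin = card G"
    using dim_span_orthonormal[OF F(1,2)] dim_span_orthonormal[OF G(1,2)] by (simp_all add: F G)
  have span: "complex_vector.span (f ` {..<card F}) = Smax" "complex_vector.span (g ` {..<card G}) = Smin"
    by (simp_all add: f g F G)
  obtain a where a: "a \<in> moment e Smax" "a \<in> moment e Smin" using mom by blast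
  obtain ws where ws: "set ws \<subseteq> Smax" "mass ws = 1" "a = vec_density e ws"
    using a(1) unfolding moment_iff[OF subspace_eig(1)] by blast
  obtain us where us: "set us \<subseteq> Smin" "mass us = 1" "a = vec_density e us"
    using a(2) unfolding moment_iff[OF subspace_eig(2)] by blast
  \<comment> \<open>Truncations keep the indices below \<open>n\<close>, so from
    \<open>Suc k\<close> on the common vector retains this nonzero entry.\<close>
  obtain k where k: "a k \<noteq> 0" using moment_nonzero[OF subspace_eig(1) a(1)] by blast
  define B where "B j = mx.frame_mat (outer (e j))" for j
  define C where "C j = mn.frame_mat (outer (e j))" for j
  have B: "B j \<in> hermitian_mats (card F)"
      "B j = inv_into (carrier_mat (card F) (card F)) mx.corner_op (compression Smax (outer (e j)))"
    and C: "C j \<in> hermitian_mats (card G)"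
      "C j = inv_into (carrier_mat (card G) (card G)) mn.corner_op (compression Smin (outer (e j)))" for j
    using mx.inv_corner_op[OF selfadjointD(1)[OF selfadjoint_outer[of "e j"]]]
      mn.inv_corner_op[OF selfadjointD(1)[OF selfadjoint_outer[of "e j"]]]
      mx.frame_mat_hermitian[OF selfadjoint_outer] mn.frame_mat_hermitian[OF selfadjoint_outer]
    unfolding span B_def C_def by simp_all
  have "\<not> joint_numerical_range_mat (card F) n B \<inter> joint_numerical_range_mat (card G) n C \<subseteq> {0\<^sub>v n}"
    if n: "n \<ge> Suc k" for n
  proof -
    define c where "c = vec n (\<lambda>j. complex_of_real (a j))"
    have "c = vec n (\<lambda>j. trace_mat (mx.frame_mat (list_op ws) * B j))"
      unfolding c_def B_def mx.trace_frame_mat_list_op[unfolded span, OF ws(1)] ws(3) vec_density_def ..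
    then have "c \<in> joint_numerical_range_mat (card F) n B"
      unfolding joint_numerical_range_mat_def
      using mx.frame_mat_list_op_density[unfolded span, OF ws(1,2)] by blast
    moreover have "c = vec n (\<lambda>j. trace_mat (mn.frame_mat (list_op us) * C j))"
      unfolding c_def C_def mn.trace_frame_mat_list_op[unfolded span, OF us(1)] us(3) vec_density_def ..
    then have "c \<in> joint_numerical_range_mat (card G) n C"
      unfolding joint_numerical_range_mat_def
      using mn.frame_mat_list_op_density[unfolded span, OF us(1,2)] by blast
    moreover have "c \<noteq> 0\<^sub>v n"
    proof
      assume "c = 0\<^sub>v n"
      then have "c $ k = 0\<^sub>v n $ k" by simp
      then show False using n k by (simp add: c_def)
    qed
    ultimately show ?thesis by blast
  qed
  then show ?thesis
    unfolding dim
    using mx.cstar_iso_corner_op[unfolded span] mn.cstar_iso_corner_op[unfolded span] B C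
    by (intro exI[of _ "Suc k"] exI[of _ mx.corner_op] exI[of _ mn.corner_op] exI[of _ B] exI[of _ C]
        conjI allI impI)
qed

text \<open>Each common vector of length \<open>n\<close> comes from two states, whose vector
  systems agree on the first \<open>n\<close> coordinates only. This suffices for
  \<open>norm_minimal\<close> without passing to a limit of systems.\<close>

lemma matrix_ranges_imp_norm_minimal:
  assumes nz: "A x \<noteq> 0"
    and U: "cstar_iso_corner r Smax U" "cstar_iso_corner s Smin V"
    and B: "\<And>j. B j = inv_into (carrier_mat r r) U (compression Smax (outer (e j)))"
    and C: "\<And>j. C j = inv_into (carrier_mat s s) V (compression Smin (outer (e j)))"
    and meet: "\<And>n. n \<ge> m \<Longrightarrow>
      \<not> joint_numerical_range_mat r n B \<inter> joint_numerical_range_mat s n C \<subseteq> {0\<^sub>v n}"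
  shows norm_minimal
proof (rule partial_moments_imp_norm_minimal)
  obtain F G where F: "finite F" "orthonormal_set F" "complex_vector.span F = Smax"
    and G: "finite G" "orthonormal_set G" "complex_vector.span G = Smin"
    using eig_basis(1,2)[OF nz] by blast
  fix n assume "n \<ge> m"
  then obtain c where c: "c \<in> joint_numerical_range_mat r n B" "c \<in> joint_numerical_range_mat s n C"
    using meet by blast
  obtain R where R: "R \<in> density_mats r" "c = vec n (\<lambda>j. trace_mat (R * B j))"
    using c(1) unfolding joint_numerical_range_mat_def by blast
  obtain T where T: "T \<in> density_mats s" "c = vec n (\<lambda>j. trace_mat (T * C j))"
    using c(2) unfolding joint_numerical_range_mat_def by blast
  obtain ws where ws: "set ws \<subseteq> Smax" "mass ws = 1"
    "\<forall>j. trace_mat (R * B j) = of_real (vec_density e ws j)"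
    using corner_state_vector_system[OF F(1,2), unfolded F(3), OF U(1) R(1), of e] unfolding B by blast
  obtain us where us: "set us \<subseteq> Smin" "mass us = 1"
    "\<forall>j. trace_mat (T * C j) = of_real (vec_density e us j)"
    using corner_state_vector_system[OF G(1,2), unfolded G(3), OF U(2) T(1), of e] unfolding C by blast
  have "vec_density e ws k = vec_density e us k" if "k < n" for k
  proof -
    have "c $ k = of_real (vec_density e ws k)" "c $ k = of_real (vec_density e us k)"
      using that ws(3) us(3) by (simp add: R(2), simp add: T(2))
    then show ?thesis by (simp only: of_real_eq_iff)
  qed
  then show "\<exists>ws us. set ws \<subseteq> Smax \<and> set us \<subseteq> Smin \<and> mass ws = 1 \<and> mass us = 1 \<and>
    (\<forall>k<n. vec_density e ws k = vec_density e us k)"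
    using ws(1,2) us(1,2) by (intro exI[of _ ws] exI[of _ us] conjI allI impI)
qed

lemma zero_case:
  assumes "A x = 0"
  shows "moment e Smax \<inter> moment e Smin \<noteq> {}"
    "joint_numerical_range e (\<lambda>i. compression Smax (outer (e i))) \<inter>
     joint_numerical_range e (\<lambda>i. compression Smin (outer (e i))) \<noteq> {\<lambda>_. 0}"
proof -
  have S: "Smax = UNIV" "Smin = UNIV"
    using lambda_A by (simp_all add: assms eigenspace_op_def)
  have "vec_density e [e 0] \<in> moment e UNIV"
    unfolding moment_iff[OF complex_vector.subspace_UNIV] by (intro exI[of _ "[e 0]"]) simp
  then obtain a where a: "a \<in> moment e UNIV" by blast
  then show "moment e Smax \<inter> moment e Smin \<noteq> {}" unfolding S by blast
  have "(\<lambda>j. of_real (a j)) \<in> joint_numerical_range e (\<lambda>i. compression UNIV (outer (e i)))"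
    by (rule moment_joint_numerical_range[OF is_orth_proj_UNIV a])
  moreover have "(\<lambda>j. complex_of_real (a j)) \<noteq> (\<lambda>_. 0)"
    using moment_nonzero[OF complex_vector.subspace_UNIV a] by (metis of_real_eq_0_iff)
  ultimately show "joint_numerical_range e (\<lambda>i. compression Smax (outer (e i))) \<inter>
     joint_numerical_range e (\<lambda>i. compression Smin (outer (e i))) \<noteq> {\<lambda>_. 0}"
    unfolding S by blast
qed

lemma norm_minimal_iff_moments: "norm_minimal \<longleftrightarrow> moment e Smax \<inter> moment e Smin \<noteq> {}"
proof (cases "A x = 0")
  case True
  then show ?thesis using zero_case(1) by (simp add: norm_minimal_iff)
next
  case False
  then show ?thesis
    using norm_minimal_imp_moments moments_imp_minimal minimal_imp_norm_minimal by blast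
qed

end

text \<open>For \<open>A x = 0\<close> the corners are the algebra of all bounded operators and
  \<open>dim\<close> of an infinite-dimensional space is 0, so no isomorphism in \<open>s5\<close>
  exists although \<open>s1\<close> holds; this explains the guard. Matrix ranges need not contain
  0, so \<open>s5\<close> demands a nonzero common vector: an inequality with the zero singleton
  would also be met by disjoint ranges.\<close>

theorem theorem6:
  fixes e :: "nat \<Rightarrow> 'h::complex_hilbert"
    and A0 :: "'h \<Rightarrow>\<^sub>L 'h"
    and x :: c0
  defines "A \<equiv> \<lambda>y. A0 + Diag e y"
  defines "Smax \<equiv> eigenspace_op (A x) (lambda_max (A x))"
    and "Smin \<equiv> eigenspace_op (A x) (lambda_min (A x))"
  assumes "orthonormal_basis e"
    and "A0 \<in> compact_sa_ops"
    and "lambda_max (A x) = - lambda_min (A x)"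
  defines "s1 \<equiv> 0 \<in> subdifferential (\<lambda>y. norm (A y)) x"
    and "s2 \<equiv> 0 \<in> {\<phi> + \<psi> | \<phi> \<psi>. \<phi> \<in> subdifferential (\<lambda>y. lambda_max (A y)) x \<and>
                               \<psi> \<in> subdifferential (\<lambda>y. - lambda_min (A y)) x}"
    and "s3 \<equiv> moment e Smax \<inter> moment e Smin \<noteq> {}"
    and "s4 \<equiv> joint_numerical_range e (\<lambda>i. compression Smax (outer (e i))) \<inter>
              joint_numerical_range e (\<lambda>i. compression Smin (outer (e i))) \<noteq> {\<lambda>_. 0}"
    and "s5 \<equiv> let r = complex_vector.dim Smax; s = complex_vector.dim Smin in
           \<exists>m U V B C. cstar_iso_corner r Smax U \<and> cstar_iso_corner s Smin V \<and>
             (\<forall>j. B j \<in> hermitian_mats r \<and>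
                  B j = inv_into (carrier_mat r r) U (compression Smax (outer (e j)))) \<and>
             (\<forall>j. C j \<in> hermitian_mats s \<and>
                  C j = inv_into (carrier_mat s s) V (compression Smin (outer (e j)))) \<and>
             (\<forall>n\<ge>m. \<not> joint_numerical_range_mat r n B \<inter> joint_numerical_range_mat s n C
                        \<subseteq> {0\<^sub>v n})"
    and "s6 \<equiv> \<forall>D. diagonal_op e D \<longrightarrow> norm (A x) \<le> norm (A x + D)"
  shows "(s1 \<longleftrightarrow> s2) \<and> (s1 \<longleftrightarrow> s3) \<and> (s1 \<longleftrightarrow> s4) \<and> (A x \<noteq> 0 \<longrightarrow> (s1 \<longleftrightarrow> s5)) \<and> (s1 \<longleftrightarrow> s6)"
proof -
  interpret M: minimality e A0 x
    using \<open>orthonormal_basis e\<close> \<open>A0 \<in> compact_sa_ops\<close> \<open>lambda_max (A x) = - lambda_min (A x)\<close>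
    unfolding A_def by unfold_locales
  have s13: "s1 \<longleftrightarrow> s3"
    unfolding s1_def s3_def Smax_def Smin_def A_def by (rule M.norm_minimal_iff_moments)
  moreover have "s3 \<Longrightarrow> s2"
    unfolding s3_def s2_def Smax_def Smin_def A_def
    using M.moments_imp_subdifferentials by (intro CollectI)
  moreover have "s2 \<Longrightarrow> s1"
    unfolding s1_def s2_def A_def
    by (elim CollectE exE conjE) (rule M.subdifferentials_imp_norm_minimal)
  moreover have "s3 \<longleftrightarrow> s4"
  proof (cases "A0 + Diag e x = 0")
    case True
    from M.zero_case[OF this] show ?thesis
      unfolding s3_def s4_def Smax_def Smin_def A_def by blast
  next
    case False
    from M.moments_iff_joint_numerical_ranges[OF this] show ?thesis
      unfolding s3_def s4_def Smax_def Smin_def A_def .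
  qed
  moreover have "s3 \<Longrightarrow> s6"
    unfolding s3_def s6_def Smax_def Smin_def A_def
    by (intro allI impI) (rule M.moments_imp_minimal)
  moreover have "s6 \<Longrightarrow> s1"
    unfolding s1_def s6_def A_def by (rule M.minimal_imp_norm_minimal) (erule allE, erule mp)
  moreover have "s5" if "A x \<noteq> 0" "s3"
    using M.moments_imp_matrix_ranges that
    unfolding s3_def s5_def Smax_def Smin_def A_def Let_def by this
  moreover have "s1" if nz: "A x \<noteq> 0" and s5
  proof -
    let ?r = "complex_vector.dim Smax" and ?s = "complex_vector.dim Smin"
    obtain m U V B C where
      UV: "cstar_iso_corner ?r Smax U" "cstar_iso_corner ?s Smin V"
      and B: "\<And>j. B j = inv_into (carrier_mat ?r ?r) U (compression Smax (outer (e j)))"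
      and C: "\<And>j. C j = inv_into (carrier_mat ?s ?s) V (compression Smin (outer (e j)))"
      and meet: "\<And>n. n \<ge> m \<Longrightarrow>
        \<not> joint_numerical_range_mat ?r n B \<inter> joint_numerical_range_mat ?s n C \<subseteq> {0\<^sub>v n}"
      using \<open>s5\<close> unfolding s5_def Let_def by (elim exE conjE) blast
    show ?thesis
      using M.matrix_ranges_imp_norm_minimal nz UV B C meet
      unfolding s1_def Smax_def Smin_def A_def by blast
  qed
  ultimately show ?thesis by blast
qed

end
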